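(* Let $w\in C^2([-2,2])$, $\eta>0$, $\mu>0$, $\gamma>0$, $f_r,f_p\in L^2(-1,1)$ and $0<\beta\le\alpha\le2\beta$. Set $$\begin{aligned}F_1(v_r,v_p)=\;&\alpha\,\sharp(S_{v_r})+\beta\,\sharp(S_{\dot v_r}\setminus S_{v_r})+\int_{-1}^1\big(\eta|\ddot v_r|^2-f_rv_r\big)\,dx\\&+\mu\int_{-1}^1|v_r-v_p|^2\,dx+\int_{-1}^1\big(\gamma|v_p''|^2-f_pv_p\big)\,dx\end{aligned}$$ and $M=\min\{F_1(v_r,v_p):\ v_r-w\in H^2_0(-1,1),\ v_p-w\in H^2_0(-1,1)\}$, which satisfies $-\infty<M<+\infty$. Assume $$\frac{1}{4\mu}\|f_r\|_{L^2(-1,1)}^2+\frac{C_P}{2\gamma}\|f_r+f_p\|_{L^2(-1,1)}^2+\gamma\|w''\|_{L^2(-1,1)}^2+\int_{-1}^1(f_r+f_p)\,w\,dx<\beta-M.$$ Then there is a unique minimizer $(u_r,u_p)$ of $F_1$ over the pairs $(v_r,v_p)\in\mathbf{H}^2(-2,2)\times H^2(-2,2)$ with $v_r=v_p=w$ in $(-2,-1)\cup(1,2)$, and this minimizer satisfies $S_{u_r}\cup S_{\dot u_r}=\emptyset$; thus $u_r-w\in H^2_0(-2,2)$.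
   Context: $H^2$, $H^2_0$ are the usual Sobolev spaces. $C_P$ is the best constant such that $\|v\|_{L^2(-1,1)}^2\le C_P\|v''\|_{L^2(-1,1)}^2$ for all $v\in H^2_0(-1,1)$. $\mathbf{H}^2(-2,2)$ is the set of functions $v:(-2,2)\to\mathbb{R}$ that are piecewise $H^2$, i.e. made of finitely many $H^2$ pieces: there is a finite partition $-2=s_0<\dots<s_n=2$ with $v\in H^2(s_{i-1},s_i)$ for each $i$. $\dot v$ is the absolutely continuous part of the distributional derivative $v'$, $\ddot v$ is the absolutely continuous part of $(\dot v)'$; $S_v$ and $S_{\dot v}$ are the sets of discontinuity points of $v$ and $\dot v$ in $(-2,2)$ (possibly including the points $\pm1$); $\sharp$ is the counting measure. In the definition of $M$, functions with $v-w\in H^2_0(-1,1)$ are extended by $w$ outside $(-1,1)$. *)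

theory Defs
  imports "HOL-Analysis.Analysis"
begin

text \<open>
  Elements of function spaces over an interval \<open>(a,b)\<close> are represented by total functions
  \<open>real \<Rightarrow> real\<close>; only the almost-everywhere class of the restriction to \<open>(a,b)\<close> matters,
  and uniqueness statements are to be read up to equality almost everywhere.
\<close>

definition L2 :: "real \<Rightarrow> real \<Rightarrow> (real \<Rightarrow> real) \<Rightarrow> bool" where
  "L2 a b f \<longleftrightarrow> f \<in> borel_measurable (lebesgue_on {a<..<b}) \<and>
     integrable (lebesgue_on {a<..<b}) (\<lambda>x. (f x)\<^sup>2)"

definition L2_norm :: "real \<Rightarrow> real \<Rightarrow> (real \<Rightarrow> real) \<Rightarrow> real" where
  "L2_norm a b f = sqrt (LINT x|lebesgue_on {a<..<b}. (f x)\<^sup>2)"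

definition loc_integrable :: "real \<Rightarrow> real \<Rightarrow> (real \<Rightarrow> real) \<Rightarrow> bool" where
  "loc_integrable a b f \<longleftrightarrow>
     (\<forall>c d. a < c \<and> d < b \<longrightarrow> integrable (lebesgue_on {c..d}) f)"

definition C2_on :: "real \<Rightarrow> real \<Rightarrow> (real \<Rightarrow> real) \<Rightarrow> bool" where
  "C2_on a b w \<longleftrightarrow> (\<exists>w1 w2.
     (\<forall>x\<in>{a..b}. (w has_real_derivative w1 x) (at x within {a..b})) \<and>
     (\<forall>x\<in>{a..b}. (w1 has_real_derivative w2 x) (at x within {a..b})) \<and>
     continuous_on {a..b} w2)"

definition test_fun :: "real \<Rightarrow> real \<Rightarrow> (real \<Rightarrow> real) \<Rightarrow> bool" where
  "test_fun a b \<phi> \<longleftrightarrow> (\<forall>n x. (deriv ^^ n) \<phi> differentiable (at x)) \<and>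
     compact (closure {x. \<phi> x \<noteq> 0}) \<and> closure {x. \<phi> x \<noteq> 0} \<subseteq> {a<..<b}"

definition has_weak_deriv ::
    "real \<Rightarrow> real \<Rightarrow> (real \<Rightarrow> real) \<Rightarrow> (real \<Rightarrow> real) \<Rightarrow> bool" where
  "has_weak_deriv a b v g \<longleftrightarrow> loc_integrable a b v \<and> loc_integrable a b g \<and>
     (\<forall>\<phi>. test_fun a b \<phi> \<longrightarrow>
        (LINT x|lebesgue_on {a<..<b}. v x * deriv \<phi> x) =
        - (LINT x|lebesgue_on {a<..<b}. g x * \<phi> x))"

text \<open>
  The weak derivative is unique almost everywhere; the choice below fixes a representative.
\<close>

definition weak_deriv :: "real \<Rightarrow> real \<Rightarrow> (real \<Rightarrow> real) \<Rightarrow> real \<Rightarrow> real" where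
  "weak_deriv a b v = (SOME g. has_weak_deriv a b v g)"

definition weak_deriv2 :: "real \<Rightarrow> real \<Rightarrow> (real \<Rightarrow> real) \<Rightarrow> real \<Rightarrow> real" where
  "weak_deriv2 a b v = weak_deriv a b (weak_deriv a b v)"

definition H2 :: "real \<Rightarrow> real \<Rightarrow> (real \<Rightarrow> real) \<Rightarrow> bool" where
  "H2 a b v \<longleftrightarrow> L2 a b v \<and>
     (\<exists>g h. has_weak_deriv a b v g \<and> L2 a b g \<and> has_weak_deriv a b g h \<and> L2 a b h)"

definition H2_norm :: "real \<Rightarrow> real \<Rightarrow> (real \<Rightarrow> real) \<Rightarrow> real" where
  "H2_norm a b v = sqrt ((L2_norm a b v)\<^sup>2 + (L2_norm a b (weak_deriv a b v))\<^sup>2 +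
     (L2_norm a b (weak_deriv2 a b v))\<^sup>2)"

text \<open>\<open>H\<^sup>2\<^sub>0\<close> is the closure of the test functions in the \<open>H\<^sup>2\<close> norm.\<close>

definition H20 :: "real \<Rightarrow> real \<Rightarrow> (real \<Rightarrow> real) \<Rightarrow> bool" where
  "H20 a b v \<longleftrightarrow> H2 a b v \<and>
     (\<exists>\<phi>. (\<forall>n. test_fun a b (\<phi> n)) \<and>
          (\<lambda>n. H2_norm a b (\<lambda>x. \<phi> n x - v x)) \<longlonglongrightarrow> 0)"

definition C_P :: real where
  "C_P = Inf {C. \<forall>v. H20 (-1) 1 v \<longrightarrow>
     (L2_norm (-1) 1 v)\<^sup>2 \<le> C * (L2_norm (-1) 1 (weak_deriv2 (-1) 1 v))\<^sup>2}"

definition pw_H2 :: "real \<Rightarrow> real \<Rightarrow> (real \<Rightarrow> real) \<Rightarrow> bool" where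
  "pw_H2 a b v \<longleftrightarrow> (\<exists>(n::nat) (s::nat \<Rightarrow> real). s 0 = a \<and> s n = b \<and>
     (\<forall>i<n. s i < s (Suc i)) \<and> (\<forall>i<n. H2 (s i) (s (Suc i)) v))"

definition finite_singular_measure :: "real measure \<Rightarrow> bool" where
  "finite_singular_measure \<nu> \<longleftrightarrow> finite_measure \<nu> \<and> sets \<nu> = sets borel \<and>
     (\<exists>N\<in>sets borel. emeasure lborel N = 0 \<and> emeasure \<nu> (- N) = 0)"

text \<open>
  The distributional derivative of \<open>v\<close> on \<open>(a,b)\<close> is a finite signed measure with Lebesgue
  decomposition \<open>g dx + (\<nu>\<^sub>1 - \<nu>\<^sub>2)\<close>: the singular part is written as a difference of two finite
  positive singular measures, and \<open>g\<close> is the density of the absolutely continuous part.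
\<close>

definition has_ac_deriv ::
    "real \<Rightarrow> real \<Rightarrow> (real \<Rightarrow> real) \<Rightarrow> (real \<Rightarrow> real) \<Rightarrow> bool" where
  "has_ac_deriv a b v g \<longleftrightarrow> loc_integrable a b v \<and> integrable (lebesgue_on {a<..<b}) g \<and>
     (\<exists>\<nu>\<^sub>1 \<nu>\<^sub>2. finite_singular_measure \<nu>\<^sub>1 \<and> finite_singular_measure \<nu>\<^sub>2 \<and>
        (\<forall>\<phi>. test_fun a b \<phi> \<longrightarrow>
           (LINT x|lebesgue_on {a<..<b}. v x * deriv \<phi> x) =
           - ((LINT x|lebesgue_on {a<..<b}. g x * \<phi> x) +
              ((LINT x|\<nu>\<^sub>1. \<phi> x) - (LINT x|\<nu>\<^sub>2. \<phi> x)))))"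

definition ac_deriv :: "real \<Rightarrow> real \<Rightarrow> (real \<Rightarrow> real) \<Rightarrow> real \<Rightarrow> real" where
  "ac_deriv a b v = (SOME g. has_ac_deriv a b v g)"

text \<open>
  Discontinuity points of an almost-everywhere class: no representative is continuous there.
  For a piecewise \<open>H\<^sup>2\<close> function and its \<open>ac_deriv\<close> these are the points of \<open>(a,b)\<close> where the
  one-sided limits differ.
\<close>

definition disc_set :: "real \<Rightarrow> real \<Rightarrow> (real \<Rightarrow> real) \<Rightarrow> real set" where
  "disc_set a b v = {x \<in> {a<..<b}.
     \<not> (\<exists>u. (AE y in lebesgue_on {a<..<b}. u y = v y) \<and> isCont u x)}"

text \<open>
  \<open>F1\<close> is only evaluated at piecewise \<open>H\<^sup>2\<close> functions \<open>v\<^sub>r\<close>, for which both discontinuity sets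
  are finite, so that \<open>card\<close> is the counting measure.
\<close>

definition F1 :: "real \<Rightarrow> real \<Rightarrow> real \<Rightarrow> real \<Rightarrow> real \<Rightarrow> (real \<Rightarrow> real) \<Rightarrow> (real \<Rightarrow> real) \<Rightarrow>
    (real \<Rightarrow> real) \<Rightarrow> (real \<Rightarrow> real) \<Rightarrow> real" where
  "F1 \<alpha> \<beta> \<eta> \<mu> \<gamma> f\<^sub>r f\<^sub>p v\<^sub>r v\<^sub>p =
     (let dv = ac_deriv (-2) 2 v\<^sub>r; ddv = ac_deriv (-2) 2 dv in
        \<alpha> * real (card (disc_set (-2) 2 v\<^sub>r))
      + \<beta> * real (card (disc_set (-2) 2 dv - disc_set (-2) 2 v\<^sub>r))
      + (LINT x|lebesgue_on {-1<..<1}. \<eta> * \<bar>ddv x\<bar>\<^sup>2 - f\<^sub>r x * v\<^sub>r x)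
      + \<mu> * (LINT x|lebesgue_on {-1<..<1}. \<bar>v\<^sub>r x - v\<^sub>p x\<bar>\<^sup>2)
      + (LINT x|lebesgue_on {-1<..<1}. \<gamma> * \<bar>weak_deriv2 (-2) 2 v\<^sub>p x\<bar>\<^sup>2 - f\<^sub>p x * v\<^sub>p x))"

definition extend_by :: "(real \<Rightarrow> real) \<Rightarrow> (real \<Rightarrow> real) \<Rightarrow> real \<Rightarrow> real" where
  "extend_by w v x = (if x \<in> {-1<..<1} then v x else w x)"

definition jump_free_values :: "real \<Rightarrow> real \<Rightarrow> real \<Rightarrow> real \<Rightarrow> real \<Rightarrow>
    (real \<Rightarrow> real) \<Rightarrow> (real \<Rightarrow> real) \<Rightarrow> (real \<Rightarrow> real) \<Rightarrow> real set" where
  "jump_free_values \<alpha> \<beta> \<eta> \<mu> \<gamma> f\<^sub>r f\<^sub>p w =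
     {F1 \<alpha> \<beta> \<eta> \<mu> \<gamma> f\<^sub>r f\<^sub>p (extend_by w v\<^sub>r) (extend_by w v\<^sub>p) | v\<^sub>r v\<^sub>p.
        H20 (-1) 1 (\<lambda>x. v\<^sub>r x - w x) \<and> H20 (-1) 1 (\<lambda>x. v\<^sub>p x - w x)}"

definition admissible :: "(real \<Rightarrow> real) \<Rightarrow> (real \<Rightarrow> real) \<times> (real \<Rightarrow> real) \<Rightarrow> bool" where
  "admissible w = (\<lambda>(v\<^sub>r, v\<^sub>p). pw_H2 (-2) 2 v\<^sub>r \<and> H2 (-2) 2 v\<^sub>p \<and>
     (AE x in lebesgue_on ({-2<..<-1} \<union> {1<..<2}). v\<^sub>r x = w x \<and> v\<^sub>p x = w x))"

definition minimizer :: "real \<Rightarrow> real \<Rightarrow> real \<Rightarrow> real \<Rightarrow> real \<Rightarrow> (real \<Rightarrow> real) \<Rightarrow> (real \<Rightarrow> real) \<Rightarrow>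
    (real \<Rightarrow> real) \<Rightarrow> (real \<Rightarrow> real) \<Rightarrow> (real \<Rightarrow> real) \<Rightarrow> bool" where
  "minimizer \<alpha> \<beta> \<eta> \<mu> \<gamma> f\<^sub>r f\<^sub>p w u\<^sub>r u\<^sub>p \<longleftrightarrow>
     is_arg_min (\<lambda>(v\<^sub>r, v\<^sub>p). F1 \<alpha> \<beta> \<eta> \<mu> \<gamma> f\<^sub>r f\<^sub>p v\<^sub>r v\<^sub>p) (admissible w) (u\<^sub>r, u\<^sub>p)"

end

theory Submission
  imports Defs
begin

text \<open>
  On an interval \<open>(a,b)\<close> an \<open>H\<^sup>2\<close> function is a double primitive of its second derivative \<open>h\<close>, and it lies in
  \<open>H\<^sup>2\<^sub>0\<close> iff it is \<open>\<integral>\<integral>h\<close> with \<open>\<integral>h = 0\<close> and \<open>\<integral>\<integral>h = 0\<close> at \<open>b\<close>. The jump-free problem is thus the minimization of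
  a strictly convex quadratic functional over a closed subspace of \<open>L\<^sup>2 \<times> L\<^sup>2\<close>: by the parallelogram
  identity minimizing sequences are Cauchy and minimizers are unique. A piecewise \<open>H\<^sup>2\<close> function is a
  double primitive plus finitely many jumps and creases. If there is at least one, it costs at least
  \<open>\<beta>\<close>, while completing the square in \<open>v\<^sub>r - v\<^sub>p\<close> and the inequality defining \<open>C_P\<close> bound the remaining
  terms below by the negative of the left-hand side of the assumption; so such a competitor has energy
  above \<open>M\<close>.
\<close>

section \<open>Smooth functions of compact support\<close>

text \<open>\<open>F1\<close> is evaluated through \<open>ac_deriv\<close> and
  \<open>weak_deriv2\<close>, which are Hilbert choices, so nothing about it can be computed until
  these are known up to null sets. This is why so much rests on \<open>ac_part_unique\<close>, and
  why explicit smooth functions are needed: only a rich supply of test functions separates an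
  absolutely continuous part from a singular one. The normal form \<open>jump_rep2\<close> then
  displays both derivatives and both discontinuity sets. Taking second derivatives as unknowns
  replaces traces and weak compactness by two moment conditions, which are continuous in L2.
  Prescribing \<open>w\<close> on both sides of (-1,1) makes -1 and 1 interior points of (-2,2), so
  jumps and creases there are counted like any others. The constants of the assumption arise thus:
  1/(4 \<mu>) comes from maximizing A S - \<mu> S^2 in S; bounding (w'' + k)^2 below by k^2/2 -
  (w'')^2 costs \<gamma> times the squared norm of w'' and leaves \<gamma>/2 times that of k; this
  remainder absorbs the combined load through Young's inequality, which produces C_P/(2
  \<gamma>).\<close>

lemma smooth_coinduct:
  fixes f :: "real \<Rightarrow> real"
  assumes "f \<in> X"
    and "\<And>g x. g \<in> X \<Longrightarrow> g differentiable (at x)" and "\<And>g. g \<in> X \<Longrightarrow> deriv g \<in> X"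
  shows "(deriv ^^ n) f differentiable (at x)"
proof -
  have "(deriv ^^ n) f \<in> X" using assms(1,3) by (induction n) auto
  then show ?thesis by (rule assms(2))
qed

text \<open>The classical flat function exp(-k/x), with a polynomial factor in 1/x so that the
  family is closed under differentiation.\<close>

definition flat_exp :: "real \<Rightarrow> real poly \<Rightarrow> real \<Rightarrow> real" where
  "flat_exp k p x = (if x > 0 then poly p (1 / x) * exp (- k / x) else 0)"

lemma poly_times_exp_tendsto_0:
  fixes k :: real
  assumes "k > 0"
  shows "((\<lambda>y. poly p y * exp (- k * y)) \<longlongrightarrow> 0) at_top"
proof -
  have *: "((\<lambda>y. coeff p i * (y ^ i * exp (- k * y))) \<longlongrightarrow> 0) at_top" for i
  proof -
    have "((\<lambda>y. (k * y) ^ i / exp (k * y)) \<longlongrightarrow> 0) at_top"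
      by (rule filterlim_compose[OF tendsto_power_div_exp_0])
         (rule filterlim_tendsto_pos_mult_at_top[OF tendsto_const assms filterlim_ident])
    then have "((\<lambda>y. coeff p i / k ^ i * ((k * y) ^ i / exp (k * y))) \<longlongrightarrow> coeff p i / k ^ i * 0) at_top"
      by (intro tendsto_intros)
    then show ?thesis
      using assms by (simp add: power_mult_distrib exp_minus field_simps)
  qed
  have "((\<lambda>y. \<Sum>i\<le>degree p. coeff p i * (y ^ i * exp (- k * y))) \<longlongrightarrow> (\<Sum>i\<le>degree p. 0)) at_top"
    by (intro tendsto_sum *)
  then show ?thesis by (simp add: poly_altdef sum_distrib_right mult.assoc)
qed

text \<open>For x > 0 the chain rule with y = 1/x, y' = -y^2 turns p(y) exp(-k y) into (k y^2 p(y) -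
  y^2 p'(y)) exp(-k y); the two coefficient lists are k y^2 and y^2. Only the origin needs an
  estimate.\<close>

lemma flat_exp_has_derivative:
  assumes k: "k > 0"
  shows "(flat_exp k p has_real_derivative flat_exp k ([:0, 0, k:] * p - [:0, 0, 1:] * pderiv p) x) (at x)"
proof -
  consider "x > 0" | "x < 0" | "x = 0" by linarith
  then show ?thesis
  proof cases
    case 1
    have ev: "\<forall>\<^sub>F y in nhds x. flat_exp k p y = poly p (1 / y) * exp (- k / y)"
      using eventually_nhds_in_open[of "{0<..}" x] 1
      by (auto elim!: eventually_mono simp: flat_exp_def)
    have "((\<lambda>y. poly p (1 / y) * exp (- k / y)) has_real_derivative
        flat_exp k ([:0, 0, k:] * p - [:0, 0, 1:] * pderiv p) x) (at x)"
      using 1 by (auto intro!: derivative_eq_intros DERIV_chain2[OF poly_DERIV]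
          simp: flat_exp_def field_simps power2_eq_square)
    then show ?thesis using DERIV_cong_ev[OF refl ev refl] by blast
  next
    case 2
    have ev: "\<forall>\<^sub>F y in nhds x. flat_exp k p y = 0"
      using eventually_nhds_in_open[of "{..<0}" x] 2
      by (auto elim!: eventually_mono simp: flat_exp_def)
    have "flat_exp k ([:0, 0, k:] * p - [:0, 0, 1:] * pderiv p) x = 0"
      using 2 by (simp add: flat_exp_def)
    then show ?thesis using DERIV_cong_ev[OF refl ev refl] by simp
  next
    case 3
    have L: "((\<lambda>h. flat_exp k p h / h) \<longlongrightarrow> 0) (at_left 0)"
      by (rule tendsto_eventually) (auto simp: flat_exp_def eventually_at_left_field intro: exI[of _ "-1"])
    \<comment> \<open>Dividing by h multiplies the polynomial by y = 1/h, hence the factor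
      \<open>[:0, 1:]\<close>; exponential decay in y wins.\<close>
    have "((\<lambda>h. poly ([:0, 1:] * p) (inverse h) * exp (- k * inverse h)) \<longlongrightarrow> 0) (at_right (0::real))"
      by (rule filterlim_compose[OF poly_times_exp_tendsto_0[OF k] filterlim_inverse_at_top_right])
    moreover have "\<forall>\<^sub>F h in at_right 0. flat_exp k p h / h = poly ([:0, 1:] * p) (inverse h) * exp (- k * inverse h)"
      unfolding eventually_at_right_field
      by (rule exI[of _ 1]) (auto simp: flat_exp_def divide_simps)
    ultimately have R: "((\<lambda>h. flat_exp k p h / h) \<longlongrightarrow> 0) (at_right 0)"
      by (simp add: tendsto_cong)
    have "((\<lambda>h. flat_exp k p h / h) \<longlongrightarrow> 0) (at 0)"
      using L R by (simp add: filterlim_at_split)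
    then show ?thesis using 3 by (simp add: DERIV_def flat_exp_def)
  qed
qed

text \<open>Affine arguments shift and reflect the flat functions, products cut off on both sides,
  and sums are forced by the product rule.\<close>

inductive_set flat_exp_algebra :: "(real \<Rightarrow> real) set" where
  base: "k > 0 \<Longrightarrow> (\<lambda>x. flat_exp k p (\<alpha> * x + \<beta>)) \<in> flat_exp_algebra"
| add: "f \<in> flat_exp_algebra \<Longrightarrow> g \<in> flat_exp_algebra \<Longrightarrow> (\<lambda>x. f x + g x) \<in> flat_exp_algebra"
| mult: "f \<in> flat_exp_algebra \<Longrightarrow> g \<in> flat_exp_algebra \<Longrightarrow> (\<lambda>x. f x * g x) \<in> flat_exp_algebra"

lemma flat_exp_smult: "flat_exp k (smult c p) x = c * flat_exp k p x"
  by (simp add: flat_exp_def)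

lemma flat_exp_algebra_deriv:
  assumes "f \<in> flat_exp_algebra"
  shows "\<exists>g\<in>flat_exp_algebra. \<forall>x. (f has_real_derivative g x) (at x)"
  using assms
proof induction
  case (base k p \<alpha> \<beta>)
  let ?q = "smult \<alpha> ([:0, 0, k:] * p - [:0, 0, 1:] * pderiv p)"
  have "((\<lambda>x. flat_exp k p (\<alpha> * x + \<beta>)) has_real_derivative flat_exp k ?q (\<alpha> * x + \<beta>)) (at x)" for x
    unfolding flat_exp_smult mult.commute[of \<alpha> "flat_exp _ _ _"]
    by (rule DERIV_chain2[OF flat_exp_has_derivative[OF base]]) (auto intro!: derivative_eq_intros)
  then show ?case by (intro bexI[OF _ flat_exp_algebra.base[OF base, of ?q]] allI)
next
  case (add f g)
  then obtain f' g' where "f' \<in> flat_exp_algebra" "g' \<in> flat_exp_algebra"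
    "\<forall>x. (f has_real_derivative f' x) (at x)" "\<forall>x. (g has_real_derivative g' x) (at x)" by blast
  then show ?case
    by (intro bexI[of _ "\<lambda>x. f' x + g' x"]) (auto intro!: derivative_intros flat_exp_algebra.add)
next
  case (mult f g)
  then obtain f' g' where "f' \<in> flat_exp_algebra" "g' \<in> flat_exp_algebra"
    "\<forall>x. (f has_real_derivative f' x) (at x)" "\<forall>x. (g has_real_derivative g' x) (at x)" by blast
  then show ?case
    using mult
    by (intro bexI[of _ "\<lambda>x. f x * g' x + f' x * g x"])
       (auto intro!: DERIV_mult' flat_exp_algebra.add flat_exp_algebra.mult)
qed

text \<open>The class is invariant under \<open>deriv\<close> and consists of differentiable
  functions, so no formula for the n-th derivative is ever required.\<close>

lemma flat_exp_algebra_smooth: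
  assumes "f \<in> flat_exp_algebra"
  shows "(deriv ^^ n) f differentiable (at x)"
proof (rule smooth_coinduct[OF assms])
  fix g x assume "g \<in> flat_exp_algebra"
  then show "g differentiable (at x)"
    using flat_exp_algebra_deriv real_differentiable_def by blast
next
  fix g assume "g \<in> flat_exp_algebra"
  then obtain h where h: "h\<in>flat_exp_algebra" "\<forall>x. (g has_real_derivative h x) (at x)"
    using flat_exp_algebra_deriv by blast
  then have "deriv g = h" by (auto intro!: ext DERIV_imp_deriv)
  then show "deriv g \<in> flat_exp_algebra" using h by simp
qed

text \<open>The usual bump as a product of two flat functions. The parameter \<open>k\<close> is
  kept because letting it tend to 0 flattens the bump to the indicator of (c,d).\<close>

definition bump :: "real \<Rightarrow> real \<Rightarrow> real \<Rightarrow> real \<Rightarrow> real" where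
  "bump k c d x = (if c < x \<and> x < d then exp (- k / (x - c)) * exp (- k / (d - x)) else 0)"

lemma bump_eq_flat_exp: "bump k c d = (\<lambda>x. flat_exp k 1 (1 * x + - c) * flat_exp k 1 (- 1 * x + d))"
  by (auto simp: bump_def flat_exp_def fun_eq_iff add.commute)

lemma test_fun_bump:
  assumes "k > 0" "a < c" "d < b"
  shows "test_fun a b (bump k c d)"
proof -
  have "bump k c d \<in> flat_exp_algebra"
    unfolding bump_eq_flat_exp by (intro flat_exp_algebra.intros assms)
  moreover have "closure {x. bump k c d x \<noteq> 0} \<subseteq> {c..d}"
    by (rule closure_minimal) (auto simp: bump_def split: if_splits)
  moreover have "compact (closure {x. bump k c d x \<noteq> 0})"
    unfolding compact_eq_bounded_closed
    by (intro conjI closed_closure bounded_subset[OF bounded_closed_interval calculation(2)])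
  ultimately show ?thesis
    using assms by (auto simp: test_fun_def flat_exp_algebra_smooth)
qed

lemma bump_bounds: "k > 0 \<Longrightarrow> 0 \<le> bump k c d x" "k > 0 \<Longrightarrow> bump k c d x \<le> 1"
  by (auto simp: bump_def intro!: mult_le_one)

text \<open>Compactness of the support inside the open interval leaves room at both ends; two
  numbers with strict inequalities are easier to use than the closure.\<close>

lemma test_fun_support:
  assumes "test_fun a b \<phi>"
  obtains c d where "a < c" "d < b" "\<And>x. x < c \<Longrightarrow> \<phi> x = 0" "\<And>x. d < x \<Longrightarrow> \<phi> x = 0" "a < b \<Longrightarrow> c < d"
proof -
  let ?K = "closure {x. \<phi> x \<noteq> 0}"
  have K: "compact ?K" "?K \<subseteq> {a<..<b}" using assms by (auto simp: test_fun_def)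
  have nz: "x \<in> ?K" if "\<phi> x \<noteq> 0" for x using that by (intro subsetD[OF closure_subset]) simp
  show ?thesis
  proof (cases "?K = {}")
    case True
    then have z: "\<phi> x = 0" for x using nz by auto
    show ?thesis
    proof (cases "a < b")
      case True
      then show ?thesis using that[of "(2 * a + b) / 3" "(a + 2 * b) / 3"] z by auto
    next
      case False
      then show ?thesis using that[of "a + 1" "b - 1"] z by auto
    qed
  next
    case False
    obtain m where m: "m \<in> ?K" "\<And>x. x \<in> ?K \<Longrightarrow> m \<le> x" using compact_attains_inf[OF K(1) False] by auto
    obtain n where n: "n \<in> ?K" "\<And>x. x \<in> ?K \<Longrightarrow> x \<le> n" using compact_attains_sup[OF K(1) False] by auto
    have mn: "a < m" "m \<le> n" "n < b" using m n K by auto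
    \<comment> \<open>Midpoints between the extreme support points and the end points are strict on
      both sides.\<close>
    show ?thesis
    proof (rule that[of "(a + m) / 2" "(n + b) / 2"])
      show "\<phi> x = 0" if "x < (a + m) / 2" for x using that nz[of x] m(2)[of x] mn by fastforce
      show "\<phi> x = 0" if "(n + b) / 2 < x" for x using that nz[of x] n(2)[of x] mn by fastforce
    qed (use mn in auto)
  qed
qed

lemma test_funI:
  assumes "\<And>n x. (deriv ^^ n) \<phi> differentiable (at x)" "a < c" "d < b"
    and "\<And>x. x < c \<Longrightarrow> \<phi> x = 0" "\<And>x. d < x \<Longrightarrow> \<phi> x = 0"
  shows "test_fun a b \<phi>"
proof -
  have "{x. \<phi> x \<noteq> 0} \<subseteq> {c..d}" using assms(4,5) not_le by fastforce
  then have sub: "closure {x. \<phi> x \<noteq> 0} \<subseteq> {c..d}"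
    by (rule closure_minimal) simp
  moreover have "compact (closure {x. \<phi> x \<noteq> 0})"
    unfolding compact_eq_bounded_closed
    by (intro conjI closed_closure bounded_subset[OF bounded_closed_interval sub])
  ultimately show ?thesis using assms by (auto simp: test_fun_def)
qed

lemma test_fun_has_deriv: "test_fun a b \<phi> \<Longrightarrow> (\<phi> has_real_derivative deriv \<phi> x) (at x)"
  by (metis DERIV_deriv_iff_real_differentiable funpow_0 test_fun_def)

lemma test_fun_continuous: "test_fun a b \<phi> \<Longrightarrow> continuous_on S \<phi>"
  by (meson DERIV_isCont continuous_at_imp_continuous_on test_fun_has_deriv)

lemma test_fun_outside:
  assumes "test_fun a b \<phi>" "x \<notin> {a<..<b}" shows "\<phi> x = 0"
  using assms closure_subset[of "{x. \<phi> x \<noteq> 0}"] by (auto simp: test_fun_def)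

lemma test_fun_mono: "test_fun c d \<phi> \<Longrightarrow> a \<le> c \<Longrightarrow> d \<le> b \<Longrightarrow> test_fun a b \<phi>"
  by (force simp: test_fun_def)

lemma test_fun_deriv:
  assumes "test_fun a b \<phi>" shows "test_fun a b (deriv \<phi>)"
proof -
  obtain c d where cd: "a < c" "d < b" "\<And>x. x < c \<Longrightarrow> \<phi> x = 0" "\<And>x. d < x \<Longrightarrow> \<phi> x = 0"
    using test_fun_support[OF assms] by metis
  have *: "deriv \<phi> x = 0" if "open S" "x \<in> S" "\<And>y. y \<in> S \<Longrightarrow> \<phi> y = 0" for x S
  proof -
    have "\<forall>\<^sub>F y in nhds x. \<phi> y = 0"
      using eventually_nhds_in_open[OF that(1,2)] by eventually_elim (use that in auto)
    then show ?thesis using deriv_cong_ev[of \<phi> "\<lambda>_. 0" x x] by simp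
  qed
  show ?thesis
  proof (rule test_funI[OF _ cd(1,2)])
    show "(deriv ^^ n) (deriv \<phi>) differentiable at x" for n x
      using assms unfolding test_fun_def by (metis comp_apply funpow_Suc_right)
    show "deriv \<phi> x = 0" if "x < c" for x by (rule *[of "{..<c}"]) (use cd that in auto)
    show "deriv \<phi> x = 0" if "d < x" for x by (rule *[of "{d<..}"]) (use cd that in auto)
  qed
qed

lemma test_fun_lincomb:
  assumes "test_fun a b \<phi>" "test_fun a b \<psi>"
  shows "test_fun a b (\<lambda>x. s * \<phi> x + t * \<psi> x)"
proof -
  obtain c d where cd: "a < c" "d < b" "\<And>x. x < c \<Longrightarrow> \<phi> x = 0" "\<And>x. d < x \<Longrightarrow> \<phi> x = 0"
    using test_fun_support[OF assms(1)] by metis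
  obtain c' d' where cd': "a < c'" "d' < b" "\<And>x. x < c' \<Longrightarrow> \<psi> x = 0" "\<And>x. d' < x \<Longrightarrow> \<psi> x = 0"
    using test_fun_support[OF assms(2)] by metis
  have smooth: "(deriv ^^ n) \<phi> differentiable at x" "(deriv ^^ n) \<psi> differentiable at x" for n x
    using assms by (auto simp: test_fun_def)
  have eq: "(deriv ^^ n) (\<lambda>x. s * \<phi> x + t * \<psi> x) = (\<lambda>x. s * (deriv ^^ n) \<phi> x + t * (deriv ^^ n) \<psi> x)" for n
  proof (induction n)
    case (Suc n)
    have D: "((deriv ^^ n) \<phi> has_real_derivative (deriv ^^ Suc n) \<phi> x) (at x)"
      "((deriv ^^ n) \<psi> has_real_derivative (deriv ^^ Suc n) \<psi> x) (at x)" for x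
      using smooth[of n x] by (auto simp: DERIV_deriv_iff_real_differentiable)
    have "((\<lambda>x. s * (deriv ^^ n) \<phi> x + t * (deriv ^^ n) \<psi> x) has_real_derivative
       s * (deriv ^^ Suc n) \<phi> x + t * (deriv ^^ Suc n) \<psi> x) (at x)" for x
      by (intro DERIV_add DERIV_cmult D)
    then show ?case by (simp add: Suc fun_eq_iff DERIV_imp_deriv)
  qed auto
  show ?thesis
  proof (rule test_funI[of _ a "min c c'" "max d d'"])
    show "(deriv ^^ n) (\<lambda>x. s * \<phi> x + t * \<psi> x) differentiable at x" for n x
      unfolding eq using smooth by (intro derivative_intros) auto
  qed (use cd cd' in auto)
qed

lemma test_fun_bounded:
  assumes "test_fun a b \<phi>" obtains B where "\<And>x. \<bar>\<phi> x\<bar> \<le> B"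
proof -
  have "bounded (\<phi> ` {a..b})"
    by (intro compact_imp_bounded compact_continuous_image test_fun_continuous[OF assms]) simp
  then obtain B where B: "\<And>x. x \<in> {a..b} \<Longrightarrow> \<bar>\<phi> x\<bar> \<le> B" unfolding bounded_real by blast
  then have "\<bar>\<phi> x\<bar> \<le> max B 0" for x
    using test_fun_outside[OF assms, of x] B[of x] by (cases "x \<in> {a<..<b}") (auto simp: le_max_iff_disj)
  then show ?thesis using that by blast
qed

lemma test_fun_primitive:
  assumes "\<And>x. (\<Psi> has_real_derivative \<psi> x) (at x)" "test_fun a b \<psi>" "a < c" "d < b"
    "\<And>x. x < c \<Longrightarrow> \<Psi> x = 0" "\<And>x. d < x \<Longrightarrow> \<Psi> x = 0"
  shows "test_fun a b \<Psi>"
proof (rule test_funI[OF _ assms(3-6)])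
  have "deriv \<Psi> = \<psi>" using assms(1) by (auto intro!: ext DERIV_imp_deriv)
  then show "(deriv ^^ n) \<Psi> differentiable at x" for n x
    using assms(1,2) real_differentiable_def unfolding test_fun_def
    by (cases n) (auto simp del: funpow.simps simp add: funpow_Suc_right)
qed

section \<open>Uniqueness of absolutely continuous parts\<close>

abbreviation leb :: "real \<Rightarrow> real \<Rightarrow> real measure" where
  "leb a b \<equiv> lebesgue_on {a<..<b}"

lemma finite_measure_leb: "finite_measure (leb a b)"
  by (rule finite_measure_lebesgue_on) simp

lemma space_leb [simp]: "space (leb a b) = {a<..<b}"
  by simp

lemma leb_measurable_continuous: "continuous_on UNIV f \<Longrightarrow> f \<in> borel_measurable (leb a b)" for f :: "real \<Rightarrow> real"
  by (rule continuous_imp_measurable_on_sets_lebesgue) (auto intro: continuous_on_subset)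

lemma leb_measurable_borel: "f \<in> borel_measurable borel \<Longrightarrow> f \<in> borel_measurable (leb a b)" for f :: "real \<Rightarrow> real"
  by (intro measurable_restrict_space1 measurable_completion) simp

lemma integrable_mult_bounded:
  fixes f \<phi> :: "'a \<Rightarrow> real" and B :: real
  assumes "integrable M f" "\<phi> \<in> borel_measurable M" "\<And>x. x \<in> space M \<Longrightarrow> \<bar>\<phi> x\<bar> \<le> B"
  shows "integrable M (\<lambda>x. f x * \<phi> x)" "integrable M (\<lambda>x. \<phi> x * f x)"
proof -
  have "integrable M (\<lambda>x. B * \<bar>f x\<bar>)" using assms by auto
  then show "integrable M (\<lambda>x. f x * \<phi> x)"
  proof (rule Bochner_Integration.integrable_bound)
    show "AE x in M. norm (f x * \<phi> x) \<le> norm (B * \<bar>f x\<bar>)"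
    proof (rule AE_I2)
      fix x assume x: "x \<in> space M"
      have "\<bar>\<phi> x\<bar> \<le> \<bar>B\<bar>" using assms(3)[OF x] by linarith
      then show "norm (f x * \<phi> x) \<le> norm (B * \<bar>f x\<bar>)"
        by (simp add: abs_mult mult.commute mult_right_mono)
    qed
  qed (use assms in measurable)
  then show "integrable M (\<lambda>x. \<phi> x * f x)" by (simp add: mult.commute)
qed

lemma integrable_leb_bounded:
  fixes f :: "real \<Rightarrow> real"
  assumes "f \<in> borel_measurable (leb a b)" "\<And>x. x \<in> {a<..<b} \<Longrightarrow> \<bar>f x\<bar> \<le> B"
  shows "integrable (leb a b) f"
proof -
  interpret finite_measure "leb a b" by (rule finite_measure_leb)
  show ?thesis by (rule integrable_const_bound[of _ B]) (use assms in auto)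
qed

lemma integrable_leb_continuous:
  assumes "continuous_on {a..b} f" shows "integrable (leb a b) (f :: real \<Rightarrow> real)"
proof -
  have "bounded (f ` {a..b})" by (intro compact_imp_bounded compact_continuous_image assms) simp
  then obtain B where "\<forall>x\<in>{a..b}. \<bar>f x\<bar> \<le> B" unfolding bounded_real by blast
  moreover have "f \<in> borel_measurable (leb a b)"
    by (rule continuous_imp_measurable_on_sets_lebesgue) (auto intro: continuous_on_subset[OF assms])
  ultimately show ?thesis by (intro integrable_leb_bounded[of _ _ _ B]) auto
qed

lemma leb_subinterval:
  assumes "a \<le> c" "d \<le> b"
  shows "(LINT x|leb a b. indicator {c<..<d} x * f x) = (LINT x|leb c d. f x :: real)"
    and "integrable (leb a b) (\<lambda>x. indicator {c<..<d} x * f x) \<longleftrightarrow> integrable (leb c d) f"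
proof -
  have eq: "(\<lambda>x. indicator {a<..<b} x *\<^sub>R (indicator {c<..<d} x * f x)) = (\<lambda>x. indicator {c<..<d} x *\<^sub>R f x)"
    using assms by (auto simp: fun_eq_iff indicator_def)
  show "(LINT x|leb a b. indicator {c<..<d} x * f x) = (LINT x|leb c d. f x :: real)"
    by (simp add: integral_restrict_space eq del: real_scaleR_def)
  show "integrable (leb a b) (\<lambda>x. indicator {c<..<d} x * f x) \<longleftrightarrow> integrable (leb c d) f"
    by (simp add: integrable_restrict_space eq del: real_scaleR_def)
qed

lemma integrable_leb_subinterval:
  assumes "integrable (leb a b) f" "a \<le> c" "d \<le> b" shows "integrable (leb c d) (f :: real \<Rightarrow> real)"
proof -
  have "(indicator {c<..<d} :: real \<Rightarrow> real) \<in> borel_measurable (leb a b)"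
    by (rule leb_measurable_borel) measurable
  then have "integrable (leb a b) (\<lambda>x. indicator {c<..<d} x * f x)"
    by (intro integrable_mult_bounded(2)[of _ _ _ 1] assms) (auto split: split_indicator)
  then show ?thesis using leb_subinterval(2) assms by blast
qed

lemma AE_leb_iff: "(AE x in leb a b. P x) \<longleftrightarrow> (AE x in lebesgue. x \<in> {a<..<b} \<longrightarrow> P x)"
  by (rule AE_restrict_space_iff) simp

lemma integral_leb_FTC:
  assumes "a \<le> b" "\<And>x. x \<in> {a..b} \<Longrightarrow> (F has_real_derivative f x) (at x within {a..b})"
    and "continuous_on {a..b} f"
  shows "(LINT x|leb a b. f x) = F b - F a"
proof -
  have "(f has_integral (F b - F a)) {a..b}"
    using assms by (intro fundamental_theorem_of_calculus)
      (auto simp: has_real_derivative_iff_has_vector_derivative)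
  then have "integral {a<..<b} f = F b - F a"
    unfolding integral_open_interval_real[symmetric] by (rule integral_unique)
  moreover have "(LINT x|leb a b. f x) = integral {a<..<b} f"
    by (rule lebesgue_integral_eq_integral) (auto intro: integrable_leb_continuous assms)
  ultimately show ?thesis by simp
qed

text \<open>The two step kernels are the one that defines a primitive and its transpose, which
  appears after exchanging the order of integration.\<close>

lemma integral_leb_FTC_step:
  assumes "t \<in> {a..b}" "\<And>x. x \<in> {a..b} \<Longrightarrow> (F has_real_derivative f x) (at x within {a..b})"
    and "continuous_on {a..b} f"
  shows "(LINT x|leb a b. of_bool (t < x) * f x) = F b - F t"
    and "(LINT x|leb a b. of_bool (x < t) * f x) = F t - F a"
proof -
  have "(LINT x|leb a b. of_bool (t < x) * f x) = (LINT x|leb a b. indicator {t<..<b} x * f x)"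
    by (rule Bochner_Integration.integral_cong) auto
  also have "\<dots> = (LINT x|leb t b. f x)" using assms by (intro leb_subinterval) auto
  also have "\<dots> = F b - F t"
    using assms(1) by (intro integral_leb_FTC DERIV_subset[OF assms(2)] continuous_on_subset[OF assms(3)]) auto
  finally show "(LINT x|leb a b. of_bool (t < x) * f x) = F b - F t" .
  have "(LINT x|leb a b. of_bool (x < t) * f x) = (LINT x|leb a b. indicator {a<..<t} x * f x)"
    by (rule Bochner_Integration.integral_cong) auto
  also have "\<dots> = (LINT x|leb a t. f x)" using assms by (intro leb_subinterval) auto
  also have "\<dots> = F t - F a"
    using assms(1) by (intro integral_leb_FTC DERIV_subset[OF assms(2)] continuous_on_subset[OF assms(3)]) auto
  finally show "(LINT x|leb a b. of_bool (x < t) * f x) = F t - F a" .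
qed

lemma test_fun_leb_measurable: "test_fun a b \<phi> \<Longrightarrow> \<phi> \<in> borel_measurable (leb c d)"
  by (intro leb_measurable_continuous test_fun_continuous)

lemma integrable_mult_test_fun:
  assumes "integrable (leb c d) f" "test_fun a b \<phi>"
  shows "integrable (leb c d) (\<lambda>x. f x * \<phi> x)"
proof -
  obtain B where B: "\<And>x. \<bar>\<phi> x\<bar> \<le> B" using test_fun_bounded[OF assms(2)] by blast
  show ?thesis
    by (rule integrable_mult_bounded(1)[OF assms(1) test_fun_leb_measurable[OF assms(2)] B])
qed

lemma integrable_test_fun: "test_fun a b \<phi> \<Longrightarrow> integrable (leb c d) \<phi>"
  by (intro integrable_leb_continuous test_fun_continuous)

text \<open>The primitive started to the left of the support is constant to its right, and the
  vanishing mean makes that constant 0.\<close>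

lemma test_fun_primitive_exists:
  assumes \<psi>: "test_fun a b \<psi>" and "a < b" and int0: "(LINT x|leb a b. \<psi> x) = 0"
  obtains \<Psi> where "test_fun a b \<Psi>" "deriv \<Psi> = \<psi>"
proof -
  obtain c d where cd: "a < c" "d < b" "c < d" "\<And>x. x < c \<Longrightarrow> \<psi> x = 0" "\<And>x. d < x \<Longrightarrow> \<psi> x = 0"
    using test_fun_support[OF \<psi>] \<open>a < b\<close> by metis
  \<comment> \<open>The window is enlarged by 1 on each side so that \<open>G\<close> has two-sided
    derivatives throughout [a,b].\<close>
  define G where "G x = integral {a-1..x} \<psi>" for x
  have G': "(G has_real_derivative \<psi> x) (at x within {a-1..b+1})" if "x \<in> {a-1..b+1}" for x
    unfolding G_def by (rule integral_has_real_derivative[OF test_fun_continuous[OF \<psi>] that])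
  have G: "(G has_real_derivative \<psi> x) (at x)" if "x \<in> {a-1<..<b+1}" for x
    using G'[of x] that by (simp add: at_within_Icc_at)
  have left: "G x = 0" if "x < c" for x
  proof -
    have "integral {a-1..x} \<psi> = integral {a-1..x} (\<lambda>_. 0)"
      using that cd by (intro Henstock_Kurzweil_Integration.integral_cong) auto
    then show ?thesis by (simp add: G_def)
  qed
  have "G b - G a = 0"
    using integral_leb_FTC[of a b G \<psi>] int0 \<open>a < b\<close> test_fun_continuous[OF \<psi>]
      DERIV_subset[OF G'] by (simp add: subset_eq)
  then have Gb: "G b = 0" using left[of a] cd by simp
  have right: "G x = 0" if x: "d < x" "x \<le> b + 1" for x
  proof -
    have D: "(G has_real_derivative 0) (at y within {d<..b+1})" if y: "y \<in> {d<..b+1}" for y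
    proof -
      have "{d<..b+1} \<subseteq> {a-1..b+1}" using cd by auto
      then have "(G has_real_derivative \<psi> y) (at y within {d<..b+1})"
        using y cd by (intro DERIV_subset[OF G']) auto
      then show ?thesis using y cd(5) by simp
    qed
    have "\<exists>c. \<forall>y\<in>{d<..b+1}. G y = c"
      by (rule has_field_derivative_zero_constant) (use D in auto)
    then obtain c where c: "\<forall>y\<in>{d<..b+1}. G y = c" by blast
    show ?thesis using Gb c[rule_format, of b] c[rule_format, of x] x cd by simp
  qed
  \<comment> \<open>\<open>G\<close> is controlled only on the enlarged window; cutting it off where
    it already vanishes gives a function differentiable on the whole line.\<close>
  define \<Psi> where "\<Psi> x = (if x \<in> {a<..<b} then G x else 0)" for x
  have eq: "\<Psi> x = G x" if "x \<in> {a-1..b+1}" for x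
    using left[of x] right[of x] that cd by (auto simp: \<Psi>_def)
  have D: "(\<Psi> has_real_derivative \<psi> x) (at x)" for x
  proof (cases "x \<in> {a-1<..<b+1}")
    case True
    have "\<forall>\<^sub>F y in nhds x. \<Psi> y = G y"
      using eventually_nhds_in_open[OF _ True] by (rule eventually_mono) (auto intro: eq)
    from DERIV_cong_ev[OF refl this refl] show ?thesis using G[OF True] by blast
  next
    case False
    have "\<forall>\<^sub>F y in nhds x. \<Psi> y = 0"
    proof -
      have "x \<in> - {a..b}" "open (- {a..b})" using False by auto
      from eventually_nhds_in_open[OF this(2,1)] show ?thesis
        by (rule eventually_mono) (auto simp: \<Psi>_def)
    qed
    from DERIV_cong_ev[OF refl this refl] show ?thesis
      using cd False by (cases "x < c") auto
  qed
  have "test_fun a b \<Psi>"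
    by (rule test_fun_primitive[OF D \<psi> cd(1,2)]) (use left right cd in \<open>auto simp: \<Psi>_def\<close>)
  moreover have "deriv \<Psi> = \<psi>" using D by (auto intro!: DERIV_imp_deriv)
  ultimately show ?thesis using that by blast
qed

lemma integral_bump_pos:
  assumes "k > 0" "a \<le> c" "c < d" "d \<le> b"
  shows "(LINT x|leb a b. bump k c d x) > 0"
proof -
  have int: "integrable (leb c d) (bump k c d)" for c d
    by (intro integrable_leb_continuous test_fun_continuous[OF test_fun_bump[of k "c-1" c d "d+1"]])
       (use assms in auto)
  have "(LINT x|leb a b. bump k c d x) = (LINT x|leb a b. indicator {c<..<d} x * bump k c d x)"
    by (rule Bochner_Integration.integral_cong) (auto simp: bump_def)
  also have "\<dots> = (LINT x|leb c d. bump k c d x)" using assms by (intro leb_subinterval) auto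
  finally have eq: "(LINT x|leb a b. bump k c d x) = (LINT x|leb c d. bump k c d x)" .
  have "(LINT x|leb c d. bump k c d x) \<noteq> 0"
  proof
    assume "(LINT x|leb c d. bump k c d x) = 0"
    then have "AE x in leb c d. bump k c d x = 0"
      using integral_nonneg_eq_0_iff_AE[OF int] bump_bounds assms by auto
    then have "AE x in lebesgue. \<not> x \<in> {c<..<d}"
      unfolding AE_leb_iff by (rule AE_mp) (auto simp: bump_def)
    then have "{c<..<d} \<in> null_sets lebesgue" by (simp add: AE_iff_null_sets)
    then show False using assms by (simp add: null_sets_def)
  qed
  moreover have "(LINT x|leb c d. bump k c d x) \<ge> 0" using bump_bounds assms by simp
  ultimately show ?thesis using eq by linarith
qed

text \<open>Dynkin's theorem: open intervals are stable under intersection and generate the Borel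
  sets, so only disjoint countable unions have to be treated.\<close>

lemma borel_induct_intervals [consumes 1, case_names basic empty compl union]:
  assumes "E \<in> sets borel" and basic: "\<And>c d::real. Q {c<..<d}" and empty: "Q {}"
    and compl: "\<And>A. A \<in> sets borel \<Longrightarrow> Q A \<Longrightarrow> Q (UNIV - A)"
    and union: "\<And>A :: nat \<Rightarrow> real set. disjoint_family A \<Longrightarrow> (\<And>i. A i \<in> sets borel) \<Longrightarrow> (\<And>i. Q (A i)) \<Longrightarrow> Q (\<Union>i. A i)"
  shows "Q E"
proof -
  let ?G = "range (\<lambda>(c, d). {c<..<d::real})"
  have borel: "sets borel = sigma_sets UNIV ?G"
    by (subst borel_eq_box) (simp add: box_real[abs_def])
  have "Int_stable ?G"
  proof (rule Int_stableI)
    fix A B assume "A \<in> ?G" "B \<in> ?G"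
    then obtain c d c' d' where "A = {c<..<d}" "B = {c'<..<d'}" by auto
    then have "A \<inter> B = (\<lambda>(c, d). {c<..<d}) (max c c', min d d')" by auto
    then show "A \<inter> B \<in> ?G" by (rule range_eqI)
  qed
  moreover have "?G \<subseteq> Pow UNIV" by simp
  ultimately show ?thesis using assms(1)[unfolded borel]
  proof (induction rule: sigma_sets_induct_disjoint)
    case (basic A)
    then show ?case using assms(2) by auto
  next
    case (union A)
    then show ?case using assms(5)[of A] borel by auto
  qed (use empty compl borel in auto)
qed

lemma inverse_Suc_tendsto_0: "(\<lambda>n. 1 / real (Suc n)) \<longlonglongrightarrow> 0"
  using LIMSEQ_inverse_real_of_nat by (simp add: inverse_eq_divide)

text \<open>The exponent parameter tends to 0, so the exponentials tend to 1. The shrinking margin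
  keeps each support strictly inside (c,d), so (c,d) may touch the ends of the ambient
  interval.\<close>

lemma bump_tendsto_indicator:
  "(\<lambda>n. bump (1 / Suc n) (c + 1 / Suc n) (d - 1 / Suc n) x) \<longlonglongrightarrow> indicator {c<..<d} x"
proof (cases "x \<in> {c<..<d}")
  case True
  note z = inverse_Suc_tendsto_0
  have l: "(\<lambda>n. exp (- (1 / real (Suc n)) / (x - (c + 1 / real (Suc n)))) * exp (- (1 / real (Suc n)) / ((d - 1 / real (Suc n)) - x)))
     \<longlonglongrightarrow> exp (- 0 / (x - (c + 0))) * exp (- 0 / ((d - 0) - x))"
    using True by (intro tendsto_intros z) auto
  have "\<forall>\<^sub>F n in sequentially. 1 / real (Suc n) < min (x - c) (d - x)"
    using order_tendstoD(2)[OF z, of "min (x - c) (d - x)"] True by simp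
  then have "\<forall>\<^sub>F n in sequentially. exp (- (1 / real (Suc n)) / (x - (c + 1 / real (Suc n)))) * exp (- (1 / real (Suc n)) / ((d - 1 / real (Suc n)) - x)) = bump (1 / Suc n) (c + 1 / Suc n) (d - 1 / Suc n) x"
    by eventually_elim (auto simp: bump_def)
  from tendsto_cong[OF this] l True show ?thesis by simp
next
  case False
  have "bump (1 / Suc n) (c + 1 / Suc n) (d - 1 / Suc n) x = 0" for n
  proof -
    have "\<not> (c + 1 / Suc n < x \<and> x < d - 1 / Suc n)" using False
      by (smt (verit) greaterThanLessThan_iff of_nat_0_less_iff zero_less_divide_1_iff zero_less_Suc)
    then show ?thesis by (auto simp: bump_def)
  qed
  then show ?thesis using False by simp
qed

text \<open>The set where \<open>g\<close> is positive is only Lebesgue measurable, while the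
  hypothesis tests Borel sets (the singular measures know no others). An F-sigma subset of full
  measure in it takes its place, and the integral of the positive part of \<open>g\<close> is then
  at most 0.\<close>

lemma AE_le_0_if_borel_integrals:
  assumes g: "integrable (leb a b) g"
    and le: "\<And>E. E \<in> sets borel \<Longrightarrow> (LINT x|leb a b. indicator E x * g x) \<le> (0::real)"
  shows "AE x in leb a b. g x \<le> 0"
proof -
  have "{x \<in> space (leb a b). g x > 0} \<in> sets (leb a b)"
    using borel_measurable_integrable[OF g] by measurable
  then have "{x \<in> {a<..<b}. g x > 0} \<in> sets lebesgue" by (simp add: sets_restrict_space_iff)
  then obtain C T where CT: "fsigma C" "T \<in> null_sets lebesgue" "C \<union> T = {x \<in> {a<..<b}. g x > 0}" "disjnt C T"
    by (rule lebesgue_set_almost_fsigma)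
  have C: "C \<in> sets borel" using CT(1) by cases (auto intro!: sets.countable_UN borel_closed)
  have mem: "x \<in> C \<or> x \<in> T \<longleftrightarrow> x \<in> {a<..<b} \<and> g x > 0" for x
    using CT(3) by (simp add: set_eq_iff)
  have AE: "AE x in leb a b. indicator C x * g x = max (g x) 0"
  proof -
    have "AE x in leb a b. x \<notin> T" unfolding AE_leb_iff
      using AE_not_in[OF CT(2)] by (rule AE_mp) auto
    moreover have "AE x in leb a b. x \<in> {a<..<b}" by (rule AE_I2) simp
    ultimately show ?thesis
    proof eventually_elim
      case (elim x)
      then have "x \<in> C \<longleftrightarrow> g x > 0" using mem[of x] by blast
      then show ?case by (simp add: indicator_def max_def)
    qed
  qed
  have m: "g \<in> borel_measurable (leb a b)" using g by simp
  have mC: "(\<lambda>x. indicator C x * g x) \<in> borel_measurable (leb a b)"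
    by (intro borel_measurable_times m leb_measurable_borel) (use C in measurable)
  have "(LINT x|leb a b. max (g x) 0) = (LINT x|leb a b. indicator C x * g x)"
    by (rule integral_cong_AE) (use AE m mC in auto)
  also have "\<dots> \<le> 0" by (rule le[OF C])
  finally have "(LINT x|leb a b. max (g x) 0) = 0"
    by (simp add: antisym)
  moreover have "integrable (leb a b) (\<lambda>x. max (g x) 0)" using g by auto
  ultimately have "AE x in leb a b. max (g x) 0 = 0"
    using integral_nonneg_eq_0_iff_AE[of "leb a b" "\<lambda>x. max (g x) 0"] by auto
  then show ?thesis by eventually_elim auto
qed

lemma AE_eq_0_if_borel_integrals:
  assumes g: "integrable (leb a b) g"
    and eq: "\<And>E. E \<in> sets borel \<Longrightarrow> (LINT x|leb a b. indicator E x * g x) = (0::real)"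
  shows "AE x in leb a b. g x = 0"
proof -
  have "AE x in leb a b. g x \<le> 0" by (rule AE_le_0_if_borel_integrals[OF g]) (simp add: eq)
  moreover have "AE x in leb a b. - g x \<le> 0"
    by (rule AE_le_0_if_borel_integrals) (use g eq in auto)
  ultimately show ?thesis by eventually_elim auto
qed

text \<open>Test functions converge boundedly to indicators of open intervals, so the signed measure
  \<open>g dx + (\<Sum>i\<in>K. \<sigma> i \<nu> i)\<close> vanishes on all Borel sets; restricting it to the complement of
  the null sets carrying the \<open>\<nu> i\<close> leaves only \<open>g\<close>.\<close>

lemma ac_part_unique:
  assumes g: "integrable (leb a b) g"
    and K: "finite K" and \<nu>: "\<And>i. i \<in> K \<Longrightarrow> finite_singular_measure (\<nu> i)"
    and eq0: "\<And>\<phi>. test_fun a b \<phi> \<Longrightarrow>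
       (LINT x|leb a b. g x * \<phi> x) + (\<Sum>i\<in>K. \<sigma> i * (LINT x|\<nu> i. \<phi> x)) = 0"
  shows "AE x in leb a b. g x = 0"
proof -
  have fin: "finite_measure (\<nu> i)" and sets\<nu>: "sets (\<nu> i) = sets borel" if "i \<in> K" for i
    using \<nu>[OF that] by (auto simp: finite_singular_measure_def)
  have "\<forall>i\<in>K. \<exists>N\<in>sets borel. emeasure lborel N = 0 \<and> emeasure (\<nu> i) (- N) = 0"
    using \<nu> by (simp add: finite_singular_measure_def)
  then obtain N where N: "\<And>i. i \<in> K \<Longrightarrow> N i \<in> sets borel" "\<And>i. i \<in> K \<Longrightarrow> emeasure lborel (N i) = 0"
    "\<And>i. i \<in> K \<Longrightarrow> emeasure (\<nu> i) (- N i) = 0"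
    by metis
  let ?I = "{a<..<b}"
  \<comment> \<open>The measures live on the whole line but test functions only see (a,b); hence the
    intersection with \<open>?I\<close>.\<close>
  define D where "D E = (LINT x|leb a b. indicator E x * g x) + (\<Sum>i\<in>K. \<sigma> i * measure (\<nu> i) (E \<inter> ?I))" for E
  have gm: "g \<in> borel_measurable (leb a b)" using g by simp
  have ind_m: "(\<lambda>x. indicator E x * g x) \<in> borel_measurable (leb a b)" if "E \<in> sets borel" for E
    by (intro borel_measurable_times gm leb_measurable_borel) (use that in measurable)
  have ind_int: "integrable (leb a b) (\<lambda>x. indicator E x * g x)" if "E \<in> sets borel" for E
    by (rule integrable_mult_bounded[of _ _ _ 1])
       (use g that in \<open>auto intro!: leb_measurable_borel simp: indicator_def\<close>)
  have D_sub: "D {c<..<d} = 0" if cd: "a \<le> c" "d \<le> b" for c d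
  proof -
    define \<phi> where "\<phi> n = bump (1 / Suc n) (c + 1 / Suc n) (d - 1 / Suc n)" for n
    have \<phi>lim: "(\<lambda>n. \<phi> n x) \<longlonglongrightarrow> indicator {c<..<d} x" for x
      unfolding \<phi>_def by (rule bump_tendsto_indicator)
    have test: "test_fun a b (\<phi> n)" for n
    proof -
      have "1 / real (Suc n) > 0" by simp
      then have "a < c + 1 / real (Suc n)" "d - 1 / real (Suc n) < b" using cd by linarith+
      then show ?thesis unfolding \<phi>_def by (intro test_fun_bump) simp
    qed
    have bnd: "\<bar>\<phi> n x\<bar> \<le> 1" for n x
      unfolding \<phi>_def using bump_bounds[of "1 / Suc n"] by (simp add: abs_le_iff order.trans[OF _ bump_bounds(1)])
    have bm: "\<phi> n \<in> borel_measurable borel" for n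
      by (intro borel_measurable_continuous_onI test_fun_continuous[OF test])
    have 1: "(\<lambda>n. LINT x|leb a b. g x * \<phi> n x) \<longlonglongrightarrow> (LINT x|leb a b. indicator {c<..<d} x * g x)"
    proof (rule integral_dominated_convergence)
      show "integrable (leb a b) (\<lambda>x. \<bar>g x\<bar>)" using g by simp
      show "AE x in leb a b. (\<lambda>n. g x * \<phi> n x) \<longlonglongrightarrow> indicator {c<..<d} x * g x"
        by (rule AE_I2) (subst mult.commute, intro tendsto_intros \<phi>lim)
      show "AE x in leb a b. norm (g x * \<phi> n x) \<le> \<bar>g x\<bar>" for n
        using bnd[of n] by (intro AE_I2) (auto simp: abs_mult intro: mult_right_le_one_le)
      show "(\<lambda>x. g x * \<phi> n x) \<in> borel_measurable (leb a b)" for n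
        by (intro borel_measurable_times gm leb_measurable_borel bm)
    qed (rule ind_m, simp)
    have 2: "(\<lambda>n. LINT x|\<nu>. \<phi> n x) \<longlonglongrightarrow> measure \<nu> ({c<..<d} \<inter> ?I)" if "finite_measure \<nu>" "sets \<nu> = sets borel" for \<nu>
    proof -
      interpret finite_measure \<nu> by fact
      have sp: "space \<nu> = UNIV" using sets_eq_imp_space_eq[OF that(2)] by auto
      have "(\<lambda>n. LINT x|\<nu>. \<phi> n x) \<longlonglongrightarrow> (LINT x|\<nu>. indicator {c<..<d} x)"
        by (rule integral_dominated_convergence[where w="\<lambda>_. 1"])
           (use \<phi>lim bnd bm that(2) in \<open>auto simp: measurable_cong_sets[OF that(2) refl]\<close>)
      moreover have "{c<..<d} \<inter> ?I = {c<..<d}" using cd by auto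
      ultimately show ?thesis using sp that(2) by simp
    qed
    have "(\<lambda>n. (LINT x|leb a b. g x * \<phi> n x) + (\<Sum>i\<in>K. \<sigma> i * (LINT x|\<nu> i. \<phi> n x))) \<longlonglongrightarrow> D {c<..<d}"
      unfolding D_def by (intro tendsto_intros 1 2 fin sets\<nu>)
    then show ?thesis by (simp add: eq0[OF test] LIMSEQ_const_iff)
  qed
  have D_Int: "D (E \<inter> ?I) = D E" for E
    unfolding D_def by (intro arg_cong2[where f="(+)"] Bochner_Integration.integral_cong) (auto simp: indicator_def)
  have D_basic: "D {c<..<d} = 0" for c d
  proof -
    have "{c<..<d} \<inter> ?I = {max a c<..<min b d}" by auto
    then show ?thesis using D_Int[of "{c<..<d}"] D_sub[of "max a c" "min b d"] by simp
  qed
  have D_UNIV: "D UNIV = 0" using D_Int[of UNIV] D_sub[of a b] by simp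
  have D_borel: "D E = 0" if "E \<in> sets borel" for E
  proof -
    from that show ?thesis
    proof (induction rule: borel_induct_intervals)
      case (basic c d)
      show ?case by (rule D_basic)
    next
      case empty
      show ?case by (simp add: D_def)
    next
      case (compl A)
      then have A: "A \<in> sets borel" by simp
      have "(LINT x|leb a b. indicator (UNIV - A) x * g x) = (LINT x|leb a b. indicator UNIV x * g x - indicator A x * g x)"
        by (rule Bochner_Integration.integral_cong) (auto simp: indicator_def)
      also have "\<dots> = (LINT x|leb a b. indicator UNIV x * g x) - (LINT x|leb a b. indicator A x * g x)"
        by (intro Bochner_Integration.integral_diff ind_int A) simp
      finally have 1: "(LINT x|leb a b. indicator (UNIV - A) x * g x) = \<dots>" .
      have 2: "measure \<nu> ((UNIV - A) \<inter> ?I) = measure \<nu> (UNIV \<inter> ?I) - measure \<nu> (A \<inter> ?I)"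
        if "finite_measure \<nu>" "sets \<nu> = sets borel" for \<nu>
      proof -
        interpret finite_measure \<nu> by fact
        have "(UNIV - A) \<inter> ?I = ?I - A \<inter> ?I" by auto
        then show ?thesis using A that(2) by (simp add: finite_measure_Diff)
      qed
      show ?case using compl(2) D_UNIV unfolding D_def 1
        by (simp add: 2[OF fin sets\<nu>] right_diff_distrib sum_subtractf cong: sum.cong)
    next
      case (union A)
      then have A: "A i \<in> sets borel" for i by simp
      have U: "(\<Union>i. A i) \<in> sets borel" using A by blast
      have 1: "(\<lambda>i. LINT x|leb a b. indicator (A i) x * g x) sums (LINT x|leb a b. indicator (\<Union>i. A i) x * g x)"
        unfolding sums_def
      proof -
        have eq: "(\<Sum>i<n. LINT x|leb a b. indicator (A i) x * g x) = (LINT x|leb a b. indicator (\<Union>i<n. A i) x * g x)" for n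
        proof -
          have "(\<Sum>i<n. LINT x|leb a b. indicator (A i) x * g x) = (LINT x|leb a b. (\<Sum>i<n. indicator (A i) x * g x))"
            by (rule Bochner_Integration.integral_sum[symmetric]) (rule ind_int[OF A])
          also have "\<dots> = (LINT x|leb a b. indicator (\<Union>i<n. A i) x * g x)"
            by (rule Bochner_Integration.integral_cong)
               (simp_all add: sum_distrib_right[symmetric] indicator_UN_disjoint disjoint_family_on_mono[OF subset_UNIV union(1)])
          finally show ?thesis .
        qed
        show "(\<lambda>n. \<Sum>i<n. LINT x|leb a b. indicator (A i) x * g x) \<longlonglongrightarrow> (LINT x|leb a b. indicator (\<Union>i. A i) x * g x)"
          unfolding eq
        proof (rule integral_dominated_convergence)
          show "integrable (leb a b) (\<lambda>x. \<bar>g x\<bar>)" using g by simp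
          show "AE x in leb a b. (\<lambda>n. indicator (\<Union>i<n. A i) x * g x) \<longlonglongrightarrow> indicator (\<Union>i. A i) x * g x"
            by (rule AE_I2) (intro tendsto_intros LIMSEQ_indicator_UN)
          show "AE x in leb a b. norm (indicator (\<Union>i<n. A i) x * g x) \<le> \<bar>g x\<bar>" for n
            by (auto simp: indicator_def)
          show "(\<lambda>x. indicator (\<Union>i<n. A i) x * g x) \<in> borel_measurable (leb a b)" for n
            by (rule ind_m) (use A in auto)
        qed (rule ind_m[OF U])
      qed
      have 2: "(\<lambda>i. measure \<nu> (A i \<inter> ?I)) sums measure \<nu> ((\<Union>i. A i) \<inter> ?I)"
        if "finite_measure \<nu>" "sets \<nu> = sets borel" for \<nu>
      proof -
        interpret finite_measure \<nu> by fact
        have "(\<lambda>i. measure \<nu> (A i \<inter> ?I)) sums measure \<nu> (\<Union>i. A i \<inter> ?I)"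
          by (rule finite_measure_UNION)
             (use A that(2) disjoint_family_on_bisimulation[OF union(1), of "\<lambda>i. A i \<inter> ?I"] in auto)
        then show ?thesis by (simp add: Int_UN_distrib2)
      qed
      have "(\<lambda>i. D (A i)) sums D (\<Union>i. A i)"
        unfolding D_def by (intro sums_add sums_sum sums_mult 1 2 fin sets\<nu>)
      then show ?case using union(3) by (simp add: sums_iff)
    qed
  qed
  have null: "(\<Union>i\<in>K. N i) \<in> null_sets lebesgue"
    using N K by (intro null_sets.finite_UN) (auto simp: null_sets_def)
  show ?thesis
  proof (rule AE_eq_0_if_borel_integrals[OF g])
    fix E :: "real set" assume E: "E \<in> sets borel"
    define E' where "E' = E - (\<Union>i\<in>K. N i)"
    have E': "E' \<in> sets borel" unfolding E'_def using E N K by (intro sets.Diff sets.finite_UN) auto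
    have 1: "measure (\<nu> i) (E' \<inter> ?I) = 0" if i: "i \<in> K" for i
    proof -
      have "measure (\<nu> i) (E' \<inter> ?I) \<le> measure (\<nu> i) (- N i)"
        by (rule finite_measure.finite_measure_mono[OF fin[OF i]]) (use i N(1)[OF i] sets\<nu>[OF i] in \<open>auto simp: E'_def\<close>)
      moreover have "measure (\<nu> i) (- N i) = 0" using N(3)[OF i] by (simp add: measure_def)
      ultimately show ?thesis using measure_nonneg[of "\<nu> i" "E' \<inter> ?I"] by linarith
    qed
    have "(LINT x|leb a b. indicator E x * g x) = (LINT x|leb a b. indicator E' x * g x)"
    proof (rule integral_cong_AE[OF ind_m[OF E] ind_m[OF E']])
      show "AE x in leb a b. indicator E x * g x = indicator E' x * g x"
        unfolding AE_leb_iff using AE_not_in[OF null] by eventually_elim (auto simp: E'_def indicator_def)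
    qed
    also have "\<dots> = 0" using D_borel[OF E'] 1 by (simp add: D_def)
    finally show "(LINT x|leb a b. indicator E x * g x) = 0" .
  qed
qed

text \<open>The fundamental lemma of the calculus of variations, as the case without singular
  measures.\<close>

lemma test_integral_zero_imp_AE:
  assumes "integrable (leb a b) g" "\<And>\<phi>. test_fun a b \<phi> \<Longrightarrow> (LINT x|leb a b. g x * \<phi> x) = 0"
  shows "AE x in leb a b. g x = 0"
  by (rule ac_part_unique[OF assms(1), of "{}"]) (simp_all add: assms)

text \<open>Every test function becomes the derivative of a test function after subtracting the
  multiple of a fixed bump \<open>\<rho>\<close> that has the same mean. So \<open>u\<close> minus
  its \<open>\<rho>\<close>-weighted mean \<open>C\<close> is orthogonal to all test
  functions.\<close>

lemma du_Bois_Reymond: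
  assumes u: "integrable (leb a b) u" and "a < b"
    and eq0: "\<And>\<phi>. test_fun a b \<phi> \<Longrightarrow> (LINT x|leb a b. u x * deriv \<phi> x) = 0"
  obtains C where "AE x in leb a b. u x = C"
proof -
  define \<rho> where "\<rho> = bump 1 ((2*a+b)/3) ((a+2*b)/3)"
  have \<rho>: "test_fun a b \<rho>" unfolding \<rho>_def using \<open>a < b\<close> by (intro test_fun_bump) auto
  define m where "m = (LINT x|leb a b. \<rho> x)"
  have m: "m > 0" unfolding m_def \<rho>_def using \<open>a < b\<close> by (intro integral_bump_pos) auto
  define C where "C = (LINT x|leb a b. u x * \<rho> x) / m"
  interpret finite_measure "leb a b" by (rule finite_measure_leb)
  have "AE x in leb a b. u x - C = 0"
  proof (rule test_integral_zero_imp_AE)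
    show "integrable (leb a b) (\<lambda>x. u x - C)" using u by simp
    fix \<psi> assume \<psi>: "test_fun a b \<psi>"
    define s where "s = - (LINT x|leb a b. \<psi> x) / m"
    have t: "test_fun a b (\<lambda>x. 1 * \<psi> x + s * \<rho> x)" by (rule test_fun_lincomb[OF \<psi> \<rho>])
    have "(LINT x|leb a b. 1 * \<psi> x + s * \<rho> x) = (LINT x|leb a b. \<psi> x) + s * m"
      using integrable_test_fun[OF \<psi>] integrable_test_fun[OF \<rho>] by (simp add: m_def)
    also have "\<dots> = 0" using m by (simp add: s_def)
    finally obtain \<Psi> where \<Psi>: "test_fun a b \<Psi>" "deriv \<Psi> = (\<lambda>x. 1 * \<psi> x + s * \<rho> x)"
      using test_fun_primitive_exists[OF t \<open>a < b\<close>] by metis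
    have "0 = (LINT x|leb a b. u x * \<psi> x + s * (u x * \<rho> x))"
      using eq0[OF \<Psi>(1)] unfolding \<Psi>(2) by (simp add: algebra_simps)
    also have "\<dots> = (LINT x|leb a b. u x * \<psi> x) + s * (LINT x|leb a b. u x * \<rho> x)"
      using integrable_mult_test_fun[OF u \<psi>] integrable_mult_test_fun[OF u \<rho>] by simp
    also have "\<dots> = (LINT x|leb a b. u x * \<psi> x) - C * (LINT x|leb a b. \<psi> x)"
      using m by (simp add: C_def s_def)
    also have "\<dots> = (LINT x|leb a b. (u x - C) * \<psi> x)"
      using integrable_mult_test_fun[OF u \<psi>] integrable_test_fun[OF \<psi>] by (simp add: algebra_simps)
    finally show "(LINT x|leb a b. (u x - C) * \<psi> x) = 0" by simp
  qed
  then have "AE x in leb a b. u x = C" by eventually_elim simp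
  then show ?thesis using that by blast
qed

section \<open>Primitives and jump functions\<close>

text \<open>Completeness makes measurability stable under changes on null sets, which is
  indispensable when representatives are picked by choice and known only almost everywhere.\<close>

lemma complete_measure_leb: "complete_measure (leb a b)"
proof
  fix A B assume AB: "B \<subseteq> A" "A \<in> null_sets (leb a b)"
  then have "A \<in> null_sets lebesgue" "A \<subseteq> {a<..<b}"
    by (auto simp: null_sets_restrict_space)
  then have "B \<in> sets lebesgue" using AB(1) completion.complete2 by blast
  then show "B \<in> sets (leb a b)" using AB(1) \<open>A \<subseteq> {a<..<b}\<close>
    by (simp add: sets_restrict_space_iff)
qed

lemma leb_measurable_AE_cong:
  assumes "f \<in> borel_measurable (leb a b)" "AE x in leb a b. f x = g x"
  shows "g \<in> borel_measurable (leb a b)"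
proof (rule measurableI)
  fix A :: "'a set" assume A: "A \<in> sets borel"
  have "f -` A \<inter> space (leb a b) \<in> sets (leb a b)" using measurable_sets[OF assms(1) A] .
  moreover have "AE x in leb a b. x \<in> f -` A \<inter> space (leb a b) \<longleftrightarrow> x \<in> g -` A \<inter> space (leb a b)"
    using assms(2) by eventually_elim auto
  ultimately show "g -` A \<inter> space (leb a b) \<in> sets (leb a b)"
    using complete_measure.in_sets_AE[OF complete_measure_leb] by blast
qed simp

lemma integrable_leb_AE_cong:
  fixes f :: "real \<Rightarrow> real"
  assumes "integrable (leb a b) f" "AE x in leb a b. f x = g x"
  shows "integrable (leb a b) g"
  using integrable_cong_AE_imp[OF assms(1) leb_measurable_AE_cong[OF _ assms(2)]] assms by auto

text \<open>No measurability is assumed: by completeness both functions are measurable or neither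
  is, and in the latter case both integrals have the default value 0.\<close>

lemma integral_leb_AE_cong:
  fixes f :: "real \<Rightarrow> real"
  assumes eq: "AE x in leb a b. f x = g x"
  shows "(LINT x|leb a b. f x) = (LINT x|leb a b. g x)"
proof (cases "f \<in> borel_measurable (leb a b)")
  case True
  then show ?thesis using leb_measurable_AE_cong[OF True eq] eq by (intro integral_cong_AE)
next
  case False
  moreover have "AE x in leb a b. g x = f x" using eq by eventually_elim simp
  ultimately have "g \<notin> borel_measurable (leb a b)" using leb_measurable_AE_cong by blast
  then show ?thesis using False by (metis borel_measurable_integrable not_integrable_integral_eq)
qed

text \<open>The primitive vanishing at \<open>a\<close>, written with a step kernel over a fixed
  measure so that dominated convergence and Fubini apply directly. It is constant to the left of
  \<open>a\<close> and to the right of \<open>b\<close>.\<close>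

definition prim :: "real \<Rightarrow> real \<Rightarrow> (real \<Rightarrow> real) \<Rightarrow> real \<Rightarrow> real" where
  "prim a b g x = (LINT t|leb a b. of_bool (t < x) * g t)"

lemma of_bool_less_measurable:
  "(\<lambda>t. of_bool (t < x) :: real) \<in> borel_measurable (leb a b)"
  "(\<lambda>t. of_bool (x < t) :: real) \<in> borel_measurable (leb a b)"
  by (rule leb_measurable_borel; measurable)+

lemma integrable_of_bool_less:
  fixes g :: "real \<Rightarrow> real"
  assumes "integrable (leb a b) g"
  shows "integrable (leb a b) (\<lambda>t. of_bool (t < x) * g t)" "integrable (leb a b) (\<lambda>t. of_bool (x < t) * g t)"
  by (intro integrable_mult_bounded(2)[where B=1] assms of_bool_less_measurable; simp)+

text \<open>Dominated convergence: when y tends to x, the kernel at t converges for every t other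
  than x.\<close>

lemma prim_isCont:
  assumes g: "integrable (leb a b) g"
  shows "isCont (prim a b g) x"
  unfolding continuous_at_sequentially
proof (intro allI impI)
  fix y assume y: "y \<longlonglongrightarrow> x"
  show "(prim a b g \<circ> y) \<longlonglongrightarrow> prim a b g x"
    unfolding comp_def prim_def
  proof (rule integral_dominated_convergence)
    show "integrable (leb a b) (\<lambda>t. \<bar>g t\<bar>)" using g by simp
    have "AE t in lebesgue. t \<noteq> x" by (rule AE_not_in[of "{x}", simplified]) (simp add: null_sets_def)
    then have "AE t in leb a b. t \<noteq> x" unfolding AE_leb_iff by eventually_elim simp
    then show "AE t in leb a b. (\<lambda>n. of_bool (t < y n) * g t) \<longlonglongrightarrow> of_bool (t < x) * g t"
    proof eventually_elim
      case (elim t)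
      have "\<forall>\<^sub>F n in sequentially. t < y n \<longleftrightarrow> t < x"
      proof (cases "t < x")
        case True
        then show ?thesis using order_tendstoD(1)[OF y True] by (auto elim: eventually_mono)
      next
        case False
        then show ?thesis using order_tendstoD(2)[OF y, of t] elim by (auto elim: eventually_mono)
      qed
      then have "\<forall>\<^sub>F n in sequentially. of_bool (t < y n) * g t = of_bool (t < x) * g t"
        by eventually_elim simp
      then show ?case by (rule tendsto_eventually)
    qed
    show "AE t in leb a b. norm (of_bool (t < y n) * g t) \<le> \<bar>g t\<bar>" for n by (rule AE_I2) auto
  qed (use integrable_of_bool_less[OF g] in auto)
qed

lemma prim_continuous: "integrable (leb a b) g \<Longrightarrow> continuous_on S (prim a b g)"
  by (simp add: prim_isCont continuous_at_imp_continuous_on)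

lemma prim_measurable: "integrable (leb a b) g \<Longrightarrow> prim a b g \<in> borel_measurable (leb c d)"
  by (intro leb_measurable_continuous prim_continuous)

lemma integrable_prim: "integrable (leb a b) g \<Longrightarrow> integrable (leb c d) (prim a b g)"
  by (rule integrable_leb_continuous[OF prim_continuous])

lemma prim_bound:
  assumes "integrable (leb a b) g"
  shows "\<bar>prim a b g x\<bar> \<le> (LINT t|leb a b. \<bar>g t\<bar>)"
proof -
  have "\<bar>prim a b g x\<bar> \<le> (LINT t|leb a b. \<bar>of_bool (t < x) * g t\<bar>)"
    unfolding prim_def by (rule integral_abs_bound)
  also have "\<dots> \<le> (LINT t|leb a b. \<bar>g t\<bar>)"
    using integrable_of_bool_less[OF assms] assms by (intro integral_mono) auto
  finally show ?thesis .
qed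

lemma prim_AE_cong:
  assumes "AE x in leb a b. f x = g x" shows "prim a b f = prim a b g"
proof
  show "prim a b f x = prim a b g x" for x
    unfolding prim_def by (rule integral_leb_AE_cong) (use assms in eventually_elim, simp)
qed

lemma prim_lincomb:
  assumes "integrable (leb a b) f" "integrable (leb a b) g"
  shows "prim a b (\<lambda>t. s * f t + r * g t) x = s * prim a b f x + r * prim a b g x"
proof -
  have "prim a b (\<lambda>t. s * f t + r * g t) x = (LINT t|leb a b. s * (of_bool (t < x) * f t) + r * (of_bool (t < x) * g t))"
    unfolding prim_def by (rule Bochner_Integration.integral_cong) (auto simp: algebra_simps)
  also have "\<dots> = s * prim a b f x + r * prim a b g x"
    unfolding prim_def using integrable_of_bool_less[OF assms(1)] integrable_of_bool_less[OF assms(2)] by simp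
  finally show ?thesis .
qed

lemma prim_left: "x \<le> a \<Longrightarrow> prim a b g x = 0"
proof -
  assume "x \<le> a"
  then have "prim a b g x = (LINT t|leb a b. 0)"
    unfolding prim_def by (intro Bochner_Integration.integral_cong) auto
  then show ?thesis by simp
qed

lemma prim_right: "b \<le> x \<Longrightarrow> prim a b g x = (LINT t|leb a b. g t)"
  unfolding prim_def by (intro Bochner_Integration.integral_cong) auto

lemma prim_subinterval:
  assumes "a \<le> c" "d \<le> b"
  shows "prim a b (\<lambda>t. indicator {c<..<d} t * g t) x = prim c d g x"
proof -
  have "prim a b (\<lambda>t. indicator {c<..<d} t * g t) x = (LINT t|leb a b. indicator {c<..<d} t * (of_bool (t < x) * g t))"
    unfolding prim_def by (rule Bochner_Integration.integral_cong) auto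
  then show ?thesis unfolding prim_def leb_subinterval(1)[OF assms] .
qed

lemma prim_eq_diff:
  assumes "a \<le> b" "\<And>x. x \<in> {a..b} \<Longrightarrow> (F has_real_derivative f x) (at x within {a..b})"
    and "continuous_on {a..b} f" "x \<in> {a..b}"
  shows "prim a b f x = F x - F a"
  unfolding prim_def by (rule integral_leb_FTC_step(2)) (use assms in auto)

text \<open>Fubini on the triangle t < x; integrability on the square comes from \<open>g\<close>
  being integrable and \<open>\<psi>\<close> bounded.\<close>

lemma integral_prim_mult:
  fixes \<psi> :: "real \<Rightarrow> real"
  assumes g: "integrable (leb a b) g" and \<psi>: "\<psi> \<in> borel_measurable (leb a b)"
    and B: "\<And>x. x \<in> {a<..<b} \<Longrightarrow> \<bar>\<psi> x\<bar> \<le> B"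
  shows "(LINT x|leb a b. prim a b g x * \<psi> x) = (LINT t|leb a b. g t * (LINT x|leb a b. of_bool (t < x) * \<psi> x))"
proof -
  let ?M = "leb a b"
  interpret finite_measure ?M by (rule finite_measure_leb)
  interpret P: pair_sigma_finite ?M ?M
    by (simp add: pair_sigma_finite_def sigma_finite_measure_axioms)
  have gm: "g \<in> borel_measurable ?M" using g by simp
  have idm: "(\<lambda>x. x) \<in> borel_measurable ?M" by (rule leb_measurable_borel) simp
  have \<psi>i: "integrable ?M \<psi>" by (rule integrable_leb_bounded[OF \<psi> B])
  let ?f = "\<lambda>t x. (of_bool (t < x) * g t) * \<psi> x"
  have m: "(\<lambda>p. ?f (fst p) (snd p)) \<in> borel_measurable (?M \<Otimes>\<^sub>M ?M)"
  proof -
    note [measurable] = gm idm \<psi>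
    have [measurable]: "fst \<in> borel_measurable (?M \<Otimes>\<^sub>M ?M)" "snd \<in> borel_measurable (?M \<Otimes>\<^sub>M ?M)"
      using measurable_compose[OF measurable_fst idm] measurable_compose[OF measurable_snd idm] by auto
    show ?thesis by measurable
  qed
  have i1: "integrable ?M (\<lambda>x. ?f t x)" for t
  proof -
    have "integrable ?M (\<lambda>x. g t * (of_bool (t < x) * \<psi> x))"
      using integrable_of_bool_less(2)[OF \<psi>i] by simp
    then show ?thesis by (simp add: algebra_simps)
  qed
  have int: "integrable (?M \<Otimes>\<^sub>M ?M) (case_prod ?f)"
    unfolding case_prod_unfold
  proof (rule P.Fubini_integrable[OF m])
    have "integrable ?M (\<lambda>t. g t * (LINT x|?M. of_bool (t < x) * \<bar>\<psi> x\<bar>))"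
    proof (rule integrable_mult_bounded(1)[OF g])
      show "(\<lambda>t. LINT x|?M. of_bool (t < x) * \<bar>\<psi> x\<bar>) \<in> borel_measurable ?M"
      proof (rule borel_measurable_lebesgue_integral)
        note [measurable] = idm \<psi>
        have [measurable]: "fst \<in> borel_measurable (?M \<Otimes>\<^sub>M ?M)" "snd \<in> borel_measurable (?M \<Otimes>\<^sub>M ?M)"
          using measurable_compose[OF measurable_fst idm] measurable_compose[OF measurable_snd idm] by auto
        have "(\<lambda>p. of_bool (fst p < snd p) * \<bar>\<psi> (snd p)\<bar>) \<in> borel_measurable (?M \<Otimes>\<^sub>M ?M)" by measurable
        then show "(\<lambda>(t, x). of_bool (t < x) * \<bar>\<psi> x\<bar>) \<in> borel_measurable (?M \<Otimes>\<^sub>M ?M)" by (simp add: case_prod_unfold)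
      qed
      show "\<bar>LINT x|?M. of_bool (t < x) * \<bar>\<psi> x\<bar>\<bar> \<le> (LINT x|?M. \<bar>\<psi> x\<bar>)" for t
      proof -
        have a: "integrable ?M (\<lambda>x. \<bar>\<psi> x\<bar>)" using \<psi>i by simp
        have "(LINT x|?M. of_bool (t < x) * \<bar>\<psi> x\<bar>) \<le> (LINT x|?M. \<bar>\<psi> x\<bar>)"
          by (rule integral_mono[OF integrable_of_bool_less(2)[OF a] a]) auto
        moreover have "(LINT x|?M. of_bool (t < x) * \<bar>\<psi> x\<bar>) \<ge> 0" by simp
        ultimately show ?thesis by linarith
      qed
    qed
    then have "integrable ?M (\<lambda>t. \<bar>g t * (LINT x|?M. of_bool (t < x) * \<bar>\<psi> x\<bar>)\<bar>)" by (rule integrable_abs)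
    moreover have "\<bar>g t * (LINT x|?M. of_bool (t < x) * \<bar>\<psi> x\<bar>)\<bar> = (LINT x|?M. norm (?f t x))" for t
    proof -
      have "(LINT x|?M. norm (?f t x)) = (LINT x|?M. \<bar>g t\<bar> * (of_bool (t < x) * \<bar>\<psi> x\<bar>))"
        by (rule Bochner_Integration.integral_cong) (auto simp: abs_mult)
      then show ?thesis by (simp add: abs_mult)
    qed
    ultimately show "integrable ?M (\<lambda>t. LINT x|?M. norm (?f (fst (t, x)) (snd (t, x))))" by simp
    show "AE t in ?M. integrable ?M (\<lambda>x. ?f (fst (t, x)) (snd (t, x)))" using i1 by simp
  qed
  have "(LINT x|?M. prim a b g x * \<psi> x) = (LINT x|?M. (LINT t|?M. ?f t x))"
    unfolding prim_def by simp
  also have "\<dots> = (LINT t|?M. (LINT x|?M. ?f t x))" by (rule P.Fubini_integral[OF int])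
  also have "\<dots> = (LINT t|?M. g t * (LINT x|?M. of_bool (t < x) * \<psi> x))"
  proof (rule Bochner_Integration.integral_cong[OF refl])
    fix t
    have "(LINT x|?M. ?f t x) = (LINT x|?M. g t * (of_bool (t < x) * \<psi> x))"
      by (rule Bochner_Integration.integral_cong) auto
    then show "(LINT x|?M. ?f t x) = g t * (LINT x|?M. of_bool (t < x) * \<psi> x)" by simp
  qed
  finally show ?thesis .
qed

section \<open>Integration by parts and functions with finitely many jumps\<close>

lemma integral_step_deriv_test_fun:
  assumes "test_fun a b \<phi>" "t \<in> {a<..<b}"
  shows "(LINT x|leb a b. of_bool (t < x) * deriv \<phi> x) = - \<phi> t"
proof -
  have "(LINT x|leb a b. of_bool (t < x) * deriv \<phi> x) = \<phi> b - \<phi> t"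
  proof (rule integral_leb_FTC_step(1))
    show "(\<phi> has_real_derivative deriv \<phi> x) (at x within {a..b})" for x
      using test_fun_has_deriv[OF assms(1)] has_field_derivative_at_within by blast
    show "continuous_on {a..b} (deriv \<phi>)" by (rule test_fun_continuous[OF test_fun_deriv[OF assms(1)]])
  qed (use assms in auto)
  then show ?thesis using test_fun_outside[OF assms(1), of b] by simp
qed

lemma integral_deriv_test_fun:
  assumes "test_fun a b \<phi>" "a \<le> b"
  shows "(LINT x|leb a b. deriv \<phi> x) = 0"
proof -
  have "(LINT x|leb a b. deriv \<phi> x) = \<phi> b - \<phi> a"
  proof (rule integral_leb_FTC)
    show "(\<phi> has_real_derivative deriv \<phi> x) (at x within {a..b})" for x
      using test_fun_has_deriv[OF assms(1)] has_field_derivative_at_within by blast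
    show "continuous_on {a..b} (deriv \<phi>)" by (rule test_fun_continuous[OF test_fun_deriv[OF assms(1)]])
  qed (use assms in auto)
  then show ?thesis using test_fun_outside[OF assms(1), of b] test_fun_outside[OF assms(1), of a] by simp
qed

text \<open>Since \<open>prim\<close> need not be differentiable everywhere, Fubini replaces the
  product rule: the inner integral of the derivative of \<open>\<phi>\<close> over x > t is
  -\<phi>(t).\<close>

lemma prim_by_parts:
  assumes g: "integrable (leb a b) g" and \<phi>: "test_fun a b \<phi>"
  shows "(LINT x|leb a b. prim a b g x * deriv \<phi> x) = - (LINT x|leb a b. g x * \<phi> x)"
proof -
  obtain B where B: "\<And>x. \<bar>deriv \<phi> x\<bar> \<le> B" using test_fun_bounded[OF test_fun_deriv[OF \<phi>]] by blast
  have "(LINT x|leb a b. prim a b g x * deriv \<phi> x) = (LINT t|leb a b. g t * (LINT x|leb a b. of_bool (t < x) * deriv \<phi> x))"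
    by (rule integral_prim_mult[OF g test_fun_leb_measurable[OF test_fun_deriv[OF \<phi>]] B])
  also have "\<dots> = (LINT t|leb a b. - (g t * \<phi> t))"
    by (rule Bochner_Integration.integral_cong[OF refl]) (simp add: integral_step_deriv_test_fun[OF \<phi>])
  finally show ?thesis by simp
qed

text \<open>The function with distributional derivative g dx plus point masses \<open>J s\<close>,
  for \<open>P\<close> inside (a,b). Heights \<open>J s = 0\<close> are allowed, so that one finite
  set can serve a function and its derivative together.\<close>

definition jump_fun :: "real \<Rightarrow> real \<Rightarrow> real \<Rightarrow> (real \<Rightarrow> real) \<Rightarrow> real set \<Rightarrow> (real \<Rightarrow> real) \<Rightarrow> real \<Rightarrow> real" where
  "jump_fun a b C g P J x = C + prim a b g x + (\<Sum>s\<in>P. J s * of_bool (s < x))"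

lemma jump_fun_empty [simp]: "jump_fun a b C g {} J = (\<lambda>x. C + prim a b g x)"
  by (simp add: jump_fun_def fun_eq_iff)

lemma jump_fun_measurable: "integrable (leb a b) g \<Longrightarrow> jump_fun a b C g P J \<in> borel_measurable (leb c d)"
  unfolding jump_fun_def[abs_def] by (intro borel_measurable_add borel_measurable_sum borel_measurable_times
    prim_measurable of_bool_less_measurable borel_measurable_const)

lemma jump_fun_bounded:
  assumes "integrable (leb a b) g"
  shows "\<bar>jump_fun a b C g P J x\<bar> \<le> \<bar>C\<bar> + (LINT t|leb a b. \<bar>g t\<bar>) + (\<Sum>s\<in>P. \<bar>J s\<bar>)"
proof -
  have "\<bar>\<Sum>s\<in>P. J s * of_bool (s < x)\<bar> \<le> (\<Sum>s\<in>P. \<bar>J s * of_bool (s < x)\<bar>)" by (rule sum_abs)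
  also have "\<dots> \<le> (\<Sum>s\<in>P. \<bar>J s\<bar>)" by (rule sum_mono) auto
  finally show ?thesis using prim_bound[OF assms, of x] unfolding jump_fun_def by linarith
qed

lemma integrable_jump_fun: "integrable (leb a b) g \<Longrightarrow> integrable (leb c d) (jump_fun a b C g P J)"
  by (rule integrable_leb_bounded[OF jump_fun_measurable jump_fun_bounded])

lemma jump_fun_by_parts:
  assumes g: "integrable (leb a b) g" and \<phi>: "test_fun a b \<phi>" and P: "P \<subseteq> {a<..<b}" and ab: "a \<le> b"
  shows "(LINT x|leb a b. jump_fun a b C g P J x * deriv \<phi> x) = - ((LINT x|leb a b. g x * \<phi> x) + (\<Sum>s\<in>P. J s * \<phi> s))"
proof -
  note \<phi>' = test_fun_deriv[OF \<phi>]
  have i0: "integrable (leb a b) (\<lambda>x. C * deriv \<phi> x)" using integrable_test_fun[OF \<phi>'] by simp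
  have i1: "integrable (leb a b) (\<lambda>x. prim a b g x * deriv \<phi> x)"
    by (rule integrable_mult_test_fun[OF integrable_prim[OF g] \<phi>'])
  have i2: "integrable (leb a b) (\<lambda>x. J s * (of_bool (s < x) * deriv \<phi> x))" for s
    using integrable_of_bool_less(2)[OF integrable_test_fun[OF \<phi>']] by simp
  have "(LINT x|leb a b. jump_fun a b C g P J x * deriv \<phi> x)
      = (LINT x|leb a b. C * deriv \<phi> x + prim a b g x * deriv \<phi> x + (\<Sum>s\<in>P. J s * (of_bool (s < x) * deriv \<phi> x)))"
    by (rule Bochner_Integration.integral_cong) (auto simp: jump_fun_def algebra_simps sum_distrib_left)
  also have "\<dots> = C * (LINT x|leb a b. deriv \<phi> x) + (LINT x|leb a b. prim a b g x * deriv \<phi> x)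
      + (\<Sum>s\<in>P. J s * (LINT x|leb a b. of_bool (s < x) * deriv \<phi> x))"
    by (simp only: Bochner_Integration.integral_add[OF Bochner_Integration.integrable_add[OF i0 i1] Bochner_Integration.integrable_sum[OF i2]]
        Bochner_Integration.integral_add[OF i0 i1] Bochner_Integration.integral_sum[OF i2] integral_mult_right_zero)
  also have "(\<Sum>s\<in>P. J s * (LINT x|leb a b. of_bool (s < x) * deriv \<phi> x)) = (\<Sum>s\<in>P. - (J s * \<phi> s))"
    by (rule sum.cong[OF refl]) (use P integral_step_deriv_test_fun[OF \<phi>] in auto)
  also have "\<dots> = - (\<Sum>s\<in>P. J s * \<phi> s)" by (rule sum_negf)
  finally show ?thesis using integral_deriv_test_fun[OF \<phi> ab] prim_by_parts[OF g \<phi>] by simp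
qed

lemma integrable_imp_loc_integrable:
  assumes "integrable (leb a b) v" shows "loc_integrable a b v"
  unfolding loc_integrable_def
proof (intro allI impI)
  fix c d assume cd: "a < c \<and> d < b"
  have "(indicator {c..d} :: real \<Rightarrow> real) \<in> borel_measurable (leb a b)"
    by (rule leb_measurable_borel) measurable
  then have "integrable (leb a b) (\<lambda>x. indicator {c..d} x * v x)"
    by (intro integrable_mult_bounded(2)[of _ _ _ 1] assms) (auto split: split_indicator)
  moreover have "(\<lambda>x. indicator {a<..<b} x *\<^sub>R (indicator {c..d} x * v x)) = (\<lambda>x. indicator {c..d} x *\<^sub>R v x)"
    using cd by (auto simp: fun_eq_iff indicator_def)
  ultimately show "integrable (lebesgue_on {c..d}) v"
    by (simp add: integrable_restrict_space del: real_scaleR_def)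
qed

text \<open>\<open>point_measure\<close> uses the discrete sigma-algebra on \<open>P\<close>;
  pushing it forward along the identity gives a Borel measure on the line, and \<open>P\<close>
  itself is the Lebesgue null set carrying it.\<close>

lemma finite_singular_point_measure:
  fixes f :: "real \<Rightarrow> real"
  assumes P: "finite P" and f: "\<And>s. s \<in> P \<Longrightarrow> f s \<ge> 0"
  defines "\<nu> \<equiv> distr (point_measure P f) borel (\<lambda>x. x)"
  shows "finite_singular_measure \<nu>"
    and "\<phi> \<in> borel_measurable borel \<Longrightarrow> (LINT x|\<nu>. \<phi> x) = (\<Sum>s\<in>P. f s * (\<phi> s :: real))"
proof -
  have m: "(\<lambda>x. x) \<in> point_measure P f \<rightarrow>\<^sub>M borel" by (simp add: point_measure_def)
  have "finite_measure (point_measure P f)"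
    by (rule finite_measureI) (simp add: space_point_measure emeasure_point_measure_finite P)
  then have "finite_measure \<nu>" unfolding \<nu>_def by (intro finite_measure.finite_measure_distr m)
  moreover have "emeasure \<nu> (- P) = 0"
  proof -
    have "- P \<in> sets borel" using P by (intro borel_comp borel_closed finite_imp_closed)
    then show ?thesis unfolding \<nu>_def by (simp add: emeasure_distr[OF m] space_point_measure)
  qed
  moreover have "P \<in> sets borel" "emeasure lborel P = 0"
    using P by (auto intro: emeasure_lborel_countable countable_finite borel_closed finite_imp_closed)
  ultimately show "finite_singular_measure \<nu>" by (auto simp: finite_singular_measure_def \<nu>_def)
  show "(LINT x|\<nu>. \<phi> x) = (\<Sum>s\<in>P. f s * \<phi> s)" if "\<phi> \<in> borel_measurable borel"
    unfolding \<nu>_def by (subst integral_distr[OF m that]) (simp add: lebesgue_integral_point_measure_finite P f)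
qed

lemma jump_fun_has_ac_deriv:
  assumes g: "integrable (leb a b) g" and P: "finite P" "P \<subseteq> {a<..<b}" and ab: "a \<le> b"
    and v: "AE x in leb a b. v x = jump_fun a b C g P J x"
  shows "has_ac_deriv a b v g"
  unfolding has_ac_deriv_def
proof (intro conjI exI allI impI)
  \<comment> \<open>Upward and downward jumps are separated to obtain two positive measures.\<close>
  let ?\<nu>\<^sub>1 = "distr (point_measure P (\<lambda>s. max (J s) 0)) borel (\<lambda>x. x)"
  let ?\<nu>\<^sub>2 = "distr (point_measure P (\<lambda>s. max (- J s) 0)) borel (\<lambda>x. x)"
  have v': "AE x in leb a b. jump_fun a b C g P J x = v x" using v by eventually_elim simp
  show "loc_integrable a b v"
    by (intro integrable_imp_loc_integrable integrable_leb_AE_cong[OF integrable_jump_fun[OF g] v'])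
  show "finite_singular_measure ?\<nu>\<^sub>1" "finite_singular_measure ?\<nu>\<^sub>2"
    by (rule finite_singular_point_measure(1)[OF P(1)], simp)+
  fix \<phi> assume \<phi>: "test_fun a b \<phi>"
  have bm: "\<phi> \<in> borel_measurable borel"
    by (intro borel_measurable_continuous_onI test_fun_continuous[OF \<phi>])
  have "(LINT x|leb a b. v x * deriv \<phi> x) = (LINT x|leb a b. jump_fun a b C g P J x * deriv \<phi> x)"
    by (rule integral_leb_AE_cong) (use v in eventually_elim, simp)
  also have "\<dots> = - ((LINT x|leb a b. g x * \<phi> x) + (\<Sum>s\<in>P. J s * \<phi> s))"
    by (rule jump_fun_by_parts[OF g \<phi> P(2) ab])
  also have "(\<Sum>s\<in>P. J s * \<phi> s) = (\<Sum>s\<in>P. max (J s) 0 * \<phi> s) - (\<Sum>s\<in>P. max (- J s) 0 * \<phi> s)"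
    unfolding sum_subtractf[symmetric] by (rule sum.cong) (auto simp: max_def algebra_simps)
  also have "\<dots> = (LINT x|?\<nu>\<^sub>1. \<phi> x) - (LINT x|?\<nu>\<^sub>2. \<phi> x)"
    by (simp add: finite_singular_point_measure(2)[OF P(1) _ bm])
  finally show "(LINT x|leb a b. v x * deriv \<phi> x) = - ((LINT x|leb a b. g x * \<phi> x) + ((LINT x|?\<nu>\<^sub>1. \<phi> x) - (LINT x|?\<nu>\<^sub>2. \<phi> x)))" .
qed (rule g)

lemma has_ac_deriv_unique:
  assumes "has_ac_deriv a b v g" "has_ac_deriv a b v g'"
  shows "AE x in leb a b. g x = g' x"
proof -
  obtain \<nu>\<^sub>1 \<nu>\<^sub>2 \<nu>\<^sub>1' \<nu>\<^sub>2' where \<nu>: "finite_singular_measure \<nu>\<^sub>1" "finite_singular_measure \<nu>\<^sub>2"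
    "finite_singular_measure \<nu>\<^sub>1'" "finite_singular_measure \<nu>\<^sub>2'"
    and eq: "\<And>\<phi>. test_fun a b \<phi> \<Longrightarrow> (LINT x|leb a b. v x * deriv \<phi> x) =
           - ((LINT x|leb a b. g x * \<phi> x) + ((LINT x|\<nu>\<^sub>1. \<phi> x) - (LINT x|\<nu>\<^sub>2. \<phi> x)))"
    and eq': "\<And>\<phi>. test_fun a b \<phi> \<Longrightarrow> (LINT x|leb a b. v x * deriv \<phi> x) =
           - ((LINT x|leb a b. g' x * \<phi> x) + ((LINT x|\<nu>\<^sub>1'. \<phi> x) - (LINT x|\<nu>\<^sub>2'. \<phi> x)))"
    using assms unfolding has_ac_deriv_def by (elim conjE exE) (rule that; blast)
  have g: "integrable (leb a b) g" "integrable (leb a b) g'" using assms by (auto simp: has_ac_deriv_def)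
  \<comment> \<open>Subtracting the two identities leaves the density \<open>g - g'\<close> and four
    singular measures with signs +, -, -, +.\<close>
  define \<nu> where "\<nu> i = [\<nu>\<^sub>1, \<nu>\<^sub>2, \<nu>\<^sub>1', \<nu>\<^sub>2'] ! i" for i :: nat
  define \<sigma> where "\<sigma> i = [1, -1, -1, 1::real] ! i" for i :: nat
  have "AE x in leb a b. g x - g' x = 0"
  proof (rule ac_part_unique[of _ _ _ "{0, 1, 2, 3}" \<nu> \<sigma>])
    show "integrable (leb a b) (\<lambda>x. g x - g' x)" using g by simp
    show "finite_singular_measure (\<nu> i)" if "i \<in> {0, 1, 2, 3}" for i
      using that \<nu> by (auto simp: \<nu>_def numeral_2_eq_2 numeral_3_eq_3)
    fix \<phi> assume \<phi>: "test_fun a b \<phi>"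
    have "(LINT x|leb a b. (g x - g' x) * \<phi> x) = (LINT x|leb a b. g x * \<phi> x) - (LINT x|leb a b. g' x * \<phi> x)"
      using integrable_mult_test_fun[OF g(1) \<phi>] integrable_mult_test_fun[OF g(2) \<phi>]
      by (simp add: left_diff_distrib)
    then show "(LINT x|leb a b. (g x - g' x) * \<phi> x) + (\<Sum>i\<in>{0, 1, 2, 3}. \<sigma> i * (LINT x|\<nu> i. \<phi> x)) = 0"
      using eq[OF \<phi>] eq'[OF \<phi>] by (simp add: \<nu>_def \<sigma>_def numeral_2_eq_2 numeral_3_eq_3)
  qed simp
  then show ?thesis by eventually_elim simp
qed

text \<open>The choice in \<open>ac_deriv\<close> does no harm: existence makes the chosen function
  a valid one, and uniqueness identifies it almost everywhere.\<close>

lemma ac_deriv_jump_fun: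
  assumes "integrable (leb a b) g" "finite P" "P \<subseteq> {a<..<b}" "a \<le> b"
    and "AE x in leb a b. v x = jump_fun a b C g P J x"
  shows "AE x in leb a b. ac_deriv a b v x = g x"
proof (rule has_ac_deriv_unique)
  have *: "has_ac_deriv a b v g" by (rule jump_fun_has_ac_deriv) fact+
  then show "has_ac_deriv a b v g" .
  show "has_ac_deriv a b v (ac_deriv a b v)" unfolding ac_deriv_def by (rule someI[of "has_ac_deriv a b v", OF *])
qed

lemma jump_fun_isCont:
  assumes "integrable (leb a b) g" "finite P" "x \<notin> P \<or> J x = 0"
  shows "isCont (jump_fun a b C g P J) x"
proof -
  have 1: "isCont (\<lambda>x. J s * of_bool (s < x)) x" if "s \<in> P" for s
  proof (cases "s = x")
    case True
    then have "J s = 0" using assms(3) that by blast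
    then show ?thesis by simp
  next
    case False
    then have "\<forall>\<^sub>F y in nhds x. J s * of_bool (s < y) = J s * of_bool (s < x)"
    proof (cases "s < x")
      case True
      then show ?thesis using eventually_nhds_in_open[of "{s<..}" x] by (auto elim!: eventually_mono)
    next
      case False
      then have "\<forall>\<^sub>F y in nhds x. y \<in> {..<s}"
        using \<open>s \<noteq> x\<close> by (intro eventually_nhds_in_open) auto
      then show ?thesis by (rule eventually_mono) (use False in auto)
    qed
    from isCont_cong[OF this] show ?thesis by simp
  qed
  show ?thesis unfolding jump_fun_def[abs_def]
    by (intro continuous_intros prim_isCont assms 1)
qed

text \<open>At a jump point the two one-sided limits of every representative are the limits of
  \<open>jump_fun\<close>, and these differ by \<open>J x\<close>.\<close>

lemma disc_set_jump_fun:
  assumes g: "integrable (leb a b) g" and P: "finite P" "P \<subseteq> {a<..<b}"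
    and v: "AE x in leb a b. v x = jump_fun a b C g P J x"
  shows "disc_set a b v = {s \<in> P. J s \<noteq> 0}"
proof -
  have "x \<notin> disc_set a b v" if "x \<notin> P \<or> J x = 0" for x
  proof -
    have "AE y in leb a b. jump_fun a b C g P J y = v y" using v by eventually_elim simp
    moreover have "isCont (jump_fun a b C g P J) x" by (rule jump_fun_isCont) (use g P that in auto)
    ultimately show ?thesis unfolding disc_set_def by blast
  qed
  moreover have "x \<in> disc_set a b v" if x: "x \<in> P" "J x \<noteq> 0" for x
  proof (rule ccontr)
    assume "x \<notin> disc_set a b v"
    then obtain u where u: "AE y in leb a b. u y = v y" and cont: "isCont u x"
      using x P unfolding disc_set_def by blast
    \<comment> \<open>Removing the jump at \<open>x\<close> leaves a function continuous there, so
      \<open>u - r\<close> is continuous at \<open>x\<close> although it equals almost everywhere 0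
      on the left and \<open>J x\<close> on the right.\<close>
    define r where "r = jump_fun a b C g (P - {x}) J"
    have r: "isCont r x" unfolding r_def by (rule jump_fun_isCont) (use g P in auto)
    have eq: "jump_fun a b C g P J y = r y + J x * of_bool (x < y)" for y
      unfolding r_def jump_fun_def sum.remove[OF P(1) x(1)] by simp
    have "isCont (\<lambda>y. u y - r y) x" by (intro continuous_intros cont r)
    then have "\<forall>\<^sub>F y in at x. dist (u y - r y) (u x - r x) < \<bar>J x\<bar> / 2"
      using x unfolding isCont_def by (intro tendstoD) auto
    then obtain d where d: "d > 0" "\<And>y. y \<noteq> x \<Longrightarrow> dist y x < d \<Longrightarrow> \<bar>(u y - r y) - (u x - r x)\<bar> < \<bar>J x\<bar> / 2"
      unfolding eventually_at by (auto simp: dist_real_def)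
    have AE: "AE y in lebesgue. y \<in> {a<..<b} \<longrightarrow> u y - r y = J x * of_bool (x < y)"
      using u v unfolding AE_leb_iff by eventually_elim (auto simp: eq)
    \<comment> \<open>An almost everywhere identity holds at some point of every nonempty interval;
      one such point on each side of \<open>x\<close> contradicts the tolerance of half the
      jump.\<close>
    have ex: "\<exists>y\<in>{c<..<e}. u y - r y = J x * of_bool (x < y)" if "a \<le> c" "c < e" "e \<le> b" for c e
    proof (rule ccontr)
      assume neg: "\<not> ?thesis"
      have "AE y in lebesgue. y \<notin> {c<..<e}" using AE by eventually_elim (use that neg in auto)
      then have "{c<..<e} \<in> null_sets lebesgue" by (simp add: AE_iff_null_sets)
      then show False using that by (simp add: null_sets_def)
    qed
    have xab: "a < x" "x < b" using x P by auto
    obtain y where y: "y \<in> {max a (x - d)<..<x}" "u y - r y = J x * of_bool (x < y)"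
      using ex[of "max a (x - d)" x] xab d(1) by auto
    obtain z where z: "z \<in> {x<..<min b (x + d)}" "u z - r z = J x * of_bool (x < z)"
      using ex[of x "min b (x + d)"] xab d(1) by auto
    have "\<bar>(u y - r y) - (u x - r x)\<bar> < \<bar>J x\<bar> / 2" "\<bar>(u z - r z) - (u x - r x)\<bar> < \<bar>J x\<bar> / 2"
      by (rule d(2); use y z in \<open>auto simp: dist_real_def\<close>)+
    moreover have "u y - r y = 0" "u z - r z = J x" using y z by auto
    ultimately show False by linarith
  qed
  ultimately show ?thesis using P unfolding disc_set_def by blast
qed

section \<open>Weak derivatives and piecewise \<open>H\<^sup>2\<close> functions\<close>

lemma L2_integrable:
  assumes "L2 a b f" shows "integrable (leb a b) f"
proof -
  interpret finite_measure "leb a b" by (rule finite_measure_leb)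
  have "integrable (leb a b) (\<lambda>x. 1 + (f x)\<^sup>2)" using assms by (simp add: L2_def)
  then show ?thesis
  proof (rule Bochner_Integration.integrable_bound)
    show "f \<in> borel_measurable (leb a b)" using assms by (simp add: L2_def)
    have "\<bar>t\<bar> \<le> 1 + t\<^sup>2" for t :: real
      using zero_le_power2[of "\<bar>t\<bar> - 1 / 2"] by (simp add: power2_diff power_divide)
    then show "AE x in leb a b. norm (f x) \<le> norm (1 + (f x)\<^sup>2)" by (intro AE_I2) simp
  qed
qed

lemma L2_mult_integrable:
  assumes "L2 a b f" "L2 a b g" shows "integrable (leb a b) (\<lambda>x. f x * g x)"
proof -
  have "integrable (leb a b) (\<lambda>x. (f x)\<^sup>2 + (g x)\<^sup>2)" using assms by (simp add: L2_def)
  then show ?thesis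
  proof (rule Bochner_Integration.integrable_bound)
    show "(\<lambda>x. f x * g x) \<in> borel_measurable (leb a b)"
      using assms by (intro borel_measurable_times) (auto simp: L2_def)
    have "\<bar>s * t\<bar> \<le> s\<^sup>2 + t\<^sup>2" for s t :: real
    proof -
      have "2 * (\<bar>s\<bar> * \<bar>t\<bar>) \<le> s\<^sup>2 + t\<^sup>2"
        using sum_squares_bound[of "\<bar>s\<bar>" "\<bar>t\<bar>"] by (simp add: mult.assoc)
      moreover have "0 \<le> \<bar>s\<bar> * \<bar>t\<bar>" by simp
      ultimately show ?thesis unfolding abs_mult by linarith
    qed
    then show "AE x in leb a b. norm (f x * g x) \<le> norm ((f x)\<^sup>2 + (g x)\<^sup>2)" by (intro AE_I2) simp
  qed
qed

lemma L2_lincomb: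
  assumes "L2 a b f" "L2 a b g" shows "L2 a b (\<lambda>x. s * f x + t * g x)"
proof -
  have "(s * f x + t * g x)\<^sup>2 = s\<^sup>2 * (f x)\<^sup>2 + t\<^sup>2 * (g x)\<^sup>2 + 2 * s * t * (f x * g x)" for x
    by (simp add: power2_eq_square algebra_simps)
  moreover have "(\<lambda>x. s * f x + t * g x) \<in> borel_measurable (leb a b)"
    using assms by (intro borel_measurable_add borel_measurable_times borel_measurable_const) (auto simp: L2_def)
  ultimately show ?thesis using assms L2_mult_integrable[OF assms] by (simp add: L2_def)
qed

lemma L2_add: "L2 a b f \<Longrightarrow> L2 a b g \<Longrightarrow> L2 a b (\<lambda>x. f x + g x)"
  using L2_lincomb[of a b f g 1 1] by simp

lemma L2_diff: "L2 a b f \<Longrightarrow> L2 a b g \<Longrightarrow> L2 a b (\<lambda>x. f x - g x)"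
  using L2_lincomb[of a b f g 1 "-1"] by simp

lemma L2_bounded:
  assumes "f \<in> borel_measurable (leb a b)" "\<And>x. x \<in> {a<..<b} \<Longrightarrow> \<bar>f x\<bar> \<le> B"
  shows "L2 a b f"
proof -
  have "\<bar>(f x)\<^sup>2\<bar> \<le> B\<^sup>2" if "x \<in> {a<..<b}" for x
    using power_mono[OF assms(2)[OF that], of 2] by simp
  then show ?thesis unfolding L2_def using assms(1) by (intro conjI integrable_leb_bounded[of _ _ _ "B\<^sup>2"]) auto
qed

lemma L2_AE_cong:
  assumes "L2 a b f" "AE x in leb a b. f x = g x" shows "L2 a b g"
proof -
  have "AE x in leb a b. (f x)\<^sup>2 = (g x)\<^sup>2" using assms(2) by eventually_elim simp
  then show ?thesis using assms(1) leb_measurable_AE_cong[OF _ assms(2)]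
      integrable_leb_AE_cong[of a b "\<lambda>x. (f x)\<^sup>2" "\<lambda>x. (g x)\<^sup>2"]
    unfolding L2_def by simp
qed

lemma L2_prim: "integrable (leb a b) g \<Longrightarrow> L2 c d (prim a b g)"
  by (rule L2_bounded[OF prim_measurable prim_bound])

lemma L2_jump_fun: "integrable (leb a b) g \<Longrightarrow> L2 c d (jump_fun a b C g P J)"
  by (rule L2_bounded[OF jump_fun_measurable jump_fun_bounded])

lemma L2_const_prim: "integrable (leb a b) g \<Longrightarrow> L2 c d (\<lambda>x. C + prim a b g x)"
  using L2_jump_fun[of a b g c d C "{}"] by simp

lemma integrable_const_prim: "integrable (leb a b) g \<Longrightarrow> integrable (leb c d) (\<lambda>x. C + prim a b g x)"
  using integrable_jump_fun[of a b g c d C "{}"] by simp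

lemma AE_leb_subinterval:
  assumes "AE x in leb a b. P x" "a \<le> c" "d \<le> b" shows "AE x in leb c d. P x"
  using assms(1) unfolding AE_leb_iff by eventually_elim (use assms in auto)

lemma AE_leb_mem: "AE x in leb a b. x \<in> {a<..<b}"
  by (rule AE_I2) simp

lemma AE_leb_not_eq: "AE x in leb a b. x \<noteq> c"
proof -
  have "AE x in lebesgue. x \<noteq> c" by (rule AE_not_in[of "{c}", simplified]) (simp add: null_sets_def)
  then show ?thesis unfolding AE_leb_iff by eventually_elim simp
qed

lemma AE_leb_join:
  assumes "AE x in leb a b. P x" "AE x in leb b c. P x" shows "AE x in leb a c. P x"
  using assms AE_leb_not_eq[where a=a and b=c and c=b] unfolding AE_leb_iff by eventually_elim (auto simp: neq_iff)

lemma leb_measurable_subinterval: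
  assumes "f \<in> borel_measurable (leb c d)" "a \<le> c" "d \<le> b"
  shows "(\<lambda>x. indicator {c<..<d} x * f x :: real) \<in> borel_measurable (leb a b)"
proof -
  have eq: "(\<lambda>x. indicator {a<..<b} x *\<^sub>R (indicator {c<..<d} x * f x)) = (\<lambda>x. indicator {c<..<d} x *\<^sub>R f x)"
    using assms(2,3) by (auto simp: fun_eq_iff indicator_def)
  show ?thesis using assms(1)
    by (simp add: borel_measurable_restrict_space_iff eq del: real_scaleR_def)
qed

lemma L2_subinterval:
  assumes "L2 a b f" "a \<le> c" "d \<le> b" shows "L2 c d f"
proof -
  have "(indicator {c<..<d} :: real \<Rightarrow> real) \<in> borel_measurable (leb a b)"
    by (rule leb_measurable_borel) measurable
  then have "(\<lambda>x. indicator {c<..<d} x * f x) \<in> borel_measurable (leb a b)"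
    using assms by (intro borel_measurable_times) (auto simp: L2_def)
  moreover have "(\<lambda>x. indicator {a<..<b} x *\<^sub>R (indicator {c<..<d} x * f x)) = (\<lambda>x. indicator {c<..<d} x *\<^sub>R f x)"
    using assms(2,3) by (auto simp: fun_eq_iff indicator_def)
  ultimately have "f \<in> borel_measurable (leb c d)"
    by (simp add: borel_measurable_restrict_space_iff del: real_scaleR_def)
  then show ?thesis using assms integrable_leb_subinterval[OF _ assms(2,3), of "\<lambda>x. (f x)\<^sup>2"] by (simp add: L2_def)
qed

lemma L2_indicator:
  assumes "L2 c d f" "a \<le> c" "d \<le> b" shows "L2 a b (\<lambda>x. indicator {c<..<d} x * f x)"
proof -
  have "(indicator {c<..<d} x * f x)\<^sup>2 = indicator {c<..<d} x * (f x)\<^sup>2" for x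
    by (simp add: indicator_def)
  then show ?thesis using assms leb_measurable_subinterval[OF _ assms(2,3)] leb_subinterval(2)[OF assms(2,3)]
    by (simp add: L2_def)
qed

lemma L2_join:
  assumes "L2 a b f" "L2 b c g" "a \<le> b" "b \<le> c"
  shows "L2 a c (\<lambda>x. if x < b then f x else g x)"
proof (rule L2_AE_cong)
  show "L2 a c (\<lambda>x. indicator {a<..<b} x * f x + indicator {b<..<c} x * g x)"
    using assms by (intro L2_add L2_indicator) auto
  have "AE x in leb a c. x \<in> {a<..<c}" by (rule AE_I2) simp
  then show "AE x in leb a c. indicator {a<..<b} x * f x + indicator {b<..<c} x * g x = (if x < b then f x else g x)"
    using AE_leb_not_eq[where a=a and b=c and c=b] by eventually_elim (auto simp: indicator_def)
qed

lemma loc_integrable_imp_integrable: "loc_integrable a b v \<Longrightarrow> a < c \<Longrightarrow> d < b \<Longrightarrow> integrable (leb c d) v"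
proof -
  assume "loc_integrable a b v" "a < c" "d < b"
  then have "integrable (lebesgue_on {c..d}) v" by (simp add: loc_integrable_def)
  then have "set_integrable lebesgue {c..d} v" by (simp add: integrable_restrict_space set_integrable_def)
  then have "set_integrable lebesgue {c<..<d} v" by (rule set_integrable_subset) auto
  then show ?thesis by (simp add: integrable_restrict_space set_integrable_def)
qed

lemma integral_test_fun_extend:
  assumes "test_fun c d \<phi>" "a \<le> c" "d \<le> b"
  shows "(LINT x|leb a b. f x * \<phi> x) = (LINT x|leb c d. f x * \<phi> x)"
proof -
  have "(LINT x|leb a b. f x * \<phi> x) = (LINT x|leb a b. indicator {c<..<d} x * (f x * \<phi> x))"
    by (rule Bochner_Integration.integral_cong) (use test_fun_outside[OF assms(1)] in \<open>auto split: split_indicator\<close>)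
  then show ?thesis using leb_subinterval(1)[OF assms(2,3)] by simp
qed

lemma has_weak_deriv_subinterval:
  assumes v: "has_weak_deriv a b v g" and "a \<le> c" "d \<le> b"
  shows "has_weak_deriv c d v g"
  unfolding has_weak_deriv_def
proof (intro conjI allI impI)
  show "loc_integrable c d v" "loc_integrable c d g"
    using assms unfolding has_weak_deriv_def loc_integrable_def by (meson le_less_trans less_le_trans)+
  fix \<phi> assume \<phi>: "test_fun c d \<phi>"
  have "test_fun a b \<phi>" using test_fun_mono[OF \<phi>] assms by blast
  then have "(LINT x|leb a b. v x * deriv \<phi> x) = - (LINT x|leb a b. g x * \<phi> x)"
    using v by (simp add: has_weak_deriv_def)
  then show "(LINT x|leb c d. v x * deriv \<phi> x) = - (LINT x|leb c d. g x * \<phi> x)"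
    unfolding integral_test_fun_extend[OF \<phi> assms(2,3)] integral_test_fun_extend[OF test_fun_deriv[OF \<phi>] assms(2,3)] .
qed

text \<open>Weak derivatives are only locally integrable, so the fundamental lemma is applied on a
  countable exhaustion of (a,b) by smaller intervals.\<close>

lemma has_weak_deriv_unique:
  assumes "has_weak_deriv a b v g" "has_weak_deriv a b v g'"
  shows "AE x in leb a b. g x = g' x"
proof -
  define c d where "c n = a + 1 / Suc n" and "d n = b - 1 / Suc n" for n :: nat
  have pos: "1 / real (Suc n) > 0" for n by simp
  have cd: "a < c n" "d n < b" for n using pos[of n] unfolding c_def d_def by linarith+
  have "AE x in leb (c n) (d n). g x = g' x" for n
  proof -
    have w: "has_weak_deriv (c n) (d n) v g" "has_weak_deriv (c n) (d n) v g'"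
      using assms has_weak_deriv_subinterval less_imp_le[OF cd(1)] less_imp_le[OF cd(2)] by blast+
    have i: "integrable (leb (c n) (d n)) g" "integrable (leb (c n) (d n)) g'"
      using assms cd by (auto simp: has_weak_deriv_def intro: loc_integrable_imp_integrable)
    have "AE x in leb (c n) (d n). g x - g' x = 0"
    proof (rule test_integral_zero_imp_AE)
      show "integrable (leb (c n) (d n)) (\<lambda>x. g x - g' x)" using i by simp
      fix \<phi> assume \<phi>: "test_fun (c n) (d n) \<phi>"
      show "(LINT x|leb (c n) (d n). (g x - g' x) * \<phi> x) = 0"
        using w \<phi> integrable_mult_test_fun[OF i(1) \<phi>] integrable_mult_test_fun[OF i(2) \<phi>]
        by (simp add: has_weak_deriv_def left_diff_distrib)
    qed
    then show ?thesis by eventually_elim simp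
  qed
  then have "AE x in lebesgue. \<forall>n. x \<in> {c n<..<d n} \<longrightarrow> g x = g' x"
    unfolding AE_leb_iff by (subst AE_all_countable) blast
  then show ?thesis unfolding AE_leb_iff
  proof eventually_elim
    case (elim x)
    show ?case
    proof
      assume x: "x \<in> {a<..<b}"
      then obtain n where "1 / real (Suc n) < min (x - a) (b - x)"
        using reals_Archimedean[of "min (x - a) (b - x)"] by (auto simp: inverse_eq_divide)
      then have "x \<in> {c n<..<d n}" by (auto simp: c_def d_def)
      then show "g x = g' x" using elim by blast
    qed
  qed
qed

lemma has_weak_deriv_prim:
  assumes g: "integrable (leb a b) g" and ab: "a \<le> b" and v: "AE x in leb a b. v x = C + prim a b g x"
  shows "has_weak_deriv a b v g"
  unfolding has_weak_deriv_def
proof (intro conjI allI impI)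
  have "AE x in leb a b. C + prim a b g x = v x" using v by eventually_elim simp
  then show "loc_integrable a b v"
    by (intro integrable_imp_loc_integrable integrable_leb_AE_cong[OF integrable_const_prim[OF g]])
  show "loc_integrable a b g" by (rule integrable_imp_loc_integrable[OF g])
  fix \<phi> assume \<phi>: "test_fun a b \<phi>"
  have "(LINT x|leb a b. v x * deriv \<phi> x) = (LINT x|leb a b. jump_fun a b C g {} (\<lambda>_. 0) x * deriv \<phi> x)"
    by (rule integral_leb_AE_cong) (use v in eventually_elim, simp)
  then show "(LINT x|leb a b. v x * deriv \<phi> x) = - (LINT x|leb a b. g x * \<phi> x)"
    using jump_fun_by_parts[OF g \<phi> empty_subsetI ab] by simp
qed

lemma weak_deriv_prim:
  assumes "integrable (leb a b) g" "a \<le> b" "AE x in leb a b. v x = C + prim a b g x"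
  shows "AE x in leb a b. weak_deriv a b v x = g x"
proof (rule has_weak_deriv_unique)
  have *: "has_weak_deriv a b v g" by (rule has_weak_deriv_prim[OF assms])
  then show "has_weak_deriv a b v g" .
  show "has_weak_deriv a b v (weak_deriv a b v)"
    unfolding weak_deriv_def by (rule someI[of "has_weak_deriv a b v", OF *])
qed

lemma weak_deriv2_prim:
  assumes h: "integrable (leb a b) h" and ab: "a \<le> b"
    and v: "AE x in leb a b. v x = C + prim a b (\<lambda>t. D + prim a b h t) x"
  shows "AE x in leb a b. weak_deriv2 a b v x = h x"
  unfolding weak_deriv2_def
  by (rule weak_deriv_prim[OF h ab weak_deriv_prim[OF integrable_const_prim[OF h] ab v]])

text \<open>The difference of \<open>v\<close> and the primitive of \<open>g\<close> has weak
  derivative 0, hence is constant by \<open>du_Bois_Reymond\<close>.\<close>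

lemma has_weak_deriv_imp_prim:
  assumes "integrable (leb a b) v" "integrable (leb a b) g" "a < b" "has_weak_deriv a b v g"
  obtains C where "AE x in leb a b. v x = C + prim a b g x"
proof -
  have "integrable (leb a b) (\<lambda>x. v x - prim a b g x)" using assms integrable_prim by simp
  moreover have "(LINT x|leb a b. (v x - prim a b g x) * deriv \<phi> x) = 0" if \<phi>: "test_fun a b \<phi>" for \<phi>
    using assms(4) \<phi> prim_by_parts[OF assms(2) \<phi>] integrable_mult_test_fun[OF assms(1) test_fun_deriv[OF \<phi>]]
      integrable_mult_test_fun[OF integrable_prim[OF assms(2)] test_fun_deriv[OF \<phi>]]
    by (simp add: has_weak_deriv_def left_diff_distrib)
  ultimately obtain C where "AE x in leb a b. v x - prim a b g x = C"
    using du_Bois_Reymond[OF _ assms(3)] by blast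
  then have "AE x in leb a b. v x = C + prim a b g x" by eventually_elim simp
  then show ?thesis using that by blast
qed

lemma H2_imp_prim:
  assumes "H2 a b v" "a < b"
  obtains C D h where "L2 a b h" "AE x in leb a b. v x = C + prim a b (\<lambda>t. D + prim a b h t) x"
proof -
  obtain g h where gh: "has_weak_deriv a b v g" "L2 a b g" "has_weak_deriv a b g h" "L2 a b h" and v: "L2 a b v"
    using assms(1) unfolding H2_def by blast
  note i = L2_integrable[OF v] L2_integrable[OF gh(2)] L2_integrable[OF gh(4)]
  obtain C where C: "AE x in leb a b. v x = C + prim a b g x"
    using has_weak_deriv_imp_prim[OF i(1,2) assms(2) gh(1)] .
  obtain D where D: "AE x in leb a b. g x = D + prim a b h x"
    using has_weak_deriv_imp_prim[OF i(2,3) assms(2) gh(3)] .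
  show ?thesis by (rule that[of h C D]) (use gh(4) C prim_AE_cong[OF D] in auto)
qed

lemma H2_primI:
  assumes "L2 a b h" "a \<le> b" and v: "AE x in leb a b. v x = C + prim a b (\<lambda>t. D + prim a b h t) x"
  shows "H2 a b v"
proof -
  note h = L2_integrable[OF assms(1)]
  let ?g = "\<lambda>t. D + prim a b h t"
  have g: "integrable (leb a b) ?g" by (rule integrable_const_prim[OF h])
  have "AE x in leb a b. C + prim a b ?g x = v x" using v by eventually_elim simp
  then have "L2 a b v" by (rule L2_AE_cong[OF L2_const_prim[OF g]])
  moreover have "has_weak_deriv a b v ?g" by (rule has_weak_deriv_prim[OF g assms(2) v])
  moreover have "has_weak_deriv a b ?g h" by (rule has_weak_deriv_prim[OF h assms(2), where C=D]) simp
  moreover have "L2 a b ?g" by (rule L2_const_prim[OF h])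
  ultimately show ?thesis using assms(1) unfolding H2_def by blast
qed

section \<open>Gluing representations at a partition point; normal form of piecewise H2
  functions\<close>

lemma prim_split:
  assumes g: "integrable (leb a c) g" and "a \<le> b" "b \<le> c"
  shows "prim a c g x = prim a b g x + prim b c g x"
proof -
  let ?f = "\<lambda>t. of_bool (t < x) * g t"
  have f: "integrable (leb a c) ?f" by (rule integrable_of_bool_less[OF g])
  have i: "integrable (leb a c) (\<lambda>t. indicator {a<..<b} t * ?f t)" "integrable (leb a c) (\<lambda>t. indicator {b<..<c} t * ?f t)"
    using leb_subinterval(2)[of a a b c ?f] leb_subinterval(2)[of a b c c ?f] integrable_leb_subinterval[OF f] assms by auto
  have "AE t in leb a c. t \<in> {a<..<c}" by (rule AE_I2) simp
  then have "AE t in leb a c. ?f t = indicator {a<..<b} t * ?f t + indicator {b<..<c} t * ?f t"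
    using AE_leb_not_eq[where a=a and b=c and c=b] by eventually_elim (auto simp: indicator_def)
  then have "prim a c g x = (LINT t|leb a c. indicator {a<..<b} t * ?f t + indicator {b<..<c} t * ?f t)"
    unfolding prim_def by (rule integral_leb_AE_cong)
  also have "\<dots> = prim a b g x + prim b c g x"
    unfolding prim_def Bochner_Integration.integral_add[OF i] using leb_subinterval(1)[of a a b c ?f] leb_subinterval(1)[of a b c c ?f] assms by simp
  finally show ?thesis .
qed

lemma jump_fun_AE_cong:
  "AE x in leb a b. f x = g x \<Longrightarrow> jump_fun a b C f P J = jump_fun a b C g P J"
  by (simp add: jump_fun_def[abs_def] prim_AE_cong[of f g])

lemma jump_fun_join:
  assumes g: "integrable (leb a c) g" and abc: "a < b" "b < c"
    and P: "finite P" "P \<subseteq> {a<..<b}" "finite P'" "P' \<subseteq> {b<..<c}"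
    and v: "AE x in leb a b. v x = jump_fun a b C g P J x" "AE x in leb b c. v x = jump_fun b c C' g P' J' x"
  obtains K where "AE x in leb a c. v x = jump_fun a c C g (P \<union> {b} \<union> P') K x"
proof -
  \<comment> \<open>The new jump at \<open>b\<close> is the starting value \<open>C'\<close> of the
    right piece minus the limit of the left piece at \<open>b\<close>.\<close>
  define K where "K s = (if s < b then J s else if s = b then C' - jump_fun a b C g P J b else J' s)" for s
  have sum: "(\<Sum>s\<in>P \<union> {b} \<union> P'. K s * of_bool (s < x)) =
      (\<Sum>s\<in>P. J s * of_bool (s < x)) + K b * of_bool (b < x) + (\<Sum>s\<in>P'. J' s * of_bool (s < x))" for x
  proof -
    have disj: "(P \<union> {b}) \<inter> P' = {}" "P \<inter> {b} = {}" using P by fastforce+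
    have "(\<Sum>s\<in>P \<union> {b} \<union> P'. K s * of_bool (s < x)) =
      (\<Sum>s\<in>P. K s * of_bool (s < x)) + (\<Sum>s\<in>{b}. K s * of_bool (s < x)) + (\<Sum>s\<in>P'. K s * of_bool (s < x))"
      unfolding sum.union_disjoint[OF finite_UnI[OF P(1) finite.insertI[OF finite.emptyI]] P(3) disj(1)]
        sum.union_disjoint[OF P(1) finite.insertI[OF finite.emptyI] disj(2)] by (rule refl)
    moreover have "(\<Sum>s\<in>P. K s * of_bool (s < x)) = (\<Sum>s\<in>P. J s * of_bool (s < x))"
      by (rule sum.cong) (use P in \<open>auto simp: K_def\<close>)
    moreover have "(\<Sum>s\<in>P'. K s * of_bool (s < x)) = (\<Sum>s\<in>P'. J' s * of_bool (s < x))"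
      by (rule sum.cong) (use P in \<open>auto simp: K_def\<close>)
    ultimately show ?thesis by simp
  qed
  have "AE x in leb a b. v x = jump_fun a c C g (P \<union> {b} \<union> P') K x"
    using v(1) AE_leb_mem[of a b]
  proof eventually_elim
    case (elim x)
    then have x: "x < b" by auto
    have "(\<Sum>s\<in>P'. J' s * of_bool (s < x)) = 0" by (rule sum.neutral) (use P x in auto)
    then show ?case using elim x
      unfolding jump_fun_def sum prim_split[OF g abc[THEN less_imp_le]]
      by (simp add: prim_left)
  qed
  moreover have "AE x in leb b c. v x = jump_fun a c C g (P \<union> {b} \<union> P') K x"
    using v(2) AE_leb_mem[of b c]
  proof eventually_elim
    case (elim x)
    then have x: "b < x" by auto
    have "(\<Sum>s\<in>P. J s * of_bool (s < x)) = (\<Sum>s\<in>P. J s * of_bool (s < b))"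
      by (rule sum.cong) (use P x in auto)
    moreover have "prim a b g x = prim a b g b" using x by (simp add: prim_right)
    moreover have "K b = C' - (C + prim a b g b + (\<Sum>s\<in>P. J s * of_bool (s < b)))" by (simp add: K_def jump_fun_def)
    ultimately show ?case using elim x
      unfolding jump_fun_def sum prim_split[OF g abc[THEN less_imp_le]] by simp
  qed
  ultimately have "AE x in leb a c. v x = jump_fun a c C g (P \<union> {b} \<union> P') K x" by (rule AE_leb_join)
  then show ?thesis using that by blast
qed

text \<open>The inner \<open>jump_fun\<close> is the absolutely continuous part of v', whose jumps
  \<open>K\<close> are the creases of \<open>v\<close>; \<open>J\<close> holds the jumps of
  \<open>v\<close> itself. The point masses of v' enter only through \<open>J\<close>, not through
  the integrand.\<close>

definition jump_rep2 :: "real \<Rightarrow> real \<Rightarrow> (real \<Rightarrow> real) \<Rightarrow> real \<Rightarrow> real \<Rightarrow> (real \<Rightarrow> real) \<Rightarrow> real set \<Rightarrow>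
    (real \<Rightarrow> real) \<Rightarrow> (real \<Rightarrow> real) \<Rightarrow> bool" where
  "jump_rep2 a b v C D h P J K \<longleftrightarrow> finite P \<and> P \<subseteq> {a<..<b} \<and> L2 a b h \<and>
     (AE x in leb a b. v x = jump_fun a b C (jump_fun a b D h P K) P J x)"

text \<open>The derivatives have to be glued before the functions: joining the outer representations
  requires that both sides integrate the same function \<open>?g''\<close>.\<close>

lemma jump_rep2_join:
  assumes abc: "a < b" "b < c" and v: "jump_rep2 a b v C D h P J K" and v': "jump_rep2 b c v C' D' h' P' J' K'"
  shows "\<exists>C D h P J K. jump_rep2 a c v C D h P J K"
proof -
  define h'' where "h'' x = (if x < b then h x else h' x)" for x
  let ?P = "P \<union> {b} \<union> P'"
  note h = v[unfolded jump_rep2_def] v'[unfolded jump_rep2_def]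
  have L2: "L2 a c h''" unfolding h''_def using h abc by (intro L2_join) auto
  note i = L2_integrable[OF L2]
  have hl: "AE x in leb a b. h x = h'' x" by (rule AE_I2) (simp add: h''_def)
  have hr: "AE x in leb b c. h' x = h'' x" by (rule AE_I2) (simp add: h''_def)
  let ?g = "jump_fun a b D h P K" and ?g' = "jump_fun b c D' h' P' K'"
  define g where "g x = (if x < b then ?g x else ?g' x)" for x
  have gl: "AE x in leb a b. g x = jump_fun a b D h'' P K x"
    using AE_leb_mem[of a b]
    by eventually_elim (simp_all add: g_def jump_fun_def prim_AE_cong[OF hl])
  have gr: "AE x in leb b c. g x = jump_fun b c D' h'' P' K' x"
    using AE_leb_mem[of b c]
    by eventually_elim (auto simp: g_def jump_fun_def prim_AE_cong[OF hr])
  obtain K'' where K'': "AE x in leb a c. g x = jump_fun a c D h'' ?P K'' x"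
    by (rule jump_fun_join[OF i abc _ _ _ _ gl gr]) (use h in auto)
  let ?g'' = "jump_fun a c D h'' ?P K''"
  have gi: "integrable (leb a c) ?g''" by (rule integrable_jump_fun[OF i])
  have "AE x in leb a b. ?g x = ?g'' x"
    using AE_leb_subinterval[OF K'' order.refl less_imp_le[OF abc(2)]] AE_leb_mem[of a b]
    by eventually_elim (simp add: g_def)
  then have l: "AE x in leb a b. v x = jump_fun a b C ?g'' P J x"
    using h(1) jump_fun_AE_cong[of ?g ?g'' a b C P J] by simp
  have "AE x in leb b c. ?g' x = ?g'' x"
    using AE_leb_subinterval[OF K'' less_imp_le[OF abc(1)] order.refl] AE_leb_mem[of b c]
    by eventually_elim (simp add: g_def)
  then have r: "AE x in leb b c. v x = jump_fun b c C' ?g'' P' J' x"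
    using h(2) jump_fun_AE_cong[of ?g' ?g'' b c C' P' J'] by simp
  obtain J'' where "AE x in leb a c. v x = jump_fun a c C ?g'' ?P J'' x"
    by (rule jump_fun_join[OF gi abc _ _ _ _ l r]) (use h in auto)
  moreover have "finite ?P" "?P \<subseteq> {a<..<c}" using h abc by auto
  ultimately have "jump_rep2 a c v C D h'' ?P J'' K''" using L2 unfolding jump_rep2_def by blast
  then show ?thesis by blast
qed

lemma pw_H2_imp_jump_rep2:
  assumes "pw_H2 a b v" "a < b"
  obtains C D h P J K where "jump_rep2 a b v C D h P J K"
proof -
  obtain n and s :: "nat \<Rightarrow> real" where s: "s 0 = a" "s n = b" "\<And>i. i < n \<Longrightarrow> s i < s (Suc i)"
    "\<And>i. i < n \<Longrightarrow> H2 (s i) (s (Suc i)) v" using assms(1) unfolding pw_H2_def by blast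
  have piece: "\<exists>C D h P J K. jump_rep2 (s i) (s (Suc i)) v C D h P J K" if i: "i < n" for i
  proof -
    obtain C D h where "L2 (s i) (s (Suc i)) h"
      "AE x in leb (s i) (s (Suc i)). v x = C + prim (s i) (s (Suc i)) (\<lambda>t. D + prim (s i) (s (Suc i)) h t) x"
      using H2_imp_prim[OF s(4)[OF i] s(3)[OF i]] .
    then have "jump_rep2 (s i) (s (Suc i)) v C D h {} (\<lambda>_. 0) (\<lambda>_. 0)" by (simp add: jump_rep2_def)
    then show ?thesis by blast
  qed
  have "n \<noteq> 0"
  proof
    assume "n = 0"
    then show False using s(1,2) assms(2) by simp
  qed
  \<comment> \<open>The induction starts from the first piece, not from an empty interval, because
    joining needs a nondegenerate interval on the left.\<close>
  have "s 0 < s (Suc k) \<and> (\<exists>C D h P J K. jump_rep2 (s 0) (s (Suc k)) v C D h P J K)" if "k < n" for k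
    using that
  proof (induction k)
    case 0
    then show ?case using piece[of 0] s(3)[of 0] by simp
  next
    case (Suc k)
    then have IH: "s 0 < s (Suc k)" "\<exists>C D h P J K. jump_rep2 (s 0) (s (Suc k)) v C D h P J K" by auto
    have lt: "s (Suc k) < s (Suc (Suc k))" using s(3)[of "Suc k"] Suc.prems by simp
    obtain C D h P J K where 1: "jump_rep2 (s 0) (s (Suc k)) v C D h P J K" using IH(2) by blast
    obtain C' D' h' P' J' K' where 2: "jump_rep2 (s (Suc k)) (s (Suc (Suc k))) v C' D' h' P' J' K'"
      using piece[OF Suc.prems] by blast
    show ?case using jump_rep2_join[OF IH(1) lt 1 2] IH(1) lt by simp
  qed
  from this[of "n - 1"] show ?thesis using \<open>n \<noteq> 0\<close> s(1,2) that by auto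
qed

text \<open>All that \<open>F1\<close> needs to know about the derivatives and singularities of its
  first argument is read off the normal form.\<close>

lemma jump_rep2_ac_derivs:
  assumes v: "jump_rep2 a b v C D h P J K" and ab: "a \<le> b"
  shows "AE x in leb a b. ac_deriv a b v x = jump_fun a b D h P K x"
    and "AE x in leb a b. ac_deriv a b (ac_deriv a b v) x = h x"
    and "disc_set a b v = {s \<in> P. J s \<noteq> 0}" "disc_set a b (ac_deriv a b v) = {s \<in> P. K s \<noteq> 0}"
proof -
  note r = v[unfolded jump_rep2_def]
  then have P: "finite P" "P \<subseteq> {a<..<b}" and h: "integrable (leb a b) h" using L2_integrable by auto
  note g = integrable_jump_fun[OF h]
  show 1: "AE x in leb a b. ac_deriv a b v x = jump_fun a b D h P K x"
    using r ac_deriv_jump_fun[OF g P ab] by blast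
  show "AE x in leb a b. ac_deriv a b (ac_deriv a b v) x = h x"
    by (rule ac_deriv_jump_fun[OF h P ab 1])
  show "disc_set a b v = {s \<in> P. J s \<noteq> 0}" using r disc_set_jump_fun[OF g P] by blast
  show "disc_set a b (ac_deriv a b v) = {s \<in> P. K s \<noteq> 0}" by (rule disc_set_jump_fun[OF h P 1])
qed

lemma jump_rep2_continuous:
  assumes v: "jump_rep2 a b v C D h P J K" and "\<And>s. s \<in> P \<Longrightarrow> J s = 0" "\<And>s. s \<in> P \<Longrightarrow> K s = 0"
  shows "AE x in leb a b. v x = C + prim a b (\<lambda>t. D + prim a b h t) x"
proof -
  have "jump_fun a b D h P K = (\<lambda>t. D + prim a b h t)" using assms(3) by (simp add: jump_fun_def fun_eq_iff)
  then show ?thesis using v assms(2) by (simp add: jump_rep2_def jump_fun_def)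
qed

section \<open>The space \<open>L\<^sup>2\<close> on an interval\<close>

lemma L2_norm_power2: "(L2_norm a b f)\<^sup>2 = (LINT x|leb a b. (f x)\<^sup>2)"
  by (simp add: L2_norm_def)

lemma L2_norm_nonneg [simp]: "0 \<le> L2_norm a b f"
  by (simp add: L2_norm_def)

lemma L2_norm_AE_cong:
  assumes "AE x in leb a b. f x = g x" shows "L2_norm a b f = L2_norm a b g"
  unfolding L2_norm_def by (rule arg_cong[where f=sqrt], rule integral_leb_AE_cong) (use assms in eventually_elim, simp)

lemma L2_norm_cmult: "L2_norm a b (\<lambda>x. c * f x) = \<bar>c\<bar> * L2_norm a b f"
  by (simp add: L2_norm_def power_mult_distrib real_sqrt_mult)

lemma L2_norm_minus_commute: "L2_norm a b (\<lambda>x. f x - g x) = L2_norm a b (\<lambda>x. g x - f x)"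
  unfolding L2_norm_def by (simp add: power2_commute)

lemma L2_integrable_power2: "L2 a b f \<Longrightarrow> integrable (leb a b) (\<lambda>x. (f x)\<^sup>2)"
  by (simp add: L2_def)

lemma L2_Cauchy_Schwarz:
  assumes f: "L2 a b f" and g: "L2 a b g"
  shows "\<bar>LINT x|leb a b. f x * g x\<bar> \<le> L2_norm a b f * L2_norm a b g"
proof -
  define A B I where "A = (L2_norm a b f)\<^sup>2" and "B = (L2_norm a b g)\<^sup>2" and "I = (LINT x|leb a b. f x * g x)"
  have q: "0 \<le> s\<^sup>2 * A - 2 * s * t * I + t\<^sup>2 * B" for s t
  proof -
    have "0 \<le> (LINT x|leb a b. (s * f x - t * g x)\<^sup>2)" by simp
    also have "\<dots> = (LINT x|leb a b. s\<^sup>2 * (f x)\<^sup>2 - 2 * s * t * (f x * g x) + t\<^sup>2 * (g x)\<^sup>2)"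
      by (rule Bochner_Integration.integral_cong) (auto simp: power2_eq_square algebra_simps)
    also have "\<dots> = s\<^sup>2 * A - 2 * s * t * I + t\<^sup>2 * B"
      unfolding A_def B_def I_def L2_norm_power2
      using L2_integrable_power2[OF f] L2_integrable_power2[OF g] L2_mult_integrable[OF f g] by simp
    finally show ?thesis .
  qed
  have "I\<^sup>2 \<le> A * B"
  proof (cases "B = 0")
    case True
    have "I = 0"
    proof (rule ccontr)
      assume "I \<noteq> 0"
      \<comment> \<open>With B = 0 the quadratic form is linear in t, and this t gives it the value
        -1.\<close>
      then show False using q[of 1 "(A + 1) / (2 * I)"] True by (simp add: field_simps)
    qed
    then show ?thesis using True by simp
  next
    case False
    then have "B > 0" by (simp add: B_def less_le)
    \<comment> \<open>The pair (B, I) is the minimizing ratio t/s = I/B with denominators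
      cleared.\<close>
    have "0 \<le> B * (B * A - I\<^sup>2)" using q[of B I] by (simp add: power2_eq_square algebra_simps)
    then show ?thesis using \<open>B > 0\<close> by (simp add: zero_le_mult_iff mult.commute)
  qed
  then have "\<bar>I\<bar> \<le> sqrt (A * B)" by (simp add: real_le_rsqrt)
  then show ?thesis by (simp add: A_def B_def I_def real_sqrt_mult)
qed

lemma L2_norm_triangle:
  assumes f: "L2 a b f" and g: "L2 a b g"
  shows "L2_norm a b (\<lambda>x. f x + g x) \<le> L2_norm a b f + L2_norm a b g"
proof (rule power2_le_imp_le)
  have "(L2_norm a b (\<lambda>x. f x + g x))\<^sup>2 = (LINT x|leb a b. (f x)\<^sup>2 + 2 * (f x * g x) + (g x)\<^sup>2)"
    unfolding L2_norm_power2 by (rule Bochner_Integration.integral_cong) (auto simp: power2_eq_square algebra_simps)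
  also have "\<dots> = (L2_norm a b f)\<^sup>2 + 2 * (LINT x|leb a b. f x * g x) + (L2_norm a b g)\<^sup>2"
    unfolding L2_norm_power2 using L2_integrable_power2[OF f] L2_integrable_power2[OF g] L2_mult_integrable[OF f g] by simp
  also have "\<dots> \<le> (L2_norm a b f + L2_norm a b g)\<^sup>2"
    using L2_Cauchy_Schwarz[OF f g] by (simp add: power2_sum)
  finally show "(L2_norm a b (\<lambda>x. f x + g x))\<^sup>2 \<le> (L2_norm a b f + L2_norm a b g)\<^sup>2" .
qed simp

lemma L2_const: "L2 a b (\<lambda>_. c)"
  by (rule L2_bounded[of _ _ _ "\<bar>c\<bar>"]) auto

lemma measure_leb [simp]: "a \<le> b \<Longrightarrow> measure (leb a b) {a<..<b} = b - a"
  by (simp add: measure_restrict_space)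

lemma integral_leb_const: "a \<le> b \<Longrightarrow> (LINT x|leb a b. c) = c * (b - a)" for c :: real
  by simp

lemma L2_norm_const: "a \<le> b \<Longrightarrow> L2_norm a b (\<lambda>_. c) = \<bar>c\<bar> * sqrt (b - a)"
  by (simp add: L2_norm_def real_sqrt_mult)

lemma L2_abs: "L2 a b f \<Longrightarrow> L2 a b (\<lambda>x. \<bar>f x\<bar>)"
  unfolding L2_def by auto

lemma integral_abs_le_L2_norm:
  assumes "L2 a b f" "a \<le> b" shows "(LINT x|leb a b. \<bar>f x\<bar>) \<le> sqrt (b - a) * L2_norm a b f"
proof -
  have "L2_norm a b (\<lambda>x. \<bar>f x\<bar>) = L2_norm a b f" by (simp add: L2_norm_def)
  then show ?thesis
    using L2_Cauchy_Schwarz[OF L2_abs[OF assms(1)] L2_const[of _ _ 1]] L2_norm_const[OF assms(2), of 1] by (simp add: mult.commute)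
qed

lemma prim_le_L2_norm:
  assumes "L2 a b f" "a \<le> b" shows "\<bar>prim a b f x\<bar> \<le> sqrt (b - a) * L2_norm a b f"
  using prim_bound[OF L2_integrable[OF assms(1)]] integral_abs_le_L2_norm[OF assms] by (rule order.trans)

lemma L2_norm_le_bound:
  assumes "f \<in> borel_measurable (leb a b)" "\<And>x. x \<in> {a<..<b} \<Longrightarrow> \<bar>f x\<bar> \<le> B" "a \<le> b" "0 \<le> B"
  shows "L2_norm a b f \<le> B * sqrt (b - a)"
proof -
  have "(LINT x|leb a b. (f x)\<^sup>2) \<le> (LINT x|leb a b. B\<^sup>2)"
    using L2_integrable_power2[OF L2_bounded[OF assms(1,2)]] L2_integrable_power2[OF L2_const]
  proof (rule integral_mono)
    show "(f x)\<^sup>2 \<le> B\<^sup>2" if "x \<in> space (leb a b)" for x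
      using power_mono[OF assms(2)[of x], of 2] that by simp
  qed
  then have "L2_norm a b f \<le> sqrt (B\<^sup>2 * (b - a))"
    unfolding L2_norm_def integral_leb_const[OF assms(3)] by (rule real_sqrt_le_mono)
  then show ?thesis using assms(4) by (simp add: real_sqrt_mult)
qed

lemma L2_norm_prim_le:
  assumes "L2 a b f" "a \<le> b" shows "L2_norm a b (prim a b f) \<le> (b - a) * L2_norm a b f"
proof -
  have "L2_norm a b (prim a b f) \<le> (sqrt (b - a) * L2_norm a b f) * sqrt (b - a)"
    by (rule L2_norm_le_bound[OF prim_measurable[OF L2_integrable[OF assms(1)]] prim_le_L2_norm[OF assms] assms(2)])
       (use assms in simp)
  also have "\<dots> = (b - a) * L2_norm a b f"
    using assms(2) by (metis (no_types, opaque_lifting) abs_of_nonneg diff_ge_0_iff_ge mult.assoc mult.commute real_sqrt_mult_self)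
  finally show ?thesis .
qed

lemma prim_diff:
  "integrable (leb a b) f \<Longrightarrow> integrable (leb a b) g \<Longrightarrow> prim a b (\<lambda>t. f t - g t) x = prim a b f x - prim a b g x"
  using prim_lincomb[of a b f g 1 "-1" x] by simp

text \<open>Membership in L2 is part of the notion because \<open>L2_norm\<close> is 0 by default
  when the square is not integrable.\<close>

definition L2_lim :: "real \<Rightarrow> real \<Rightarrow> (nat \<Rightarrow> real \<Rightarrow> real) \<Rightarrow> (real \<Rightarrow> real) \<Rightarrow> bool" where
  "L2_lim a b f g \<longleftrightarrow> (\<forall>n. L2 a b (f n)) \<and> L2 a b g \<and> (\<lambda>n. L2_norm a b (\<lambda>x. f n x - g x)) \<longlonglongrightarrow> 0"

lemma L2_lim_const: "L2 a b f \<Longrightarrow> L2_lim a b (\<lambda>_. f) f"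
  by (simp add: L2_lim_def L2_norm_def)

lemma L2_lim_lincomb:
  assumes f: "L2_lim a b f f'" and g: "L2_lim a b g g'"
  shows "L2_lim a b (\<lambda>n x. s * f n x + t * g n x) (\<lambda>x. s * f' x + t * g' x)"
proof -
  have "(\<lambda>n. \<bar>s\<bar> * L2_norm a b (\<lambda>x. f n x - f' x) + \<bar>t\<bar> * L2_norm a b (\<lambda>x. g n x - g' x)) \<longlonglongrightarrow> \<bar>s\<bar> * 0 + \<bar>t\<bar> * 0"
    using assms by (intro tendsto_intros) (auto simp: L2_lim_def)
  then have lim: "(\<lambda>n. \<bar>s\<bar> * L2_norm a b (\<lambda>x. f n x - f' x) + \<bar>t\<bar> * L2_norm a b (\<lambda>x. g n x - g' x)) \<longlonglongrightarrow> 0" by simp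
  have le: "L2_norm a b (\<lambda>x. (s * f n x + t * g n x) - (s * f' x + t * g' x)) \<le> \<bar>s\<bar> * L2_norm a b (\<lambda>x. f n x - f' x) + \<bar>t\<bar> * L2_norm a b (\<lambda>x. g n x - g' x)" for n
  proof -
    have d: "L2 a b (\<lambda>x. f n x - f' x)" "L2 a b (\<lambda>x. g n x - g' x)" using assms by (auto simp: L2_lim_def intro: L2_diff)
    have "L2 a b (\<lambda>x. s * (f n x - f' x))" "L2 a b (\<lambda>x. t * (g n x - g' x))"
      using L2_lincomb[OF d(1) d(1), of s 0] L2_lincomb[OF d(2) d(2), of t 0] by simp_all
    from L2_norm_triangle[OF this] show ?thesis unfolding L2_norm_cmult by (simp add: algebra_simps)
  qed
  have "(\<lambda>n. L2_norm a b (\<lambda>x. (s * f n x + t * g n x) - (s * f' x + t * g' x))) \<longlonglongrightarrow> 0"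
    by (rule tendsto_sandwich[OF _ _ tendsto_const lim]) (auto simp: le)
  then show ?thesis using assms by (auto simp: L2_lim_def intro: L2_lincomb)
qed

lemma L2_lim_add: "L2_lim a b f f' \<Longrightarrow> L2_lim a b g g' \<Longrightarrow> L2_lim a b (\<lambda>n x. f n x + g n x) (\<lambda>x. f' x + g' x)"
  using L2_lim_lincomb[of a b f f' g g' 1 1] by simp

lemma L2_lim_diff: "L2_lim a b f f' \<Longrightarrow> L2_lim a b g g' \<Longrightarrow> L2_lim a b (\<lambda>n x. f n x - g n x) (\<lambda>x. f' x - g' x)"
  using L2_lim_lincomb[of a b f f' g g' 1 "-1"] by simp

lemma L2_lim_prim:
  assumes f: "L2_lim a b f g" and ab: "a \<le> b" shows "L2_lim a b (\<lambda>n. prim a b (f n)) (prim a b g)"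
proof -
  have L2: "L2 a b (f n)" "L2 a b g" for n using f by (auto simp: L2_lim_def)
  note i = L2_integrable[OF L2(1)] L2_integrable[OF L2(2)]
  have "(\<lambda>n. (b - a) * L2_norm a b (\<lambda>x. f n x - g x)) \<longlonglongrightarrow> (b - a) * 0"
    using f by (intro tendsto_intros) (auto simp: L2_lim_def)
  then have lim: "(\<lambda>n. (b - a) * L2_norm a b (\<lambda>x. f n x - g x)) \<longlonglongrightarrow> 0" by simp
  have "L2_norm a b (\<lambda>x. prim a b (f n) x - prim a b g x) \<le> (b - a) * L2_norm a b (\<lambda>x. f n x - g x)" for n
  proof -
    have "(\<lambda>x. prim a b (f n) x - prim a b g x) = prim a b (\<lambda>x. f n x - g x)"
      by (simp add: prim_diff[OF i] fun_eq_iff)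
    then show ?thesis using L2_norm_prim_le[OF L2_diff[OF L2] ab] by simp
  qed
  then have "(\<lambda>n. L2_norm a b (\<lambda>x. prim a b (f n) x - prim a b g x)) \<longlonglongrightarrow> 0"
    by (intro tendsto_sandwich[OF _ _ tendsto_const lim]) auto
  then show ?thesis using L2_prim[OF i(1)] L2_prim[OF i(2)] by (simp add: L2_lim_def)
qed

lemma L2_lim_integral_mult:
  assumes f: "L2_lim a b f f'" and g: "L2_lim a b g g'"
  shows "(\<lambda>n. LINT x|leb a b. f n x * g n x) \<longlonglongrightarrow> (LINT x|leb a b. f' x * g' x)"
proof -
  have L2: "L2 a b (f n)" "L2 a b f'" "L2 a b (g n)" "L2 a b g'" for n using f g by (auto simp: L2_lim_def)
  define F G where "F n = L2_norm a b (\<lambda>x. f n x - f' x)" and "G n = L2_norm a b (\<lambda>x. g n x - g' x)" for n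
  have "(\<lambda>n. F n * G n + F n * L2_norm a b g' + L2_norm a b f' * G n) \<longlonglongrightarrow> 0 * 0 + 0 * L2_norm a b g' + L2_norm a b f' * 0"
    using f g unfolding F_def G_def by (intro tendsto_intros) (auto simp: L2_lim_def)
  then have lim: "(\<lambda>n. F n * G n + F n * L2_norm a b g' + L2_norm a b f' * G n) \<longlonglongrightarrow> 0" by simp
  have le: "\<bar>(LINT x|leb a b. f n x * g n x) - (LINT x|leb a b. f' x * g' x)\<bar> \<le> F n * G n + F n * L2_norm a b g' + L2_norm a b f' * G n" for n
  proof -
    note d = L2_diff[OF L2(1,2)] L2_diff[OF L2(3,4)]
    have "(LINT x|leb a b. f n x * g n x) - (LINT x|leb a b. f' x * g' x) = (LINT x|leb a b. f n x * g n x - f' x * g' x)"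
      by (rule Bochner_Integration.integral_diff[symmetric]) (intro L2_mult_integrable L2)+
    also have "\<dots> = (LINT x|leb a b. (f n x - f' x) * (g n x - g' x) + (f n x - f' x) * g' x + f' x * (g n x - g' x))"
      by (rule Bochner_Integration.integral_cong) (auto simp: algebra_simps)
    also have "\<dots> = (LINT x|leb a b. (f n x - f' x) * (g n x - g' x)) + (LINT x|leb a b. (f n x - f' x) * g' x) + (LINT x|leb a b. f' x * (g n x - g' x))"
      by (simp only: Bochner_Integration.integral_add Bochner_Integration.integrable_add L2_mult_integrable[OF d] L2_mult_integrable[OF d(1) L2(4)] L2_mult_integrable[OF L2(2) d(2)])
    finally show ?thesis
      using L2_Cauchy_Schwarz[OF d(1)[of n] d(2)[of n]] L2_Cauchy_Schwarz[OF d(1)[of n] L2(4)] L2_Cauchy_Schwarz[OF L2(2) d(2)[of n]]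
      unfolding F_def G_def by linarith
  qed
  have "(\<lambda>n. (LINT x|leb a b. f n x * g n x) - (LINT x|leb a b. f' x * g' x)) \<longlonglongrightarrow> 0"
    by (rule tendsto_rabs_zero_cancel, rule tendsto_sandwich[OF _ _ tendsto_const lim]) (auto simp: le)
  then show ?thesis by (simp add: LIM_zero_iff)
qed

lemma L2_lim_integral:
  assumes "L2_lim a b f f'" shows "(\<lambda>n. LINT x|leb a b. f n x) \<longlonglongrightarrow> (LINT x|leb a b. f' x)"
  using L2_lim_integral_mult[OF assms L2_lim_const[OF L2_const[of _ _ 1]]] by simp

lemma L2_lim_integral_power2:
  assumes "L2_lim a b f f'" shows "(\<lambda>n. LINT x|leb a b. (f n x)\<^sup>2) \<longlonglongrightarrow> (LINT x|leb a b. (f' x)\<^sup>2)"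
  using L2_lim_integral_mult[OF assms assms] by (simp add: power2_eq_square)

text \<open>Riesz-Fischer: a subsequence with geometrically small increments has an almost
  everywhere absolutely convergent telescoping series, and Fatou's lemma upgrades the pointwise
  limit to a limit in norm of the full sequence.\<close>

lemma L2_complete:
  assumes L2: "\<And>n. L2 a b (f n)" and ab: "a \<le> b"
    and Cauchy: "\<And>e. e > 0 \<Longrightarrow> \<exists>N. \<forall>m\<ge>N. \<forall>n\<ge>N. L2_norm a b (\<lambda>x. f m x - f n x) < e"
  obtains F where "L2_lim a b f F"
proof -
  have "\<exists>N. \<forall>m\<ge>N. \<forall>n\<ge>N. L2_norm a b (\<lambda>x. f m x - f n x) < (1/2) ^ k" for k :: nat
    by (rule Cauchy) simp
  then obtain N where N: "\<And>k m n. m \<ge> N k \<Longrightarrow> n \<ge> N k \<Longrightarrow> L2_norm a b (\<lambda>x. f m x - f n x) < (1/2) ^ k" by metis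
  \<comment> \<open>The maximum makes the indices strictly increasing and at the same time at least
    \<open>N k\<close>.\<close>
  define r where "r = rec_nat (N 0) (\<lambda>k p. max (Suc p) (N (Suc k)))"
  have r_Suc: "r (Suc k) = max (Suc (r k)) (N (Suc k))" for k by (simp add: r_def)
  have r_mono: "strict_mono r" by (rule strict_mono_Suc_iff[THEN iffD2]) (simp add: r_Suc less_max_iff_disj)
  have rN: "r k \<ge> N k" for k by (cases k) (auto simp: r_Suc r_def)
  define D where "D k x = \<bar>f (r (Suc k)) x - f (r k) x\<bar>" for k x
  have D_L2: "L2 a b (D k)" for k unfolding D_def by (intro L2_abs L2_diff L2)
  note fm = L2[unfolded L2_def, THEN conjunct1]
  have D_meas: "D k \<in> borel_measurable (leb a b)" for k using D_L2 by (simp add: L2_def)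
  have D_int: "(LINT x|leb a b. D k x) \<le> sqrt (b - a) * (1/2) ^ k" for k
  proof -
    have "L2_norm a b (\<lambda>x. f (r (Suc k)) x - f (r k) x) < (1/2) ^ k"
      using rN[of k] r_Suc[of k] by (intro N) auto
    then have "sqrt (b - a) * L2_norm a b (\<lambda>x. f (r (Suc k)) x - f (r k) x) \<le> sqrt (b - a) * (1/2) ^ k"
      using ab by (intro mult_left_mono) auto
    then show ?thesis using integral_abs_le_L2_norm[OF L2_diff[OF L2 L2] ab, of "r (Suc k)" "r k"] unfolding D_def by linarith
  qed
  have "AE x in leb a b. (\<Sum>k. ennreal (D k x)) \<noteq> \<infinity>"
  proof (rule nn_integral_noteq_infinite)
    show "(\<lambda>x. \<Sum>k. ennreal (D k x)) \<in> borel_measurable (leb a b)" using D_meas by measurable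
    have "(\<integral>\<^sup>+x. (\<Sum>k. ennreal (D k x)) \<partial>leb a b) = (\<Sum>k. \<integral>\<^sup>+x. ennreal (D k x) \<partial>leb a b)"
      using D_meas by (intro nn_integral_suminf) measurable
    also have "\<dots> = (\<Sum>k. ennreal (LINT x|leb a b. D k x))"
      using L2_integrable[OF D_L2] by (subst nn_integral_eq_integral) (auto simp: D_def)
    also have "\<dots> \<le> (\<Sum>k. ennreal (sqrt (b - a) * (1/2) ^ k))"
      by (intro suminf_le ennreal_leI D_int) auto
    also have "\<dots> = ennreal (\<Sum>k. sqrt (b - a) * (1/2) ^ k)"
      using ab by (intro suminf_ennreal2) (auto intro!: summable_mult summable_geometric)
    finally show "(\<integral>\<^sup>+x. (\<Sum>k. ennreal (D k x)) \<partial>leb a b) \<noteq> \<infinity>" by (auto simp: top_unique)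
  qed
  then have conv: "AE x in leb a b. convergent (\<lambda>k. f (r k) x)"
  proof eventually_elim
    case (elim x)
    then have "summable (\<lambda>k. D k x)" by (intro summable_suminf_not_top) (auto simp: D_def)
    then have "summable (\<lambda>k. f (r (Suc k)) x - f (r k) x)" unfolding D_def by (rule summable_rabs_cancel)
    then have "convergent (\<lambda>n. \<Sum>k<n. f (r (Suc k)) x - f (r k) x)" by (simp add: summable_iff_convergent)
    then have "convergent (\<lambda>n. f (r n) x - f (r 0) x)"
      by (simp add: sum_lessThan_telescope[of "\<lambda>k. f (r k) x"])
    then have "convergent (\<lambda>n. f (r n) x - f (r 0) x + f (r 0) x)" by (intro convergent_add convergent_const)
    then show ?case by simp
  qed
  define F where "F x = lim (\<lambda>k. f (r k) x)" for x
  have Fm: "F \<in> borel_measurable (leb a b)" unfolding F_def using fm by measurable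
  have Flim: "AE x in leb a b. (\<lambda>k. f (r k) x) \<longlonglongrightarrow> F x"
    using conv by eventually_elim (simp add: F_def convergent_LIMSEQ_iff)
  \<comment> \<open>Fatou along the subsequence with \<open>n\<close> fixed; this yields both that
    \<open>F\<close> differs from \<open>f n\<close> by an L2 function and the rate.\<close>
  have key: "integrable (leb a b) (\<lambda>x. (F x - f n x)\<^sup>2) \<and> L2_norm a b (\<lambda>x. F x - f n x) \<le> (1/2) ^ j" if n: "n \<ge> N j" for n j
  proof -
    have "(\<integral>\<^sup>+x. ennreal ((F x - f n x)\<^sup>2) \<partial>leb a b) = (\<integral>\<^sup>+x. liminf (\<lambda>k. ennreal ((f (r k) x - f n x)\<^sup>2)) \<partial>leb a b)"
    proof (rule nn_integral_cong_AE)
      show "AE x in leb a b. ennreal ((F x - f n x)\<^sup>2) = liminf (\<lambda>k. ennreal ((f (r k) x - f n x)\<^sup>2))"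
        using Flim
      proof eventually_elim
        case (elim x)
        then have "(\<lambda>k. ennreal ((f (r k) x - f n x)\<^sup>2)) \<longlonglongrightarrow> ennreal ((F x - f n x)\<^sup>2)"
          by (intro tendsto_intros) auto
        from lim_imp_Liminf[OF _ this] show ?case by simp
      qed
    qed
    also have "\<dots> \<le> liminf (\<lambda>k. \<integral>\<^sup>+x. ennreal ((f (r k) x - f n x)\<^sup>2) \<partial>leb a b)"
      using fm by (intro nn_integral_liminf) measurable
    also have "\<dots> \<le> limsup (\<lambda>k. \<integral>\<^sup>+x. ennreal ((f (r k) x - f n x)\<^sup>2) \<partial>leb a b)"
      by (rule Liminf_le_Limsup) simp
    also have "\<dots> \<le> ennreal (((1/2) ^ j)\<^sup>2)"
    proof (rule Limsup_bounded)
      have "\<forall>\<^sub>F k in sequentially. k \<ge> j" by (rule eventually_ge_at_top)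
      then show "\<forall>\<^sub>F k in sequentially. (\<integral>\<^sup>+x. ennreal ((f (r k) x - f n x)\<^sup>2) \<partial>leb a b) \<le> ennreal (((1/2) ^ j)\<^sup>2)"
      proof eventually_elim
        case (elim k)
        have "r k \<ge> r j" using r_mono elim by (simp add: strict_mono_less_eq)
        then have "L2_norm a b (\<lambda>x. f (r k) x - f n x) < (1/2) ^ j" using rN[of j] n by (intro N) auto
        then have "(L2_norm a b (\<lambda>x. f (r k) x - f n x))\<^sup>2 \<le> ((1/2) ^ j)\<^sup>2" by (intro power_mono) auto
        then show ?case
          using L2_integrable_power2[OF L2_diff[OF L2 L2]] unfolding L2_norm_power2
          by (subst nn_integral_eq_integral) (auto intro: ennreal_leI)
      qed
    qed
    finally have le: "(\<integral>\<^sup>+x. ennreal ((F x - f n x)\<^sup>2) \<partial>leb a b) \<le> ennreal (((1/2) ^ j)\<^sup>2)" .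
    have "integrable (leb a b) (\<lambda>x. (F x - f n x)\<^sup>2)"
      by (rule integrableI_nonneg) (use Fm fm le in \<open>auto intro: le_less_trans\<close>)
    moreover have "(L2_norm a b (\<lambda>x. F x - f n x))\<^sup>2 \<le> ((1/2) ^ j)\<^sup>2"
      using le calculation unfolding L2_norm_power2 by (subst (asm) nn_integral_eq_integral) auto
    ultimately show ?thesis by (auto intro: power2_le_imp_le)
  qed
  have FL2: "L2 a b (\<lambda>x. F x - f (N 0) x)" using key[of 0 "N 0"] Fm fm by (auto simp: L2_def)
  have "L2 a b F" using L2_add[OF FL2 L2[of "N 0"]] by simp
  moreover have "(\<lambda>n. L2_norm a b (\<lambda>x. f n x - F x)) \<longlonglongrightarrow> 0"
  proof (rule LIMSEQ_I)
    fix e :: real assume "e > 0"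
    then obtain j where j: "(1/2::real) ^ j < e" using real_arch_pow_inv[of e "1/2"] by auto
    show "\<exists>no. \<forall>n\<ge>no. norm (L2_norm a b (\<lambda>x. f n x - F x) - 0) < e"
      using key[of j] j L2_norm_minus_commute[of a b "f _" F] by (intro exI[of _ "N j"]) fastforce
  qed
  ultimately show ?thesis using that L2 by (auto simp: L2_lim_def)
qed

text \<open>The midpoint form measures the gain of averaging; it drives every Cauchy estimate and
  every uniqueness argument below.\<close>

lemma L2_parallelogram:
  assumes "L2 a b f" "L2 a b g"
  shows "(LINT x|leb a b. (1/2 * f x + 1/2 * g x)\<^sup>2) =
    ((LINT x|leb a b. (f x)\<^sup>2) + (LINT x|leb a b. (g x)\<^sup>2)) / 2 - (L2_norm a b (\<lambda>x. f x - g x))\<^sup>2 / 4"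
proof -
  note i = L2_integrable_power2[OF assms(1)] L2_integrable_power2[OF assms(2)] L2_integrable_power2[OF L2_diff[OF assms]]
  have "(LINT x|leb a b. (1/2 * f x + 1/2 * g x)\<^sup>2) = (LINT x|leb a b. ((f x)\<^sup>2 / 2 + (g x)\<^sup>2 / 2) - (f x - g x)\<^sup>2 / 4)"
    by (rule Bochner_Integration.integral_cong) (auto simp: power2_eq_square field_simps)
  also have "\<dots> = (LINT x|leb a b. (f x)\<^sup>2) / 2 + (LINT x|leb a b. (g x)\<^sup>2) / 2 - (LINT x|leb a b. (f x - g x)\<^sup>2) / 4"
    using i by simp
  finally show ?thesis by (simp add: L2_norm_power2 add_divide_distrib)
qed

text \<open>The right-hand side is exactly what the midpoint gain of one quarter yields for two
  competitors within 1/(i+1) and 1/(j+1) of an infimum.\<close>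

lemma L2_complete_of_rate:
  assumes L2: "\<And>n. L2 a b (g n)" and ab: "a \<le> b" and c: "c > 0"
    and le: "\<And>i j. c * (L2_norm a b (\<lambda>x. g i x - g j x))\<^sup>2 \<le> 2 / real (Suc i) + 2 / real (Suc j)"
  obtains G where "L2_lim a b g G"
proof (rule L2_complete[OF L2 ab])
  show "\<exists>N. \<forall>i\<ge>N. \<forall>j\<ge>N. L2_norm a b (\<lambda>x. g i x - g j x) < e" if e: "e > 0" for e
  proof -
    obtain N where N: "1 / real (Suc N) < c * e\<^sup>2 / 4"
      using reals_Archimedean[of "c * e\<^sup>2 / 4"] c e by (auto simp: inverse_eq_divide)
    show ?thesis
    proof (intro exI[of _ N] allI impI)
      fix i j assume "N \<le> i" "N \<le> j"
      then have "1 / real (Suc i) \<le> 1 / real (Suc N)" "1 / real (Suc j) \<le> 1 / real (Suc N)"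
        by (auto intro!: divide_left_mono)
      then have "c * (L2_norm a b (\<lambda>x. g i x - g j x))\<^sup>2 < c * e\<^sup>2" using le[of i j] N by linarith
      then have "(L2_norm a b (\<lambda>x. g i x - g j x))\<^sup>2 < e\<^sup>2" using c by simp
      then show "L2_norm a b (\<lambda>x. g i x - g j x) < e" using e by (simp add: power_less_imp_less_base)
    qed
  qed
qed (rule that)

section \<open>Density of test functions and \<open>H\<^sup>2\<^sub>0\<close>\<close>

lemma L2_test_fun: "test_fun a b \<phi> \<Longrightarrow> L2 c d \<phi>"
proof -
  assume \<phi>: "test_fun a b \<phi>"
  obtain B where "\<And>x. \<bar>\<phi> x\<bar> \<le> B" using test_fun_bounded[OF \<phi>] by blast
  then show ?thesis by (intro L2_bounded[OF test_fun_leb_measurable[OF \<phi>]])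
qed

text \<open>A sequence of test functions minimizing the distance to \<open>f\<close> converges in \<open>L\<^sup>2\<close>, and the
  difference of \<open>f\<close> and its limit is orthogonal to all test functions, hence zero.\<close>

lemma L2_test_fun_dense:
  assumes f: "L2 a b f" and ab: "a < b"
  obtains \<psi> where "\<And>n. test_fun a b (\<psi> n)" "L2_lim a b \<psi> f"
proof -
  define d where "d \<psi> = (L2_norm a b (\<lambda>x. f x - \<psi> x))\<^sup>2" for \<psi>
  define m where "m = Inf (d ` Collect (test_fun a b))"
  have ne: "d ` Collect (test_fun a b) \<noteq> {}"
    using test_fun_bump[of 1 a "(2*a+b)/3" "(a+2*b)/3" b] ab by auto
  have m_le: "m \<le> d \<psi>" if "test_fun a b \<psi>" for \<psi>
    unfolding m_def by (rule cInf_lower) (use that in \<open>auto intro!: bdd_belowI[of _ 0] simp: d_def\<close>)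
  have "\<exists>\<psi>. test_fun a b \<psi> \<and> d \<psi> < m + 1 / real (Suc n)" for n
    using cInf_lessD[OF ne, of "m + 1 / real (Suc n)"] unfolding m_def[symmetric] by auto
  then obtain \<psi> where \<psi>: "\<And>n. test_fun a b (\<psi> n)" "\<And>n. d (\<psi> n) < m + 1 / real (Suc n)" by metis
  have L2: "L2 a b (\<psi> n)" "L2 a b (\<lambda>x. f x - \<psi> n x)" for n
    using L2_test_fun[OF \<psi>(1)] L2_diff[OF f] by auto
  have rate: "1 * (L2_norm a b (\<lambda>x. \<psi> i x - \<psi> j x))\<^sup>2 \<le> 2 / real (Suc i) + 2 / real (Suc j)" for i j
  proof -
    have "f x - (1/2 * \<psi> j x + 1/2 * \<psi> i x) = 1/2 * (f x - \<psi> j x) + 1/2 * (f x - \<psi> i x)" for x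
      by (simp add: field_simps)
    then have "d (\<lambda>x. 1/2 * \<psi> j x + 1/2 * \<psi> i x) = (d (\<psi> j) + d (\<psi> i)) / 2 - (L2_norm a b (\<lambda>x. \<psi> i x - \<psi> j x))\<^sup>2 / 4"
      using L2_parallelogram[OF L2(2)[of j] L2(2)[of i]] by (simp add: d_def L2_norm_power2)
    moreover have "m \<le> d (\<lambda>x. 1/2 * \<psi> j x + 1/2 * \<psi> i x)" by (intro m_le test_fun_lincomb \<psi>(1))
    moreover have "2 / real (Suc i) = 2 * (1 / real (Suc i))" "2 / real (Suc j) = 2 * (1 / real (Suc j))" by simp_all
    ultimately show ?thesis using \<psi>(2)[of i] \<psi>(2)[of j] by argo
  qed
  obtain g where g: "L2_lim a b \<psi> g"
    by (rule L2_complete_of_rate[OF L2(1) _ _ rate]) (use ab in auto)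
  then have gL2: "L2 a b g" by (simp add: L2_lim_def)
  note fg = L2_diff[OF f gL2]
  have lim: "(\<lambda>n. d (\<lambda>x. \<psi> n x + t * \<phi> x)) \<longlonglongrightarrow> (LINT x|leb a b. (f x - (g x + t * \<phi> x))\<^sup>2)" if "test_fun a b \<phi>" for \<phi> t
    unfolding d_def L2_norm_power2
    using L2_lim_lincomb[OF g L2_lim_const[OF L2_test_fun[OF that, of a b]], of 1 t]
    by (intro L2_lim_integral_power2 L2_lim_diff L2_lim_const f) simp
  have "AE x in leb a b. f x - g x = 0"
  proof (rule test_integral_zero_imp_AE[OF L2_integrable[OF fg]])
    fix \<phi> assume \<phi>: "test_fun a b \<phi>"
    note \<phi>L2 = L2_test_fun[OF \<phi>, of a b]
    define A B J where "A = (LINT x|leb a b. (f x - g x)\<^sup>2)" and "B = (LINT x|leb a b. (\<phi> x)\<^sup>2)"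
      and "J = (LINT x|leb a b. (f x - g x) * \<phi> x)"
    have quad: "m \<le> A - 2 * t * J + t\<^sup>2 * B" for t
    proof -
      have "m \<le> d (\<lambda>x. \<psi> n x + t * \<phi> x)" for n
        using m_le[OF test_fun_lincomb[OF \<psi>(1)[of n] \<phi>, of 1 t]] by simp
      then have "m \<le> (LINT x|leb a b. (f x - (g x + t * \<phi> x))\<^sup>2)" by (intro LIMSEQ_le_const[OF lim[OF \<phi>]]) auto
      also have "\<dots> = (LINT x|leb a b. (f x - g x)\<^sup>2 - 2 * t * ((f x - g x) * \<phi> x) + t\<^sup>2 * (\<phi> x)\<^sup>2)"
        by (rule Bochner_Integration.integral_cong) (auto simp: power2_eq_square algebra_simps)
      also have "\<dots> = A - 2 * t * J + t\<^sup>2 * B"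
        using L2_integrable_power2[OF fg] L2_integrable_power2[OF \<phi>L2] L2_mult_integrable[OF fg \<phi>L2]
        by (simp add: A_def B_def J_def)
      finally show ?thesis .
    qed
    \<comment> \<open>The limit \<open>g\<close> realizes the infimum, so the first variation in the
      direction \<open>\<phi>\<close> must vanish.\<close>
    have "A \<le> m"
    proof (rule LIMSEQ_le)
      show "(\<lambda>n. d (\<psi> n)) \<longlonglongrightarrow> A" using lim[OF \<phi>, of 0] by (simp add: A_def)
      show "(\<lambda>n. m + 1 / real (Suc n)) \<longlonglongrightarrow> m" using tendsto_add[OF tendsto_const inverse_Suc_tendsto_0, of m] by simp
      show "\<exists>N. \<forall>n\<ge>N. d (\<psi> n) \<le> m + 1 / real (Suc n)" using \<psi>(2) less_imp_le by blast
    qed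
    then have nn: "0 \<le> t\<^sup>2 * B - 2 * t * J" for t using quad[of t] by linarith
    have "B \<ge> 0" by (simp add: B_def)
    \<comment> \<open>The denominator B + 1 avoids a case distinction on B = 0; inserting t = u
      gives -u^2 (B + 2) on the right-hand side.\<close>
    define u where "u = J / (B + 1)"
    have J: "J = u * (B + 1)" using \<open>B \<ge> 0\<close> by (simp add: u_def)
    have "u\<^sup>2 * (B + 2) \<le> 0" using nn[of u] unfolding J by (simp add: power2_eq_square algebra_simps)
    then have "u = 0" using \<open>B \<ge> 0\<close> by (simp add: mult_le_0_iff)
    then show "J = 0" by (simp add: J)
  qed
  then have ae: "AE x in leb a b. g x = f x" by eventually_elim simp
  have "L2_norm a b (\<lambda>x. \<psi> n x - g x) = L2_norm a b (\<lambda>x. \<psi> n x - f x)" for n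
    by (rule L2_norm_AE_cong) (use ae in eventually_elim, simp)
  then have "L2_lim a b \<psi> f" using g f by (simp add: L2_lim_def)
  then show ?thesis using that \<psi>(1) by blast
qed

text \<open>The second derivatives of functions in \<open>H\<^sup>2\<^sub>0\<close>: for \<open>z = prim (prim h)\<close> the two moment
  conditions say \<open>z' = z = 0\<close> at the right end point.\<close>

definition clamped :: "real \<Rightarrow> real \<Rightarrow> (real \<Rightarrow> real) \<Rightarrow> bool" where
  "clamped a b h \<longleftrightarrow> L2 a b h \<and> (LINT x|leb a b. h x) = 0 \<and> (LINT x|leb a b. prim a b h x) = 0"

lemma prim_deriv_test_fun:
  assumes "test_fun a b \<phi>" "x \<in> {a<..<b}" shows "prim a b (deriv \<phi>) x = \<phi> x"
proof -
  have "prim a b (deriv \<phi>) x = \<phi> x - \<phi> a"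
  proof (rule prim_eq_diff)
    show "(\<phi> has_real_derivative deriv \<phi> x) (at x within {a..b})" for x
      using test_fun_has_deriv[OF assms(1)] has_field_derivative_at_within by blast
    show "continuous_on {a..b} (deriv \<phi>)" by (rule test_fun_continuous[OF test_fun_deriv[OF assms(1)]])
  qed (use assms in auto)
  then show ?thesis using test_fun_outside[OF assms(1), of a] by simp
qed

lemma prim_prim_test_fun:
  assumes "test_fun a b \<phi>" "x \<in> {a<..<b}" shows "prim a b (prim a b (deriv (deriv \<phi>))) x = \<phi> x"
proof -
  have "AE x in leb a b. prim a b (deriv (deriv \<phi>)) x = deriv \<phi> x"
    using AE_leb_mem by eventually_elim (rule prim_deriv_test_fun[OF test_fun_deriv[OF assms(1)]])
  then show ?thesis using prim_AE_cong prim_deriv_test_fun[OF assms] by metis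
qed

text \<open>Removes the chosen weak derivatives from \<open>H2_norm\<close> and leaves three plain
  L2 distances.\<close>

lemma H2_norm_test_diff:
  assumes \<phi>: "test_fun a b \<phi>" and ab: "a \<le> b" and h: "L2 a b h"
    and z: "AE x in leb a b. z x = C + prim a b (\<lambda>t. D + prim a b h t) x"
  shows "(H2_norm a b (\<lambda>x. \<phi> x - z x))\<^sup>2 = (L2_norm a b (\<lambda>x. \<phi> x - z x))\<^sup>2
     + (L2_norm a b (\<lambda>x. deriv \<phi> x - (D + prim a b h x)))\<^sup>2 + (L2_norm a b (\<lambda>x. deriv (deriv \<phi>) x - h x))\<^sup>2"
proof -
  note \<phi>' = test_fun_deriv[OF \<phi>] and \<phi>'' = test_fun_deriv[OF test_fun_deriv[OF \<phi>]]
  note hi = L2_integrable[OF h]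
  let ?h = "\<lambda>x. deriv (deriv \<phi>) x - h x"
  have ih: "integrable (leb a b) ?h" using hi integrable_test_fun[OF \<phi>''] by simp
  have D: "AE x in leb a b. deriv \<phi> x - (D + prim a b h x) = - D + prim a b ?h x"
    using AE_leb_mem by eventually_elim
      (simp add: prim_diff[OF integrable_test_fun[OF \<phi>''] hi] prim_deriv_test_fun[OF \<phi>'])
  have ig: "integrable (leb a b) (\<lambda>x. deriv \<phi> x - (D + prim a b h x))"
    using integrable_test_fun[OF \<phi>'] integrable_const_prim[OF hi] by simp
  have Z: "AE x in leb a b. \<phi> x - z x = - C + prim a b (\<lambda>x. deriv \<phi> x - (D + prim a b h x)) x"
    using AE_leb_mem z by eventually_elim
      (simp add: prim_diff[OF integrable_test_fun[OF \<phi>'] integrable_const_prim[OF hi]] prim_deriv_test_fun[OF \<phi>])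
  have 1: "AE x in leb a b. weak_deriv a b (\<lambda>x. \<phi> x - z x) x = deriv \<phi> x - (D + prim a b h x)"
    by (rule weak_deriv_prim[OF ig ab Z])
  have 2: "AE x in leb a b. weak_deriv2 a b (\<lambda>x. \<phi> x - z x) x = ?h x"
    by (rule weak_deriv2_prim[OF ih ab]) (rule Z[unfolded prim_AE_cong[OF D]])
  show ?thesis unfolding H2_norm_def L2_norm_AE_cong[OF 1] L2_norm_AE_cong[OF 2] by simp
qed

lemma prim_one: "a \<le> b \<Longrightarrow> t \<in> {a..b} \<Longrightarrow> (LINT x|leb a b. of_bool (t < x) * 1) = b - t"
  by (rule integral_leb_FTC_step(1)[of _ _ _ "\<lambda>x. x"]) auto

text \<open>Cauchy's formula for repeated integration: the second primitive at \<open>b\<close> is a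
  moment with weight b - t.\<close>

lemma integral_prim:
  assumes g: "integrable (leb a b) g" and ab: "a \<le> b"
  shows "(LINT x|leb a b. prim a b g x) = (LINT t|leb a b. g t * (b - t))"
proof -
  have "(LINT x|leb a b. prim a b g x * 1) = (LINT t|leb a b. g t * (LINT x|leb a b. of_bool (t < x) * 1))"
    by (rule integral_prim_mult[OF g, of _ 1]) auto
  also have "\<dots> = (LINT t|leb a b. g t * (b - t))"
    by (rule Bochner_Integration.integral_cong[OF refl], subst prim_one) (use ab in auto)
  finally show ?thesis by simp
qed

text \<open>Boundary values pass to the limit without a trace theorem: both quantities are expressed
  by integrals continuous in L2. The weight b - t recovers the integral of each test function from
  its derivative, and the corresponding formula for \<open>u\<close> has the extra term C (b -
  a).\<close>

lemma L2_lim_test_fun_boundary: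
  assumes \<phi>: "\<And>n. test_fun a b (\<phi> n)" and ab: "a < b" and lim: "L2_lim a b \<phi> u" and lim': "L2_lim a b (\<lambda>n. deriv (\<phi> n)) g"
    and u: "AE x in leb a b. u x = C + prim a b g x"
  shows "C = 0" "(LINT x|leb a b. g x) = 0"
proof -
  have g: "integrable (leb a b) g" using lim' by (auto simp: L2_lim_def intro: L2_integrable)
  have L2i: "L2 a b (\<lambda>t. b - t)" by (rule L2_bounded[of _ _ _ "b - a"]) (auto intro!: leb_measurable_borel)
  have eq: "(LINT x|leb a b. \<phi> n x) = (LINT t|leb a b. deriv (\<phi> n) t * (b - t))" for n
  proof -
    have "(LINT x|leb a b. \<phi> n x) = (LINT x|leb a b. prim a b (deriv (\<phi> n)) x)"
      by (rule Bochner_Integration.integral_cong[OF refl]) (simp add: prim_deriv_test_fun[OF \<phi>])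
    then show ?thesis using integral_prim[OF integrable_test_fun[OF test_fun_deriv[OF \<phi>]]] ab by simp
  qed
  have "(LINT x|leb a b. u x) = (LINT t|leb a b. g t * (b - t))"
    using LIMSEQ_unique[OF L2_lim_integral[OF lim]] L2_lim_integral_mult[OF lim' L2_lim_const[OF L2i]] by (simp add: eq)
  moreover have "(LINT x|leb a b. u x) = C * (b - a) + (LINT t|leb a b. g t * (b - t))"
  proof -
    have "(LINT x|leb a b. u x) = (LINT x|leb a b. C + prim a b g x)" by (rule integral_leb_AE_cong[OF u])
    also have "\<dots> = (LINT x|leb a b. C) + (LINT x|leb a b. prim a b g x)"
      by (rule Bochner_Integration.integral_add[OF L2_integrable[OF L2_const] integrable_prim[OF g]])
    finally show ?thesis using integral_prim[OF g] integral_leb_const[of a b C] ab by simp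
  qed
  ultimately show "C = 0" using ab by simp
  have "(\<lambda>n. LINT x|leb a b. deriv (\<phi> n) x) \<longlonglongrightarrow> (LINT x|leb a b. g x)" by (rule L2_lim_integral[OF lim'])
  then show "(LINT x|leb a b. g x) = 0"
    using integral_deriv_test_fun[OF \<phi>] ab by (simp add: LIMSEQ_const_iff)
qed

lemma H20_imp_clamped:
  assumes "H20 a b z" and ab: "a < b"
  obtains h where "clamped a b h" "AE x in leb a b. z x = prim a b (prim a b h) x"
proof -
  obtain \<phi> where \<phi>: "\<And>n. test_fun a b (\<phi> n)" and lim: "(\<lambda>n. H2_norm a b (\<lambda>x. \<phi> n x - z x)) \<longlonglongrightarrow> 0" and H2: "H2 a b z"
    using assms(1) unfolding H20_def by blast
  obtain C D h where h: "L2 a b h" and z: "AE x in leb a b. z x = C + prim a b (\<lambda>t. D + prim a b h t) x"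
    using H2_imp_prim[OF H2 ab] by blast
  note \<phi>' = test_fun_deriv[OF \<phi>] and \<phi>'' = test_fun_deriv[OF test_fun_deriv[OF \<phi>]]
  note hi = L2_integrable[OF h]
  note N = H2_norm_test_diff[OF \<phi> less_imp_le[OF ab] h z]
  have H2nn: "H2_norm a b f \<ge> 0" for f by (simp add: H2_norm_def)
  have le: "L2_norm a b (\<lambda>x. \<phi> n x - z x) \<le> H2_norm a b (\<lambda>x. \<phi> n x - z x)"
    "L2_norm a b (\<lambda>x. deriv (\<phi> n) x - (D + prim a b h x)) \<le> H2_norm a b (\<lambda>x. \<phi> n x - z x)"
    "L2_norm a b (\<lambda>x. deriv (deriv (\<phi> n)) x - h x) \<le> H2_norm a b (\<lambda>x. \<phi> n x - z x)" for n
    by (rule power2_le_imp_le[OF _ H2nn]; unfold N; simp)+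
  have zL2: "L2 a b z" using H2 by (simp add: H2_def)
  have l: "L2_lim a b \<phi> z" "L2_lim a b (\<lambda>n. deriv (\<phi> n)) (\<lambda>x. D + prim a b h x)" "L2_lim a b (\<lambda>n. deriv (deriv (\<phi> n))) h"
    unfolding L2_lim_def
    using L2_test_fun[OF \<phi>] L2_test_fun[OF \<phi>'] L2_test_fun[OF \<phi>''] zL2 h L2_const_prim[OF hi]
      tendsto_sandwich[OF _ _ tendsto_const lim] le by auto
  \<comment> \<open>Applied to the first and second derivatives this gives zero slope at both ends;
    applied to the functions and first derivatives it gives zero value at both ends.\<close>
  have D: "D = 0" "(LINT x|leb a b. h x) = 0"
    using L2_lim_test_fun_boundary[OF \<phi>' ab l(2,3), of D] by auto
  have C: "C = 0" "(LINT x|leb a b. D + prim a b h x) = 0"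
    using L2_lim_test_fun_boundary[OF \<phi> ab l(1,2) z] by auto
  have "clamped a b h" using h D C by (simp add: clamped_def)
  moreover have "AE x in leb a b. z x = prim a b (prim a b h) x" using z C D by simp
  ultimately show ?thesis using that by blast
qed

text \<open>Approximating test functions are corrected by a bump and its derivative to satisfy the
  two moment conditions. The derivative of the bump has mean 0 and its primitive has mean
  \<open>m\<close>, so the system for the two coefficients is triangular; they tend to 0 because
  both moments are continuous in L2 and vanish for \<open>h\<close>.\<close>

lemma clamped_test_approx:
  assumes h: "clamped a b h" and ab: "a < b"
  obtains \<theta> where "\<And>n. test_fun a b (\<theta> n)" "\<And>n. clamped a b (\<theta> n)" "L2_lim a b \<theta> h"
proof -
  have hL2: "L2 a b h" and h0: "(LINT x|leb a b. h x) = 0" "(LINT x|leb a b. prim a b h x) = 0" using h by (auto simp: clamped_def)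
  obtain \<psi> where \<psi>: "\<And>n. test_fun a b (\<psi> n)" and lim: "L2_lim a b \<psi> h"
    using L2_test_fun_dense[OF hL2 ab] by blast
  define \<rho> where "\<rho> = bump 1 ((2*a+b)/3) ((a+2*b)/3)"
  have \<rho>: "test_fun a b \<rho>" unfolding \<rho>_def using ab by (intro test_fun_bump) auto
  define m where "m = (LINT x|leb a b. \<rho> x)"
  have m: "m > 0" unfolding m_def \<rho>_def using ab by (intro integral_bump_pos) auto
  define k where "k = (LINT x|leb a b. prim a b \<rho> x)"
  define A where "A n = (LINT x|leb a b. \<psi> n x) / m" for n
  define B where "B n = ((LINT x|leb a b. prim a b (\<psi> n) x) - A n * k) / m" for n
  define \<theta> where "\<theta> n x = 1 * \<psi> n x + - 1 * (A n * \<rho> x + B n * deriv \<rho> x)" for n x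
  note i = integrable_test_fun[OF \<psi>] integrable_test_fun[OF \<rho>] integrable_test_fun[OF test_fun_deriv[OF \<rho>]]
  have \<theta>: "test_fun a b (\<theta> n)" for n
    unfolding \<theta>_def by (intro test_fun_lincomb \<psi> \<rho> test_fun_deriv)
  have "clamped a b (\<theta> n)" for n
    unfolding clamped_def
  proof (intro conjI)
    show "L2 a b (\<theta> n)" by (rule L2_test_fun[OF \<theta>])
    show "(LINT x|leb a b. \<theta> n x) = 0"
      unfolding \<theta>_def using i integral_deriv_test_fun[OF \<rho>] ab m by (simp add: m_def[symmetric]) (simp add: A_def)
    have "prim a b (\<theta> n) x = prim a b (\<psi> n) x - (A n * prim a b \<rho> x + B n * prim a b (deriv \<rho>) x)" for x
      unfolding \<theta>_def using i by (subst prim_lincomb) (simp_all add: prim_lincomb)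
    then have "(LINT x|leb a b. prim a b (\<theta> n) x) = (LINT x|leb a b. prim a b (\<psi> n) x) - (A n * k + B n * (LINT x|leb a b. prim a b (deriv \<rho>) x))"
      using integrable_prim[OF i(1)] integrable_prim[OF i(2)] integrable_prim[OF i(3)] by (simp add: k_def)
    also have "(LINT x|leb a b. prim a b (deriv \<rho>) x) = m"
      unfolding m_def by (rule Bochner_Integration.integral_cong[OF refl]) (simp add: prim_deriv_test_fun[OF \<rho>])
    finally show "(LINT x|leb a b. prim a b (\<theta> n) x) = 0" using m by (simp add: B_def)
  qed
  moreover have "L2_lim a b \<theta> h"
  proof -
    have A: "A \<longlonglongrightarrow> 0" unfolding A_def using tendsto_divide[OF L2_lim_integral[OF lim] tendsto_const[of m]] m h0 by simp
    have "(\<lambda>n. LINT x|leb a b. prim a b (\<psi> n) x) \<longlonglongrightarrow> 0"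
      using L2_lim_integral[OF L2_lim_prim[OF lim less_imp_le[OF ab]]] h0 by simp
    then have "B \<longlonglongrightarrow> (0 - 0 * k) / m" unfolding B_def using m by (intro tendsto_intros A) auto
    then have B: "B \<longlonglongrightarrow> 0" by simp
    have *: "L2_lim a b (\<lambda>n x. c n * \<sigma> x) (\<lambda>x. 0)" if "c \<longlonglongrightarrow> 0" "L2 a b \<sigma>" for c \<sigma>
    proof -
      have "(\<lambda>n. \<bar>c n\<bar> * L2_norm a b \<sigma>) \<longlonglongrightarrow> \<bar>0\<bar> * L2_norm a b \<sigma>" by (intro tendsto_intros that)
      moreover have "L2 a b (\<lambda>x. c n * \<sigma> x)" for n using L2_lincomb[OF that(2) that(2), of "c n" 0] by simp
      ultimately show ?thesis by (simp add: L2_lim_def L2_norm_cmult L2_const)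
    qed
    have "L2_lim a b (\<lambda>n x. 1 * \<psi> n x + -1 * (A n * \<rho> x + B n * deriv \<rho> x)) (\<lambda>x. 1 * h x + -1 * (0 + 0))"
      by (intro L2_lim_lincomb L2_lim_add lim * A B L2_test_fun[OF \<rho>] L2_test_fun[OF test_fun_deriv[OF \<rho>]])
    then show ?thesis by (simp add: \<theta>_def[abs_def])
  qed
  ultimately show ?thesis using that \<theta> by blast
qed

text \<open>Each moment condition permits one integration of the approximating test functions within
  compact support; the double primitives then converge in all three L2 distances because
  \<open>prim\<close> is bounded on L2.\<close>

lemma clamped_imp_H20:
  assumes h: "clamped a b h" and ab: "a < b" and z: "AE x in leb a b. z x = prim a b (prim a b h) x"
  shows "H20 a b z"
proof -
  have hL2: "L2 a b h" using h by (simp add: clamped_def)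
  note hi = L2_integrable[OF hL2]
  obtain \<theta> where \<theta>: "\<And>n. test_fun a b (\<theta> n)" "\<And>n. clamped a b (\<theta> n)" "L2_lim a b \<theta> h"
    using clamped_test_approx[OF h ab] by blast
  have "\<exists>\<Phi>. test_fun a b \<Phi> \<and> deriv (deriv \<Phi>) = \<theta> n" for n
  proof -
    obtain \<Psi> where \<Psi>: "test_fun a b \<Psi>" "deriv \<Psi> = \<theta> n"
      using test_fun_primitive_exists[OF \<theta>(1) ab, of n] \<theta>(2)[of n] by (auto simp: clamped_def)
    have "(LINT x|leb a b. \<Psi> x) = (LINT x|leb a b. prim a b (\<theta> n) x)"
      by (rule Bochner_Integration.integral_cong[OF refl]) (simp add: prim_deriv_test_fun[OF \<Psi>(1)] flip: \<Psi>(2))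
    then have "(LINT x|leb a b. \<Psi> x) = 0" using \<theta>(2)[of n] by (simp add: clamped_def)
    then obtain \<Phi> where "test_fun a b \<Phi>" "deriv \<Phi> = \<Psi>"
      using test_fun_primitive_exists[OF \<Psi>(1) ab] by blast
    then show ?thesis using \<Psi> by auto
  qed
  then obtain \<Phi> where \<Phi>: "\<And>n. test_fun a b (\<Phi> n)" "\<And>n. deriv (deriv (\<Phi> n)) = \<theta> n" by metis
  have z': "AE x in leb a b. z x = 0 + prim a b (\<lambda>t. 0 + prim a b h t) x" using z by simp
  note N = H2_norm_test_diff[OF \<Phi>(1) less_imp_le[OF ab] hL2 z']
  have e1: "L2_norm a b (\<lambda>x. deriv (\<Phi> n) x - (0 + prim a b h x)) = L2_norm a b (\<lambda>x. prim a b (\<theta> n) x - prim a b h x)" for n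
    by (rule L2_norm_AE_cong) (use AE_leb_mem in eventually_elim, simp add: prim_deriv_test_fun[OF test_fun_deriv[OF \<Phi>(1)]] flip: \<Phi>(2))
  have e0: "L2_norm a b (\<lambda>x. \<Phi> n x - z x) = L2_norm a b (\<lambda>x. prim a b (prim a b (\<theta> n)) x - prim a b (prim a b h) x)" for n
    by (rule L2_norm_AE_cong) (use AE_leb_mem z in eventually_elim, simp add: prim_prim_test_fun[OF \<Phi>(1)] flip: \<Phi>(2))
  note l1 = L2_lim_prim[OF \<theta>(3) less_imp_le[OF ab]]
  note l0 = L2_lim_prim[OF l1 less_imp_le[OF ab]]
  have "(\<lambda>n. (H2_norm a b (\<lambda>x. \<Phi> n x - z x))\<^sup>2) \<longlonglongrightarrow> 0\<^sup>2 + 0\<^sup>2 + 0\<^sup>2"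
    unfolding N e0 e1 \<Phi>(2) using l0 l1 \<theta>(3) by (intro tendsto_intros) (auto simp: L2_lim_def)
  then have "(\<lambda>n. sqrt ((H2_norm a b (\<lambda>x. \<Phi> n x - z x))\<^sup>2)) \<longlonglongrightarrow> sqrt 0" by (intro tendsto_intros) simp
  moreover have "H2_norm a b f \<ge> 0" for f by (simp add: H2_norm_def)
  ultimately have "(\<lambda>n. H2_norm a b (\<lambda>x. \<Phi> n x - z x)) \<longlonglongrightarrow> 0" by simp
  moreover have "H2 a b z" by (rule H2_primI[OF hL2 less_imp_le[OF ab] z'])
  ultimately show ?thesis using \<Phi>(1) unfolding H20_def by blast
qed

section \<open>Clamped second derivatives and the Poincare constant\<close>

definition biprim :: "real \<Rightarrow> real \<Rightarrow> (real \<Rightarrow> real) \<Rightarrow> real \<Rightarrow> real" where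
  "biprim a b h = prim a b (prim a b h)"

lemma biprim_lincomb:
  assumes "L2 a b f" "L2 a b g"
  shows "biprim a b (\<lambda>x. s * f x + t * g x) x = s * biprim a b f x + t * biprim a b g x"
proof -
  note i = L2_integrable[OF assms(1)] L2_integrable[OF assms(2)]
  have "prim a b (\<lambda>x. s * f x + t * g x) = (\<lambda>x. s * prim a b f x + t * prim a b g x)"
    by (simp add: prim_lincomb[OF i] fun_eq_iff)
  then show ?thesis unfolding biprim_def by (simp add: prim_lincomb[OF integrable_prim[OF i(1)] integrable_prim[OF i(2)]])
qed

lemma L2_biprim: "L2 a b h \<Longrightarrow> L2 c d (biprim a b h)"
  unfolding biprim_def by (intro L2_prim integrable_prim L2_integrable)

lemma biprim_AE_cong: "AE x in leb a b. f x = g x \<Longrightarrow> biprim a b f = biprim a b g"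
  unfolding biprim_def by (simp add: prim_AE_cong)

lemma L2_lim_biprim: "L2_lim a b f g \<Longrightarrow> a \<le> b \<Longrightarrow> L2_lim a b (\<lambda>n. biprim a b (f n)) (biprim a b g)"
  unfolding biprim_def by (intro L2_lim_prim)

lemma L2_norm_biprim_le: "L2 a b h \<Longrightarrow> a \<le> b \<Longrightarrow> L2_norm a b (biprim a b h) \<le> (b - a)\<^sup>2 * L2_norm a b h"
proof -
  assume h: "L2 a b h" and ab: "a \<le> b"
  have "L2_norm a b (biprim a b h) \<le> (b - a) * L2_norm a b (prim a b h)"
    unfolding biprim_def by (intro L2_norm_prim_le L2_prim L2_integrable h ab)
  also have "\<dots> \<le> (b - a) * ((b - a) * L2_norm a b h)"
    using ab by (intro mult_left_mono L2_norm_prim_le h) auto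
  finally show ?thesis by (simp add: power2_eq_square mult.assoc)
qed

lemma AE_leb_witness:
  assumes "AE x in leb a b. P x" "a < b" obtains x where "x \<in> {a<..<b}" "P x"
proof -
  have "\<exists>x\<in>{a<..<b}. P x"
  proof (rule ccontr)
    assume neg: "\<not> ?thesis"
    have "AE y in lebesgue. y \<notin> {a<..<b}" using assms(1) unfolding AE_leb_iff by eventually_elim (use neg in auto)
    then have "{a<..<b} \<in> null_sets lebesgue" by (simp add: AE_iff_null_sets)
    then show False using assms(2) by (simp add: null_sets_def)
  qed
  then show ?thesis using that by blast
qed

lemma clamped_biprim_outside:
  assumes "clamped c d h" "x \<le> c \<or> d \<le> x" shows "prim c d h x = 0" "biprim c d h x = 0"
  using assms unfolding clamped_def biprim_def by (auto simp: prim_left prim_right)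

lemma prim_eq_indicator:
  assumes "(LINT x|leb c d. h x) = 0"
  shows "prim c d h = (\<lambda>x. indicator {c<..<d} x * prim c d h x)"
proof
  show "prim c d h x = indicator {c<..<d} x * prim c d h x" for x
    using prim_left[of x c d h] prim_right[of d x c h] assms
    by (cases "x \<le> c \<or> d \<le> x") (auto simp: indicator_def)
qed

text \<open>The moment conditions make both primitives vanish beyond \<open>d\<close>, which is why
  extension by zero commutes with them.\<close>

lemma clamped_extend:
  assumes h: "clamped c d h" and "a \<le> c" "c \<le> d" "d \<le> b"
  shows "clamped a b (\<lambda>x. indicator {c<..<d} x * h x)"
    and "biprim a b (\<lambda>x. indicator {c<..<d} x * h x) = biprim c d h"
    and "prim a b (\<lambda>x. indicator {c<..<d} x * h x) = prim c d h"
proof -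
  have db: "a \<le> c" "d \<le> b" using assms by auto
  show p: "prim a b (\<lambda>x. indicator {c<..<d} x * h x) = prim c d h"
    by (simp add: prim_subinterval[OF db] fun_eq_iff)
  have "prim c d h = (\<lambda>x. indicator {c<..<d} x * prim c d h x)"
    using h by (intro prim_eq_indicator) (simp add: clamped_def)
  then have "prim a b (prim c d h) = prim a b (\<lambda>x. indicator {c<..<d} x * prim c d h x)" by simp
  also have "\<dots> = prim c d (prim c d h)" by (simp add: prim_subinterval[OF db] fun_eq_iff)
  finally show b: "biprim a b (\<lambda>x. indicator {c<..<d} x * h x) = biprim c d h"
    by (simp add: biprim_def p)
  show "clamped a b (\<lambda>x. indicator {c<..<d} x * h x)"
    unfolding clamped_def
  proof (intro conjI)
    show "L2 a b (\<lambda>x. indicator {c<..<d} x * h x)" using h db by (intro L2_indicator) (auto simp: clamped_def)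
    show "(LINT x|leb a b. indicator {c<..<d} x * h x) = 0" using h leb_subinterval(1)[OF db] by (simp add: clamped_def)
    have "(LINT x|leb a b. prim a b (\<lambda>x. indicator {c<..<d} x * h x) x) = biprim a b (\<lambda>x. indicator {c<..<d} x * h x) b"
      unfolding biprim_def by (simp add: prim_right)
    then show "(LINT x|leb a b. prim a b (\<lambda>x. indicator {c<..<d} x * h x) x) = 0"
      using clamped_biprim_outside(2)[OF h, of b] db b by simp
  qed
qed

text \<open>By uniqueness of weak derivatives, both derivatives of \<open>z\<close> vanish wherever
  \<open>z\<close> does. The constants and moments are then read off at single points outside [c,d],
  where the primitives are constant.\<close>

lemma clamped_restrict:
  assumes z: "AE x in leb a b. z x = C + prim a b (\<lambda>t. D + prim a b h t) x" and h: "L2 a b h"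
    and acdb: "a < c" "c < d" "d < b" and out: "AE x in leb a c. z x = 0" "AE x in leb d b. z x = 0"
  shows "clamped c d h" "AE x in leb a b. z x = biprim c d h x"
proof -
  have ab: "a \<le> b" using acdb by linarith
  note hi = L2_integrable[OF h]
  let ?g = "\<lambda>t. D + prim a b h t"
  have zg: "has_weak_deriv a b z ?g" by (rule has_weak_deriv_prim[OF integrable_const_prim[OF hi] ab z])
  have gh: "has_weak_deriv a b ?g h" by (rule has_weak_deriv_prim[OF hi ab, where C=D]) simp
  have vanish: "AE x in leb s t. ?g x = 0" "AE x in leb s t. h x = 0"
    if "a \<le> s" "s \<le> t" "t \<le> b" "AE x in leb s t. z x = 0" for s t
  proof -
    have i0: "integrable (leb s t) (\<lambda>_. 0)" by simp
    have z0: "has_weak_deriv s t u (\<lambda>_. 0)" if "AE x in leb s t. u x = 0" for u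
      by (rule has_weak_deriv_prim[OF i0 \<open>s \<le> t\<close>, of u 0]) (use that in \<open>simp add: prim_def\<close>)
    show g0: "AE x in leb s t. ?g x = 0"
      by (rule has_weak_deriv_unique[OF has_weak_deriv_subinterval[OF zg] z0]) (use that in auto)
    show "AE x in leb s t. h x = 0"
      by (rule has_weak_deriv_unique[OF has_weak_deriv_subinterval[OF gh] z0[OF g0]]) (use that in auto)
  qed
  have l: "AE x in leb a c. ?g x = 0" "AE x in leb a c. h x = 0"
    by (rule vanish; use acdb out in simp)+
  have r: "AE x in leb d b. ?g x = 0" "AE x in leb d b. h x = 0"
    by (rule vanish; use acdb out in simp)+
  have hh: "AE x in leb a b. h x = indicator {c<..<d} x * h x"
  proof -
    have "AE x in leb a c. h x = indicator {c<..<d} x * h x" using l(2) by eventually_elim simp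
    moreover have "AE x in leb c d. h x = indicator {c<..<d} x * h x" using AE_leb_mem by eventually_elim simp
    moreover have "AE x in leb d b. h x = indicator {c<..<d} x * h x" using r(2) by eventually_elim simp
    ultimately show ?thesis using AE_leb_join by blast
  qed
  have "prim a b h = prim a b (\<lambda>x. indicator {c<..<d} x * h x)" by (rule prim_AE_cong[OF hh])
  also have "\<dots> = prim c d h" using acdb by (simp add: prim_subinterval fun_eq_iff)
  finally have ph: "prim a b h = prim c d h" .
  \<comment> \<open>A point left of \<open>c\<close> determines the integration constant, a point
    right of \<open>d\<close> the moment; the same pattern recurs one level up for \<open>C\<close>
    and the second moment.\<close>
  obtain x where "x \<in> {a<..<c}" "?g x = 0" using AE_leb_witness[OF l(1) acdb(1)] .
  then have D: "D = 0" by (simp add: ph prim_left)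
  obtain x where "x \<in> {d<..<b}" "?g x = 0" using AE_leb_witness[OF r(1) acdb(3)] .
  then have h0: "(LINT x|leb c d. h x) = 0" by (simp add: ph prim_right D)
  have "prim c d h = (\<lambda>x. indicator {c<..<d} x * prim c d h x)"
    by (rule prim_eq_indicator[OF h0])
  then have "prim a b (prim c d h) = prim a b (\<lambda>x. indicator {c<..<d} x * prim c d h x)" by simp
  also have "\<dots> = biprim c d h" using acdb by (simp add: prim_subinterval fun_eq_iff biprim_def)
  finally have z': "AE x in leb a b. z x = C + biprim c d h x" using z by (simp add: D ph)
  have "AE x in leb a c. C + biprim c d h x = 0"
  proof -
    have "AE x in leb a c. z x = C + biprim c d h x" by (rule AE_leb_subinterval[OF z']) (use acdb in auto)
    then show ?thesis using out(1) by eventually_elim simp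
  qed
  then obtain x where "x \<in> {a<..<c}" "C + biprim c d h x = 0" using AE_leb_witness acdb(1) by blast
  then have C: "C = 0" by (simp add: biprim_def prim_left)
  have "AE x in leb d b. C + biprim c d h x = 0"
  proof -
    have "AE x in leb d b. z x = C + biprim c d h x" by (rule AE_leb_subinterval[OF z']) (use acdb in auto)
    then show ?thesis using out(2) by eventually_elim simp
  qed
  then obtain x where "x \<in> {d<..<b}" "C + biprim c d h x = 0" using AE_leb_witness acdb(3) by blast
  then have "(LINT x|leb c d. prim c d h x) = 0" by (simp add: C biprim_def prim_right)
  then show "clamped c d h" using h0 L2_subinterval[OF h] acdb by (simp add: clamped_def)
  show "AE x in leb a b. z x = biprim c d h x" using z' C by simp
qed

lemma clamped_lincomb:
  assumes "clamped a b h" "clamped a b k" shows "clamped a b (\<lambda>x. s * h x + t * k x)"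
proof -
  have L2: "L2 a b h" "L2 a b k" using assms by (auto simp: clamped_def)
  note i = L2_integrable[OF L2(1)] L2_integrable[OF L2(2)]
  have "prim a b (\<lambda>x. s * h x + t * k x) = (\<lambda>x. s * prim a b h x + t * prim a b k x)"
    by (simp add: prim_lincomb[OF i] fun_eq_iff)
  then show ?thesis
    using assms i integrable_prim[OF i(1)] integrable_prim[OF i(2)] L2_lincomb[OF L2]
    by (simp add: clamped_def)
qed

text \<open>The subspace is closed because both moments are continuous in L2.\<close>

lemma clamped_lim:
  assumes lim: "L2_lim a b h k" and h: "\<And>n. clamped a b (h n)" and ab: "a \<le> b" shows "clamped a b k"
proof -
  have "L2 a b k" using lim by (simp add: L2_lim_def)
  moreover have "(LINT x|leb a b. k x) = 0"
    using L2_lim_integral[OF lim] h by (simp add: clamped_def LIMSEQ_const_iff)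
  moreover have "(LINT x|leb a b. prim a b k x) = 0"
    using L2_lim_integral[OF L2_lim_prim[OF lim ab]] h by (simp add: clamped_def LIMSEQ_const_iff)
  ultimately show ?thesis by (simp add: clamped_def)
qed

lemma clamped_weak_deriv2:
  assumes "clamped a b h" "a \<le> b" "AE x in leb a b. z x = biprim a b h x"
  shows "AE x in leb a b. weak_deriv2 a b z x = h x"
  using assms by (intro weak_deriv2_prim[of a b h z 0 0]) (auto simp: clamped_def biprim_def L2_integrable)

section \<open>The constant \<open>C_P\<close> and the weighted Young inequality\<close>

lemma clamped_exists_norm_pos:
  assumes "a < b" obtains h where "clamped a b h" "L2_norm a b (biprim a b h) > 0"
proof -
  define \<phi> where "\<phi> = bump 1 ((2*a+b)/3) ((a+2*b)/3)"
  have \<phi>: "test_fun a b \<phi>" unfolding \<phi>_def using assms by (intro test_fun_bump) auto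
  note \<phi>' = test_fun_deriv[OF \<phi>] and \<phi>'' = test_fun_deriv[OF test_fun_deriv[OF \<phi>]]
  have pos: "(LINT x|leb a b. \<phi> x) > 0" unfolding \<phi>_def using assms by (intro integral_bump_pos) auto
  have eq: "L2_norm a b (biprim a b (deriv (deriv \<phi>))) = L2_norm a b \<phi>"
    by (rule L2_norm_AE_cong) (use AE_leb_mem in eventually_elim, simp add: biprim_def prim_prim_test_fun[OF \<phi>])
  have "(LINT x|leb a b. \<phi> x * 1) \<le> L2_norm a b \<phi> * L2_norm a b (\<lambda>_. 1)"
    using L2_Cauchy_Schwarz[OF L2_test_fun[OF \<phi>] L2_const[of a b 1]] by linarith
  then have "L2_norm a b \<phi> \<noteq> 0" using pos by auto
  then have "L2_norm a b \<phi> > 0" by (simp add: less_le)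
  moreover have "clamped a b (deriv (deriv \<phi>))"
  proof -
    have "(LINT x|leb a b. prim a b (deriv (deriv \<phi>)) x) = (LINT x|leb a b. deriv \<phi> x)"
      by (rule Bochner_Integration.integral_cong[OF refl]) (simp add: prim_deriv_test_fun[OF \<phi>'])
    then show ?thesis using integral_deriv_test_fun[OF \<phi>] integral_deriv_test_fun[OF \<phi>'] L2_test_fun[OF \<phi>''] assms
      by (simp add: clamped_def)
  qed
  ultimately show ?thesis using that eq by simp
qed

text \<open>The infimum is itself an admissible constant: for \<open>k\<close> of nonzero norm, the
  quotient of the two squared norms is a lower bound of the admissible set.\<close>

lemma C_P_bound:
  assumes k: "clamped (-1) 1 k"
  shows "(L2_norm (-1) 1 (biprim (-1) 1 k))\<^sup>2 \<le> C_P * (L2_norm (-1) 1 k)\<^sup>2" and "0 \<le> C_P"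
proof -
  define S where "S = {C. \<forall>v. H20 (-1) 1 v \<longrightarrow> (L2_norm (-1) 1 v)\<^sup>2 \<le> C * (L2_norm (-1) 1 (weak_deriv2 (-1) 1 v))\<^sup>2}"
  have SI: "(L2_norm (-1) 1 (biprim (-1) 1 h))\<^sup>2 \<le> C * (L2_norm (-1) 1 h)\<^sup>2" if "C \<in> S" "clamped (-1) 1 h" for C h
  proof -
    have "H20 (-1) 1 (biprim (-1) 1 h)" by (rule clamped_imp_H20[OF that(2)]) (simp_all add: biprim_def)
    moreover have "L2_norm (-1) 1 (weak_deriv2 (-1) 1 (biprim (-1) 1 h)) = L2_norm (-1) 1 h"
      by (rule L2_norm_AE_cong, rule clamped_weak_deriv2[OF that(2)]) auto
    ultimately show ?thesis using that(1) unfolding S_def by force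
  qed
  \<comment> \<open>Two primitives on an interval of length 2 cost a factor 2 each in norm, hence 4,
    and 16 after squaring. Nonemptiness keeps the infimum meaningful.\<close>
  have "16 \<in> S" unfolding S_def
  proof (intro CollectI allI impI)
    fix v assume "H20 (-1) 1 v"
    then obtain h where h: "clamped (-1) 1 h" "AE x in leb (-1) 1. v x = biprim (-1) 1 h x"
      using H20_imp_clamped[of "-1" 1 v] by (auto simp: biprim_def)
    have "L2_norm (-1) 1 (biprim (-1) 1 h) \<le> 4 * L2_norm (-1) 1 h"
      using L2_norm_biprim_le[of "-1" 1 h] h(1) by (simp add: clamped_def)
    from power_mono[OF this L2_norm_nonneg, of 2]
    show "(L2_norm (-1) 1 v)\<^sup>2 \<le> 16 * (L2_norm (-1) 1 (weak_deriv2 (-1) 1 v))\<^sup>2"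
      using L2_norm_AE_cong[OF h(2)] L2_norm_AE_cong[OF clamped_weak_deriv2[OF h(1) _ h(2)]]
      by (simp add: power_mult_distrib)
  qed
  then have ne: "S \<noteq> {}" by blast
  have C_P: "C_P = Inf S" by (simp add: C_P_def S_def)
  \<comment> \<open>A single nontrivial function rules out negative constants.\<close>
  obtain h\<^sub>0 where h\<^sub>0: "clamped (-1) 1 h\<^sub>0" "L2_norm (-1) 1 (biprim (-1) 1 h\<^sub>0) > 0"
    using clamped_exists_norm_pos[of "-1" 1] by auto
  show "0 \<le> C_P" unfolding C_P
  proof (rule cInf_greatest[OF ne])
    fix C assume "C \<in> S"
    have "0 < (L2_norm (-1) 1 (biprim (-1) 1 h\<^sub>0))\<^sup>2" using h\<^sub>0(2) by simp
    also have "\<dots> \<le> C * (L2_norm (-1) 1 h\<^sub>0)\<^sup>2" by (rule SI[OF \<open>C \<in> S\<close> h\<^sub>0(1)])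
    finally show "0 \<le> C" by (auto simp: zero_less_mult_iff)
  qed
  show "(L2_norm (-1) 1 (biprim (-1) 1 k))\<^sup>2 \<le> C_P * (L2_norm (-1) 1 k)\<^sup>2"
  proof (cases "L2_norm (-1) 1 k = 0")
    case True
    then show ?thesis using SI[OF \<open>16 \<in> S\<close> k] by simp
  next
    case False
    then have pos: "(L2_norm (-1) 1 k)\<^sup>2 > 0" by simp
    have "(L2_norm (-1) 1 (biprim (-1) 1 k))\<^sup>2 / (L2_norm (-1) 1 k)\<^sup>2 \<le> C_P"
      unfolding C_P by (rule cInf_greatest[OF ne]) (use SI[OF _ k] pos in \<open>simp add: divide_le_eq\<close>)
    then show ?thesis using pos by (simp add: divide_le_eq)
  qed
qed

text \<open>Young's inequality from (F sqrt(c) - \<gamma> \<kappa>)^2 \<ge> 0. The weight \<gamma>/2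
  is chosen to match the part of the bending energy left over after separating the datum.\<close>

lemma mult_le_weighted_squares:
  fixes c \<gamma> F \<kappa> t :: real
  assumes "t\<^sup>2 \<le> c * \<kappa>\<^sup>2" "0 \<le> c" "0 < \<gamma>" "0 \<le> \<kappa>" "0 \<le> F"
  shows "F * t \<le> c / (2 * \<gamma>) * F\<^sup>2 + \<gamma> / 2 * \<kappa>\<^sup>2"
proof -
  have "t\<^sup>2 \<le> (sqrt c * \<kappa>)\<^sup>2" using assms by (simp add: power_mult_distrib)
  from power2_le_imp_le[OF this] have "t \<le> sqrt c * \<kappa>" using assms by simp
  then have "F * t \<le> F * (sqrt c * \<kappa>)" using assms by (intro mult_left_mono)
  moreover have "0 \<le> (F * sqrt c - \<gamma> * \<kappa>)\<^sup>2" by simp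
  then have "2 * \<gamma> * (F * (sqrt c * \<kappa>)) \<le> c * F\<^sup>2 + \<gamma>\<^sup>2 * \<kappa>\<^sup>2"
    using assms by (simp add: power2_diff power_mult_distrib algebra_simps)
  then have "F * (sqrt c * \<kappa>) \<le> (c * F\<^sup>2 + \<gamma>\<^sup>2 * \<kappa>\<^sup>2) / (2 * \<gamma>)"
    using assms by (simp add: field_simps)
  moreover have "(c * F\<^sup>2 + \<gamma>\<^sup>2 * \<kappa>\<^sup>2) / (2 * \<gamma>) = c / (2 * \<gamma>) * F\<^sup>2 + \<gamma> / 2 * \<kappa>\<^sup>2"
    using assms by (simp add: field_simps power2_eq_square)
  ultimately show ?thesis by linarith
qed

section \<open>The minimization problem\<close>

lemma L2_integral_mult_lincomb:
  assumes "L2 a b f" "L2 a b g" "L2 a b h"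
  shows "(LINT x|leb a b. f x * (s * g x + t * h x)) = s * (LINT x|leb a b. f x * g x) + t * (LINT x|leb a b. f x * h x)"
proof -
  have "(LINT x|leb a b. f x * (s * g x + t * h x)) = (LINT x|leb a b. s * (f x * g x) + t * (f x * h x))"
    by (rule Bochner_Integration.integral_cong) (auto simp: algebra_simps)
  then show ?thesis using L2_mult_integrable[OF assms(1,2)] L2_mult_integrable[OF assms(1,3)] by simp
qed

text \<open>\<open>w1\<close> and \<open>w2\<close> are derivatives within the closed interval;
  \<open>deriv\<close> at the end points would depend on values of \<open>w\<close> outside
  it.\<close>

locale plate_problem =
  fixes w w1 w2 f\<^sub>r f\<^sub>p :: "real \<Rightarrow> real" and \<alpha> \<beta> \<eta> \<mu> \<gamma> :: real
  assumes w1: "\<And>x. x \<in> {-2..2} \<Longrightarrow> (w has_real_derivative w1 x) (at x within {-2..2})"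
    and w2: "\<And>x. x \<in> {-2..2} \<Longrightarrow> (w1 has_real_derivative w2 x) (at x within {-2..2})"
    and w2_cont: "continuous_on {-2..2} w2"
    and pos: "\<eta> > 0" "\<mu> > 0" "\<gamma> > 0" and \<beta>: "0 < \<beta>" "\<beta> \<le> \<alpha>"
    and f: "L2 (-1) 1 f\<^sub>r" "L2 (-1) 1 f\<^sub>p"
begin

abbreviation T :: "(real \<Rightarrow> real) \<Rightarrow> real \<Rightarrow> real" where "T \<equiv> biprim (-1) 1"
abbreviation I :: "real measure" where "I \<equiv> leb (-1) 1"
abbreviation nrm :: "(real \<Rightarrow> real) \<Rightarrow> real" where "nrm \<equiv> L2_norm (-1) 1"
abbreviation V :: "(real \<Rightarrow> real) \<Rightarrow> bool" where "V \<equiv> clamped (-1) 1"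
abbreviation F :: "(real \<Rightarrow> real) \<Rightarrow> (real \<Rightarrow> real) \<Rightarrow> real" where "F \<equiv> F1 \<alpha> \<beta> \<eta> \<mu> \<gamma> f\<^sub>r f\<^sub>p"

text \<open>The functional on jump-free pairs, with the second derivatives of
  \<open>v\<^sub>r - w\<close> and \<open>v\<^sub>p - w\<close> as unknowns.\<close>

definition energy :: "(real \<Rightarrow> real) \<Rightarrow> (real \<Rightarrow> real) \<Rightarrow> real" where
  "energy h k = \<eta> * (LINT x|I. (w2 x + h x)\<^sup>2) - (LINT x|I. f\<^sub>r x * (w x + T h x))
     + \<mu> * (LINT x|I. (T h x - T k x)\<^sup>2)
     + (\<gamma> * (LINT x|I. (w2 x + k x)\<^sup>2) - (LINT x|I. f\<^sub>p x * (w x + T k x)))"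

text \<open>The left-hand side of the smallness assumption, with \<open>w2\<close> for the second
  derivative of \<open>w\<close>.\<close>

definition load :: real where
  "load = 1 / (4 * \<mu>) * (nrm f\<^sub>r)\<^sup>2 + C_P / (2 * \<gamma>) * (nrm (\<lambda>x. f\<^sub>r x + f\<^sub>p x))\<^sup>2
      + \<gamma> * (nrm w2)\<^sup>2 + (LINT x|I. (f\<^sub>r x + f\<^sub>p x) * w x)"

lemma continuous_w: "continuous_on {-2..2} w" "continuous_on {-2..2} w1"
  by (rule DERIV_continuous_on[OF w1] DERIV_continuous_on[OF w2]; assumption)+

lemma L2_continuous_22:
  assumes "continuous_on {-2..2} u" shows "L2 (-2) 2 u"
proof -
  have "bounded (u ` {-2..2})" by (intro compact_imp_bounded compact_continuous_image assms) simp
  then obtain B where "\<forall>x\<in>{-2..2}. \<bar>u x\<bar> \<le> B" unfolding bounded_real by blast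
  moreover have "u \<in> borel_measurable (leb (-2) 2)"
    by (rule continuous_imp_measurable_on_sets_lebesgue) (auto intro: continuous_on_subset[OF assms])
  ultimately show ?thesis by (intro L2_bounded[of _ _ _ B]) auto
qed

lemma L2_w: "L2 (-2) 2 w2" "L2 (-1) 1 w2" "L2 (-1) 1 w"
  using L2_continuous_22[OF w2_cont] L2_continuous_22[OF continuous_w(1)] L2_subinterval[of "-2" 2 _ "-1" 1] by auto

lemma clamped_L2: "V h \<Longrightarrow> L2 (-1) 1 h" "V h \<Longrightarrow> L2 (-1) 1 (T h)"
  by (auto simp: clamped_def L2_biprim)

lemma w_eq_prim: "x \<in> {-2<..<2} \<Longrightarrow> w x = w (-2) + prim (-2) 2 (\<lambda>t. w1 (-2) + prim (-2) 2 w2 t) x"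
proof -
  assume x: "x \<in> {-2<..<2}"
  have "AE t in leb (-2) 2. w1 (-2) + prim (-2) 2 w2 t = w1 t"
    using AE_leb_mem by eventually_elim (subst prim_eq_diff[of _ _ w1], use w2 w2_cont in auto)
  then have "prim (-2) 2 (\<lambda>t. w1 (-2) + prim (-2) 2 w2 t) = prim (-2) 2 w1" by (rule prim_AE_cong)
  moreover have "prim (-2) 2 w1 x = w x - w (-2)"
    by (rule prim_eq_diff) (use x w1 continuous_w in auto)
  ultimately show ?thesis by simp
qed

lemma plus_T_eq_prim:
  assumes h: "V h" and x: "x \<in> {-2<..<2}"
  shows "w x + T h x = w (-2) + prim (-2) 2 (\<lambda>t. w1 (-2) + prim (-2) 2 (\<lambda>x. w2 x + indicator {-1<..<1} x * h x) t) x"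
proof -
  let ?h = "\<lambda>x. indicator {-1<..<1} x * h x"
  note e = clamped_extend[OF h, of "-2" 2, simplified]
  have i: "integrable (leb (-2) 2) w2" "integrable (leb (-2) 2) ?h"
    using L2_integrable L2_w(1) e(1) by (auto simp: clamped_def)
  let ?g = "\<lambda>t. w1 (-2) + prim (-2) 2 w2 t" and ?p = "prim (-2) 2 ?h"
  have g: "integrable (leb (-2) 2) ?g" "integrable (leb (-2) 2) ?p"
    by (rule integrable_const_prim[OF i(1)], rule integrable_prim[OF i(2)])
  have 1: "w1 (-2) + prim (-2) 2 (\<lambda>x. w2 x + ?h x) t = 1 * ?g t + 1 * ?p t" for t
    using prim_lincomb[OF i, of 1 1 t] by (simp only: mult_1_left add.assoc)
  have "prim (-2) 2 (\<lambda>t. 1 * ?g t + 1 * ?p t) x = prim (-2) 2 ?g x + prim (-2) 2 ?p x"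
    unfolding prim_lincomb[OF g] by (simp only: mult_1_left)
  also have "prim (-2) 2 ?p x = T h x" using fun_cong[OF e(2), of x] by (simp only: biprim_def)
  finally show ?thesis unfolding 1 using w_eq_prim[OF x] by (simp only:)
qed

lemma jump_free_rep:
  assumes h: "V h" and u: "AE x in leb (-2) 2. u x = w x + T h x"
  shows "jump_rep2 (-2) 2 u (w (-2)) (w1 (-2)) (\<lambda>x. w2 x + indicator {-1<..<1} x * h x) {} (\<lambda>_. 0) (\<lambda>_. 0)"
    and "H2 (-2) 2 u"
proof -
  have L2: "L2 (-2) 2 (\<lambda>x. w2 x + indicator {-1<..<1} x * h x)"
    using clamped_extend(1)[OF h, of "-2" 2] by (intro L2_add L2_w) (auto simp: clamped_def)
  have ae: "AE x in leb (-2) 2. u x = w (-2) + prim (-2) 2 (\<lambda>t. w1 (-2) + prim (-2) 2 (\<lambda>x. w2 x + indicator {-1<..<1} x * h x) t) x"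
    using u AE_leb_mem by eventually_elim (simp only: plus_T_eq_prim[OF h])
  show "jump_rep2 (-2) 2 u (w (-2)) (w1 (-2)) (\<lambda>x. w2 x + indicator {-1<..<1} x * h x) {} (\<lambda>_. 0) (\<lambda>_. 0)"
    using L2 ae by (simp add: jump_rep2_def)
  show "H2 (-2) 2 u" by (rule H2_primI[OF L2 _ ae]) simp
qed

lemma prim_imp_clamped:
  assumes u: "AE x in leb (-2) 2. u x = C + prim (-2) 2 (\<lambda>t. D + prim (-2) 2 q t) x" and q: "L2 (-2) 2 q"
    and out: "AE x in leb (-2) (-1). u x = w x" "AE x in leb 1 2. u x = w x"
  shows "V (\<lambda>x. q x - w2 x)" "AE x in leb (-2) 2. u x = w x + T (\<lambda>x. q x - w2 x) x"
proof -
  note i = L2_integrable[OF q] L2_integrable[OF L2_w(1)]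
  have eq: "prim (-2) 2 (\<lambda>t. (D - w1 (-2)) + prim (-2) 2 (\<lambda>x. q x - w2 x) t) x
      = prim (-2) 2 (\<lambda>t. D + prim (-2) 2 q t) x - prim (-2) 2 (\<lambda>t. w1 (-2) + prim (-2) 2 w2 t) x" for x
    unfolding prim_diff[OF integrable_const_prim[OF i(1)] integrable_const_prim[OF i(2)], symmetric]
    by (simp add: prim_diff[OF i] algebra_simps)
  have z: "AE x in leb (-2) 2. u x - w x = (C - w (-2)) + prim (-2) 2 (\<lambda>t. (D - w1 (-2)) + prim (-2) 2 (\<lambda>x. q x - w2 x) t) x"
    using u AE_leb_mem
  proof eventually_elim
    case (elim x)
    show ?case unfolding eq using elim(1) w_eq_prim[OF elim(2)] by linarith
  qed
  have o: "AE x in leb (-2) (-1). u x - w x = 0" "AE x in leb 1 2. u x - w x = 0"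
  proof -
    show "AE x in leb (-2) (-1). u x - w x = 0" using out(1) by eventually_elim simp
    show "AE x in leb 1 2. u x - w x = 0" using out(2) by eventually_elim simp
  qed
  have qw: "L2 (-2) 2 (\<lambda>x. q x - w2 x)" by (intro L2_diff q L2_w)
  show "V (\<lambda>x. q x - w2 x)"
    by (rule clamped_restrict(1)[OF z qw _ _ _ o]) auto
  have "AE x in leb (-2) 2. u x - w x = T (\<lambda>x. q x - w2 x) x"
    by (rule clamped_restrict(2)[OF z qw _ _ _ o]) auto
  then show "AE x in leb (-2) 2. u x = w x + T (\<lambda>x. q x - w2 x) x" by eventually_elim simp
qed

lemma admissible_outside:
  assumes "admissible w (v\<^sub>r, v\<^sub>p)"
  shows "AE x in leb (-2) (-1). v\<^sub>r x = w x" "AE x in leb 1 2. v\<^sub>r x = w x"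
    "AE x in leb (-2) (-1). v\<^sub>p x = w x" "AE x in leb 1 2. v\<^sub>p x = w x"
proof -
  have "AE x in lebesgue_on ({-2<..<-1} \<union> {1<..<2}). v\<^sub>r x = w x \<and> v\<^sub>p x = w x"
    using assms by (simp only: admissible_def case_prod_conv)
  then have "AE x in lebesgue. x \<in> {-2<..<-1} \<union> {1<..<2} \<longrightarrow> v\<^sub>r x = w x \<and> v\<^sub>p x = w x"
    by (subst (asm) AE_restrict_space_iff) auto
  then show "AE x in leb (-2) (-1). v\<^sub>r x = w x" "AE x in leb 1 2. v\<^sub>r x = w x"
    "AE x in leb (-2) (-1). v\<^sub>p x = w x" "AE x in leb 1 2. v\<^sub>p x = w x"
    unfolding AE_leb_iff by (eventually_elim; auto)+
qed

lemma admissible_plate: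
  assumes "admissible w (v\<^sub>r, v\<^sub>p)"
  obtains k where "V k" "AE x in leb (-2) 2. v\<^sub>p x = w x + T k x"
proof -
  have "H2 (-2) 2 v\<^sub>p" using assms by (simp add: admissible_def)
  then obtain C D q where "L2 (-2) 2 q" "AE x in leb (-2) 2. v\<^sub>p x = C + prim (-2) 2 (\<lambda>t. D + prim (-2) 2 q t) x"
    by (rule H2_imp_prim) simp
  then show ?thesis using that prim_imp_clamped[OF _ _ admissible_outside(3,4)[OF assms]] by blast
qed

text \<open>Here all choice operators disappear from \<open>F1\<close>; on (-1,1) only ordinary
  integrals of the data of the normal form remain.\<close>

lemma F1_rep:
  assumes r: "jump_rep2 (-2) 2 v\<^sub>r C D q P J K" and k: "V k"
    and p: "AE x in leb (-2) 2. v\<^sub>p x = w x + T k x"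
  shows "F v\<^sub>r v\<^sub>p =
      \<alpha> * real (card {s\<in>P. J s \<noteq> 0}) + \<beta> * real (card ({s\<in>P. K s \<noteq> 0} - {s\<in>P. J s \<noteq> 0}))
      + (\<eta> * (LINT x|I. (q x)\<^sup>2) - (LINT x|I. f\<^sub>r x * v\<^sub>r x))
      + \<mu> * (LINT x|I. (v\<^sub>r x - (w x + T k x))\<^sup>2)
      + (\<gamma> * (LINT x|I. (w2 x + k x)\<^sup>2) - (LINT x|I. f\<^sub>p x * (w x + T k x)))"
    and "L2 (-1) 1 v\<^sub>r" "L2 (-1) 1 q"
proof -
  note ac = jump_rep2_ac_derivs[OF r, simplified]
  have qi: "L2 (-2) 2 q" using r by (simp add: jump_rep2_def)
  show q: "L2 (-1) 1 q" by (rule L2_subinterval[OF qi]) auto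
  have "AE x in leb (-2) 2. v\<^sub>r x = jump_fun (-2) 2 C (jump_fun (-2) 2 D q P K) P J x"
    using r by (simp add: jump_rep2_def)
  then have "AE x in leb (-2) 2. jump_fun (-2) 2 C (jump_fun (-2) 2 D q P K) P J x = v\<^sub>r x"
    by eventually_elim simp
  then have "L2 (-2) 2 v\<^sub>r" by (rule L2_AE_cong[OF L2_jump_fun[OF integrable_jump_fun[OF L2_integrable[OF qi]]]])
  then show v: "L2 (-1) 1 v\<^sub>r" by (rule L2_subinterval) auto
  have q_ae: "AE x in I. ac_deriv (-2) 2 (ac_deriv (-2) 2 v\<^sub>r) x = q x"
    by (rule AE_leb_subinterval[OF ac(2)]) auto
  have k_ae: "AE x in I. weak_deriv2 (-2) 2 v\<^sub>p x = w2 x + k x"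
  proof -
    have "AE x in leb (-2) 2. weak_deriv2 (-2) 2 v\<^sub>p x = w2 x + indicator {-1<..<1} x * k x"
    proof (rule weak_deriv2_prim)
      show "integrable (leb (-2) 2) (\<lambda>x. w2 x + indicator {-1<..<1} x * k x)"
        using jump_free_rep(1)[OF k p] by (intro L2_integrable) (simp add: jump_rep2_def)
      show "AE x in leb (-2) 2. v\<^sub>p x = w (-2) + prim (-2) 2 (\<lambda>t. w1 (-2) + prim (-2) 2 (\<lambda>x. w2 x + indicator {-1<..<1} x * k x) t) x"
        using p AE_leb_mem by eventually_elim (simp only: plus_T_eq_prim[OF k])
    qed simp
    then have "AE x in I. weak_deriv2 (-2) 2 v\<^sub>p x = w2 x + indicator {-1<..<1} x * k x"
      by (rule AE_leb_subinterval) auto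
    then show ?thesis using AE_leb_mem by eventually_elim simp
  qed
  have p_ae: "AE x in I. v\<^sub>p x = w x + T k x" by (rule AE_leb_subinterval[OF p]) auto
  have wT: "L2 (-1) 1 (\<lambda>x. w x + T k x)" by (intro L2_add L2_w clamped_L2 k)
  have wk: "L2 (-1) 1 (\<lambda>x. w2 x + k x)" by (intro L2_add L2_w clamped_L2 k)
  have "(LINT x|I. \<eta> * \<bar>ac_deriv (-2) 2 (ac_deriv (-2) 2 v\<^sub>r) x\<bar>\<^sup>2 - f\<^sub>r x * v\<^sub>r x)
      = (LINT x|I. \<eta> * (q x)\<^sup>2 - f\<^sub>r x * v\<^sub>r x)"
    by (rule integral_leb_AE_cong) (use q_ae in eventually_elim, simp)
  then have 1: "(LINT x|I. \<eta> * \<bar>ac_deriv (-2) 2 (ac_deriv (-2) 2 v\<^sub>r) x\<bar>\<^sup>2 - f\<^sub>r x * v\<^sub>r x)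
      = \<eta> * (LINT x|I. (q x)\<^sup>2) - (LINT x|I. f\<^sub>r x * v\<^sub>r x)"
    using L2_integrable_power2[OF q] L2_mult_integrable[OF f(1) v] by simp
  have 2: "(LINT x|I. \<bar>v\<^sub>r x - v\<^sub>p x\<bar>\<^sup>2) = (LINT x|I. (v\<^sub>r x - (w x + T k x))\<^sup>2)"
    by (rule integral_leb_AE_cong) (use p_ae in eventually_elim, simp)
  have "(LINT x|I. \<gamma> * \<bar>weak_deriv2 (-2) 2 v\<^sub>p x\<bar>\<^sup>2 - f\<^sub>p x * v\<^sub>p x)
      = (LINT x|I. \<gamma> * (w2 x + k x)\<^sup>2 - f\<^sub>p x * (w x + T k x))"
    by (rule integral_leb_AE_cong) (use k_ae p_ae in eventually_elim, simp)
  then have 3: "(LINT x|I. \<gamma> * \<bar>weak_deriv2 (-2) 2 v\<^sub>p x\<bar>\<^sup>2 - f\<^sub>p x * v\<^sub>p x)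
      = \<gamma> * (LINT x|I. (w2 x + k x)\<^sup>2) - (LINT x|I. f\<^sub>p x * (w x + T k x))"
    using L2_integrable_power2[OF wk] L2_mult_integrable[OF f(2) wT] by simp
  show "F v\<^sub>r v\<^sub>p =
      \<alpha> * real (card {s\<in>P. J s \<noteq> 0}) + \<beta> * real (card ({s\<in>P. K s \<noteq> 0} - {s\<in>P. J s \<noteq> 0}))
      + (\<eta> * (LINT x|I. (q x)\<^sup>2) - (LINT x|I. f\<^sub>r x * v\<^sub>r x))
      + \<mu> * (LINT x|I. (v\<^sub>r x - (w x + T k x))\<^sup>2)
      + (\<gamma> * (LINT x|I. (w2 x + k x)\<^sup>2) - (LINT x|I. f\<^sub>p x * (w x + T k x)))"
    unfolding F1_def Let_def 1 2 3 ac(3,4) ..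
qed

lemma F1_jump_free:
  assumes h: "V h" and k: "V k"
    and r: "AE x in leb (-2) 2. v\<^sub>r x = w x + T h x" and p: "AE x in leb (-2) 2. v\<^sub>p x = w x + T k x"
  shows "F v\<^sub>r v\<^sub>p = energy h k"
proof -
  have r': "AE x in I. v\<^sub>r x = w x + T h x" by (rule AE_leb_subinterval[OF r]) auto
  have "(LINT x|I. (w2 x + indicator {-1<..<1} x * h x)\<^sup>2) = (LINT x|I. (w2 x + h x)\<^sup>2)"
    by (rule Bochner_Integration.integral_cong) auto
  moreover have "(LINT x|I. f\<^sub>r x * v\<^sub>r x) = (LINT x|I. f\<^sub>r x * (w x + T h x))"
    by (rule integral_leb_AE_cong) (use r' in eventually_elim, simp)
  moreover have "(LINT x|I. (v\<^sub>r x - (w x + T k x))\<^sup>2) = (LINT x|I. (T h x - T k x)\<^sup>2)"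
    by (rule integral_leb_AE_cong) (use r' in eventually_elim, simp)
  ultimately show ?thesis by (simp add: F1_rep(1)[OF jump_free_rep(1)[OF h r] k p] energy_def)
qed

text \<open>Neither continuity of \<open>v\<close> nor a relation between \<open>v\<close> and
  \<open>q\<close> enters, so the bound covers competitors with jumps. Writing v = (w + T k) + s,
  the part of the load acting on s is absorbed by the coupling term, and the rest combines with
  \<open>f\<^sub>p\<close> into a load on w + T k.\<close>

lemma energy_parts_lower_bound:
  assumes v: "L2 (-1) 1 v" and q: "L2 (-1) 1 q" and k: "V k"
  shows "- load \<le> (\<eta> * (LINT x|I. (q x)\<^sup>2) - (LINT x|I. f\<^sub>r x * v x))
      + \<mu> * (LINT x|I. (v x - (w x + T k x))\<^sup>2)
      + (\<gamma> * (LINT x|I. (w2 x + k x)\<^sup>2) - (LINT x|I. f\<^sub>p x * (w x + T k x)))"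
proof -
  define s where "s x = v x - (w x + T k x)" for x
  note L2 = clamped_L2[OF k] L2_w(2,3) f
  have wT: "L2 (-1) 1 (\<lambda>x. w x + T k x)" by (intro L2_add L2)
  have sL2: "L2 (-1) 1 s" unfolding s_def by (intro L2_diff v wT)
  have ff: "L2 (-1) 1 (\<lambda>x. f\<^sub>r x + f\<^sub>p x)" by (intro L2_add f)
  define A S B \<kappa> t where "A = nrm f\<^sub>r" and "S = nrm s"
    and "B = nrm (\<lambda>x. f\<^sub>r x + f\<^sub>p x)" and "\<kappa> = nrm k" and "t = nrm (T k)"
  define X where "X = (LINT x|I. (f\<^sub>r x + f\<^sub>p x) * T k x)"
  have fv: "(LINT x|I. f\<^sub>r x * v x) = (LINT x|I. f\<^sub>r x * s x) + (LINT x|I. f\<^sub>r x * (w x + T k x))"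
    using L2_integral_mult_lincomb[OF f(1) sL2 wT, of 1 1] by (simp add: s_def)
  have fw: "(LINT x|I. f\<^sub>r x * (w x + T k x)) + (LINT x|I. f\<^sub>p x * (w x + T k x))
      = (LINT x|I. (f\<^sub>r x + f\<^sub>p x) * w x) + X"
  proof -
    have "(LINT x|I. f\<^sub>r x * (w x + T k x)) + (LINT x|I. f\<^sub>p x * (w x + T k x))
        = (LINT x|I. f\<^sub>r x * (w x + T k x) + f\<^sub>p x * (w x + T k x))"
      by (rule Bochner_Integration.integral_add[symmetric]) (intro L2_mult_integrable f wT)+
    also have "\<dots> = (LINT x|I. (f\<^sub>r x + f\<^sub>p x) * (1 * w x + 1 * T k x))"
      by (rule Bochner_Integration.integral_cong) (auto simp: algebra_simps)
    also have "\<dots> = (LINT x|I. (f\<^sub>r x + f\<^sub>p x) * w x) + X"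
      unfolding L2_integral_mult_lincomb[OF ff L2(4,2)] X_def by simp
    finally show ?thesis .
  qed
  have 1: "(LINT x|I. f\<^sub>r x * s x) - \<mu> * S\<^sup>2 \<le> 1 / (4 * \<mu>) * A\<^sup>2"
  proof -
    have "(LINT x|I. f\<^sub>r x * s x) \<le> A * S"
      using L2_Cauchy_Schwarz[OF f(1) sL2] by (simp add: A_def S_def)
    moreover have "A * S - \<mu> * S\<^sup>2 \<le> 1 / (4 * \<mu>) * A\<^sup>2"
    proof -
      \<comment> \<open>The completed square: equality holds at S = A / (2 \<mu>), the maximizer of
        A S - \<mu> S^2.\<close>
      have "0 \<le> (A - 2 * \<mu> * S)\<^sup>2 / (4 * \<mu>)" using pos by simp
      also have "\<dots> = 1 / (4 * \<mu>) * A\<^sup>2 - (A * S - \<mu> * S\<^sup>2)"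
        using pos by (simp add: power2_eq_square field_simps)
      finally show ?thesis by simp
    qed
    ultimately show ?thesis by linarith
  qed
  have 2: "\<kappa>\<^sup>2 / 2 - (nrm w2)\<^sup>2 \<le> (LINT x|I. (w2 x + k x)\<^sup>2)"
  proof -
    have "\<kappa>\<^sup>2 / 2 - (nrm w2)\<^sup>2 = (LINT x|I. (k x)\<^sup>2 / 2 - (w2 x)\<^sup>2)"
      unfolding \<kappa>_def L2_norm_power2 using L2_integrable_power2[OF L2(1)] L2_integrable_power2[OF L2(3)] by simp
    also have "\<dots> \<le> (LINT x|I. (w2 x + k x)\<^sup>2)"
    proof (rule integral_mono)
      show "integrable (I) (\<lambda>x. (k x)\<^sup>2 / 2 - (w2 x)\<^sup>2)"
        using L2_integrable_power2[OF L2(1)] L2_integrable_power2[OF L2(3)] by simp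
      show "integrable (I) (\<lambda>x. (w2 x + k x)\<^sup>2)" by (intro L2_integrable_power2 L2_add L2)
      \<comment> \<open>The difference of the two sides is half the square of k + 2 w2.\<close>
      show "(k x)\<^sup>2 / 2 - (w2 x)\<^sup>2 \<le> (w2 x + k x)\<^sup>2" for x
        using zero_le_power2[of "k x + 2 * w2 x"] by (simp add: power2_eq_square algebra_simps)
    qed
    finally show ?thesis .
  qed
  have 3: "X \<le> C_P / (2 * \<gamma>) * B\<^sup>2 + \<gamma> / 2 * \<kappa>\<^sup>2"
  proof -
    have "X \<le> B * t" using L2_Cauchy_Schwarz[OF ff L2(2)] by (simp add: X_def B_def t_def)
    also have "\<dots> \<le> C_P / (2 * \<gamma>) * B\<^sup>2 + \<gamma> / 2 * \<kappa>\<^sup>2"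
      using C_P_bound[OF k] pos by (intro mult_le_weighted_squares) (auto simp: t_def \<kappa>_def B_def)
    finally show ?thesis .
  qed
  have 4: "\<gamma> * (\<kappa>\<^sup>2 / 2 - (nrm w2)\<^sup>2) \<le> \<gamma> * (LINT x|I. (w2 x + k x)\<^sup>2)"
    using 2 pos by (intro mult_left_mono) auto
  have 5: "0 \<le> \<eta> * (LINT x|I. (q x)\<^sup>2)" using pos by simp
  have S2: "(LINT x|I. (v x - (w x + T k x))\<^sup>2) = S\<^sup>2" by (simp add: S_def L2_norm_power2 s_def)
  show ?thesis unfolding S2 using 1 3 4 5 fv fw
    unfolding load_def A_def[symmetric] B_def[symmetric] by (simp add: right_diff_distrib)
qed

section \<open>Strict convexity, existence and uniqueness of the jump-free minimizer\<close>

lemma energy_ge: "V h \<Longrightarrow> V k \<Longrightarrow> - load \<le> energy h k"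
  using energy_parts_lower_bound[of "\<lambda>x. w x + T h x" "\<lambda>x. w2 x + h x" k]
  by (simp add: energy_def L2_add L2_w clamped_L2)

text \<open>The quantitative gain comes from the two bending terms alone; the loads are affine, and
  the midpoint gain of the coupling term is discarded.\<close>

lemma energy_midpoint:
  assumes c: "V h" "V k" "V h'" "V k'"
  shows "energy (\<lambda>x. 1/2 * h x + 1/2 * h' x) (\<lambda>x. 1/2 * k x + 1/2 * k' x) \<le> (energy h k + energy h' k') / 2
      - (\<eta> * (nrm (\<lambda>x. h x - h' x))\<^sup>2 + \<gamma> * (nrm (\<lambda>x. k x - k' x))\<^sup>2) / 4"
proof -
  note L2 = clamped_L2[OF c(1)] clamped_L2[OF c(2)] clamped_L2[OF c(3)] clamped_L2[OF c(4)]
  have Th: "T (\<lambda>x. 1/2 * h x + 1/2 * h' x) = (\<lambda>x. 1/2 * T h x + 1/2 * T h' x)"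
    by (rule ext, rule biprim_lincomb) (intro L2)+
  have Tk: "T (\<lambda>x. 1/2 * k x + 1/2 * k' x) = (\<lambda>x. 1/2 * T k x + 1/2 * T k' x)"
    by (rule ext, rule biprim_lincomb) (intro L2)+
  have sq: "(LINT x|I. (w2 x + (1/2 * g x + 1/2 * g' x))\<^sup>2) =
      ((LINT x|I. (w2 x + g x)\<^sup>2) + (LINT x|I. (w2 x + g' x)\<^sup>2)) / 2 - (nrm (\<lambda>x. g x - g' x))\<^sup>2 / 4"
    if "L2 (-1) 1 g" "L2 (-1) 1 g'" for g g'
  proof -
    have "w2 x + (1/2 * g x + 1/2 * g' x) = 1/2 * (w2 x + g x) + 1/2 * (w2 x + g' x)" for x
      by (simp add: field_simps)
    then have "(LINT x|I. (w2 x + (1/2 * g x + 1/2 * g' x))\<^sup>2) = (LINT x|I. (1/2 * (w2 x + g x) + 1/2 * (w2 x + g' x))\<^sup>2)"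
      by presburger
    also have "\<dots> = ((LINT x|I. (w2 x + g x)\<^sup>2) + (LINT x|I. (w2 x + g' x)\<^sup>2)) / 2
        - (nrm (\<lambda>x. (w2 x + g x) - (w2 x + g' x)))\<^sup>2 / 4"
      by (rule L2_parallelogram) (intro L2_add L2_w that)+
    finally show ?thesis by simp
  qed
  have lin: "(LINT x|I. \<phi> x * (w x + (1/2 * g x + 1/2 * g' x))) =
      ((LINT x|I. \<phi> x * (w x + g x)) + (LINT x|I. \<phi> x * (w x + g' x))) / 2"
    if "L2 (-1) 1 \<phi>" "L2 (-1) 1 g" "L2 (-1) 1 g'" for \<phi> g g'
  proof -
    have "w x + (1/2 * g x + 1/2 * g' x) = 1/2 * (w x + g x) + 1/2 * (w x + g' x)" for x
      by (simp add: field_simps)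
    then have "(LINT x|I. \<phi> x * (w x + (1/2 * g x + 1/2 * g' x))) = (LINT x|I. \<phi> x * (1/2 * (w x + g x) + 1/2 * (w x + g' x)))"
      by presburger
    also have "\<dots> = 1/2 * (LINT x|I. \<phi> x * (w x + g x)) + 1/2 * (LINT x|I. \<phi> x * (w x + g' x))"
      by (rule L2_integral_mult_lincomb) (intro L2_add L2_w that)+
    finally show ?thesis by simp
  qed
  have d: "(LINT x|I. ((1/2 * T h x + 1/2 * T h' x) - (1/2 * T k x + 1/2 * T k' x))\<^sup>2) \<le>
      ((LINT x|I. (T h x - T k x)\<^sup>2) + (LINT x|I. (T h' x - T k' x)\<^sup>2)) / 2"
  proof -
    have "(LINT x|I. ((1/2 * T h x + 1/2 * T h' x) - (1/2 * T k x + 1/2 * T k' x))\<^sup>2)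
        = (LINT x|I. (1/2 * (T h x - T k x) + 1/2 * (T h' x - T k' x))\<^sup>2)"
      by (rule Bochner_Integration.integral_cong) (auto simp: algebra_simps)
    also have "\<dots> = ((LINT x|I. (T h x - T k x)\<^sup>2) + (LINT x|I. (T h' x - T k' x)\<^sup>2)) / 2
        - (nrm (\<lambda>x. (T h x - T k x) - (T h' x - T k' x)))\<^sup>2 / 4"
      by (rule L2_parallelogram) (intro L2_diff L2)+
    also have "\<dots> \<le> ((LINT x|I. (T h x - T k x)\<^sup>2) + (LINT x|I. (T h' x - T k' x)\<^sup>2)) / 2"
      using zero_le_power2[of "nrm (\<lambda>x. (T h x - T k x) - (T h' x - T k' x))"] by linarith
    finally show ?thesis .
  qed
  have "\<mu> * (LINT x|I. ((1/2 * T h x + 1/2 * T h' x) - (1/2 * T k x + 1/2 * T k' x))\<^sup>2) \<le>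
      \<mu> * (((LINT x|I. (T h x - T k x)\<^sup>2) + (LINT x|I. (T h' x - T k' x)\<^sup>2)) / 2)"
    using d pos by (intro mult_left_mono) auto
  then show ?thesis
    unfolding energy_def Th Tk sq[OF L2(1,5)] sq[OF L2(3,7)] lin[OF f(1) L2(2,6)] lin[OF f(2) L2(4,8)]
    by (simp add: field_simps)
qed

lemma energy_min_exists:
  obtains h k where "V h" "V k"
    "\<And>h' k'. V h' \<Longrightarrow> V k' \<Longrightarrow> energy h k \<le> energy h' k'"
proof -
  define E where "E = {energy h k | h k. V h \<and> V k}"
  define m where "m = Inf E"
  have c0: "V (\<lambda>_. 0)" by (simp add: clamped_def L2_const prim_def)
  have ne: "E \<noteq> {}" using c0 unfolding E_def by blast
  have bdd: "bdd_below E" using energy_ge unfolding E_def by (intro bdd_belowI[of _ "- load"]) auto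
  have m_le: "m \<le> energy h k" if "V h" "V k" for h k
    unfolding m_def using that by (intro cInf_lower[OF _ bdd]) (auto simp: E_def)
  have "\<exists>h k. V h \<and> V k \<and> energy h k < m + 1 / real (Suc n)" for n
    using cInf_lessD[OF ne, of "m + 1 / real (Suc n)"] unfolding m_def[symmetric] by (auto simp: E_def)
  then obtain h k where hk: "\<And>n. V (h n)" "\<And>n. V (k n)"
    "\<And>n. energy (h n) (k n) < m + 1 / real (Suc n)" by metis
  note z = inverse_Suc_tendsto_0
  \<comment> \<open>The midpoint has energy at least \<open>m\<close>, the average exceeds
    \<open>m\<close> by less than half of 1/(i+1) + 1/(j+1), and the gain carries a factor 1/4:
    hence the factor 2.\<close>
  have mid: "\<eta> * (nrm (\<lambda>x. h i x - h j x))\<^sup>2 + \<gamma> * (nrm (\<lambda>x. k i x - k j x))\<^sup>2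
      \<le> 2 / real (Suc i) + 2 / real (Suc j)" for i j
  proof -
    have "m \<le> energy (\<lambda>x. 1/2 * h i x + 1/2 * h j x) (\<lambda>x. 1/2 * k i x + 1/2 * k j x)"
      by (intro m_le clamped_lincomb hk)
    also have "\<dots> \<le> (energy (h i) (k i) + energy (h j) (k j)) / 2
      - (\<eta> * (nrm (\<lambda>x. h i x - h j x))\<^sup>2 + \<gamma> * (nrm (\<lambda>x. k i x - k j x))\<^sup>2) / 4"
      by (intro energy_midpoint hk)
    finally have "m \<le> (energy (h i) (k i) + energy (h j) (k j)) / 2
      - (\<eta> * (nrm (\<lambda>x. h i x - h j x))\<^sup>2 + \<gamma> * (nrm (\<lambda>x. k i x - k j x))\<^sup>2) / 4" .
    moreover have "2 / real (Suc i) = 2 * (1 / real (Suc i))" "2 / real (Suc j) = 2 * (1 / real (Suc j))" by simp_all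
    ultimately show ?thesis using hk(3)[of i] hk(3)[of j] by argo
  qed
  have "\<eta> * (nrm (\<lambda>x. h i x - h j x))\<^sup>2 \<le> 2 / real (Suc i) + 2 / real (Suc j)"
    "\<gamma> * (nrm (\<lambda>x. k i x - k j x))\<^sup>2 \<le> 2 / real (Suc i) + 2 / real (Suc j)" for i j
  proof -
    have "0 \<le> \<gamma> * (nrm (\<lambda>x. k i x - k j x))\<^sup>2" "0 \<le> \<eta> * (nrm (\<lambda>x. h i x - h j x))\<^sup>2" using pos by simp_all
    then show "\<eta> * (nrm (\<lambda>x. h i x - h j x))\<^sup>2 \<le> 2 / real (Suc i) + 2 / real (Suc j)"
      "\<gamma> * (nrm (\<lambda>x. k i x - k j x))\<^sup>2 \<le> 2 / real (Suc i) + 2 / real (Suc j)"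
      using mid[of i j] by linarith+
  qed
  note rate = this
  obtain H where H: "L2_lim (-1) 1 h H"
    by (rule L2_complete_of_rate[OF clamped_L2(1)[OF hk(1)] _ pos(1) rate(1)]) simp
  obtain K where K: "L2_lim (-1) 1 k K"
    by (rule L2_complete_of_rate[OF clamped_L2(1)[OF hk(2)] _ pos(3) rate(2)]) simp
  have clH: "V H" by (rule clamped_lim[OF H hk(1)]) simp
  have clK: "V K" by (rule clamped_lim[OF K hk(2)]) simp
  have TH: "L2_lim (-1) 1 (\<lambda>n. T (h n)) (T H)" and TK: "L2_lim (-1) 1 (\<lambda>n. T (k n)) (T K)"
    using L2_lim_biprim[OF H] L2_lim_biprim[OF K] by auto
  note cw = L2_lim_const[OF L2_w(3)] and cw2 = L2_lim_const[OF L2_w(2)] and cf = L2_lim_const[OF f(1)] L2_lim_const[OF f(2)]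
  have "(\<lambda>n. energy (h n) (k n)) \<longlonglongrightarrow> energy H K"
    unfolding energy_def
    by (intro tendsto_intros L2_lim_integral_power2 L2_lim_integral_mult L2_lim_add L2_lim_diff H K TH TK cw cw2 cf)
  moreover have "(\<lambda>n. energy (h n) (k n)) \<longlonglongrightarrow> m"
  proof (rule tendsto_sandwich[OF _ _ tendsto_const])
    show "(\<lambda>n. m + 1 / real (Suc n)) \<longlonglongrightarrow> m" using tendsto_add[OF tendsto_const z, of m] by simp
    show "\<forall>\<^sub>F n in sequentially. m \<le> energy (h n) (k n)" by (intro always_eventually allI m_le hk)
    show "\<forall>\<^sub>F n in sequentially. energy (h n) (k n) \<le> m + 1 / real (Suc n)"
      by (intro always_eventually allI less_imp_le hk)
  qed
  ultimately have "energy H K = m" by (rule LIMSEQ_unique)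
  then show ?thesis using that[OF clH clK] m_le by simp
qed

text \<open>Second derivatives are determined only almost everywhere, but \<open>T\<close> does not
  see null sets, so the double primitives agree as functions.\<close>

lemma energy_min_unique:
  assumes c: "V h" "V k" "V h'" "V k'"
    and min: "\<And>h' k'. V h' \<Longrightarrow> V k' \<Longrightarrow> energy h k \<le> energy h' k'"
    and eq: "energy h' k' = energy h k"
  shows "T h' = T h" "T k' = T k"
proof -
  have "energy h k \<le> energy (\<lambda>x. 1/2 * h x + 1/2 * h' x) (\<lambda>x. 1/2 * k x + 1/2 * k' x)"
    by (intro min clamped_lincomb c)
  also have "\<dots> \<le> (energy h k + energy h' k') / 2
      - (\<eta> * (nrm (\<lambda>x. h x - h' x))\<^sup>2 + \<gamma> * (nrm (\<lambda>x. k x - k' x))\<^sup>2) / 4"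
    by (intro energy_midpoint c)
  finally have le: "\<eta> * (nrm (\<lambda>x. h x - h' x))\<^sup>2 + \<gamma> * (nrm (\<lambda>x. k x - k' x))\<^sup>2 \<le> 0"
    using eq by simp
  have nn: "0 \<le> \<eta> * (nrm (\<lambda>x. h x - h' x))\<^sup>2" "0 \<le> \<gamma> * (nrm (\<lambda>x. k x - k' x))\<^sup>2"
    using pos by auto
  have *: "T g' = T g" if "L2 (-1) 1 g" "L2 (-1) 1 g'" "(nrm (\<lambda>x. g x - g' x))\<^sup>2 = 0" for g g'
  proof (rule biprim_AE_cong)
    have "AE x in I. (g x - g' x)\<^sup>2 = 0"
      using that(3) integral_nonneg_eq_0_iff_AE[OF L2_integrable_power2[OF L2_diff[OF that(1,2)]]]
      by (simp add: L2_norm_power2)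
    then show "AE x in I. g' x = g x" by eventually_elim simp
  qed
  have "\<eta> * (nrm (\<lambda>x. h x - h' x))\<^sup>2 = 0" using le nn by linarith
  then show "T h' = T h" using pos c clamped_L2 by (intro *) auto
  have "\<gamma> * (nrm (\<lambda>x. k x - k' x))\<^sup>2 = 0" using le nn by linarith
  then show "T k' = T k" using pos c clamped_L2 by (intro *) auto
qed

section \<open>From the energy back to \<open>F1\<close> and to all admissible pairs\<close>

lemma jump_free_values_eq:
  "jump_free_values \<alpha> \<beta> \<eta> \<mu> \<gamma> f\<^sub>r f\<^sub>p w = {energy h k | h k. V h \<and> V k}"
proof -
  \<comment> \<open>The double primitive of a clamped function vanishes outside (-1,1), so the
    extension by \<open>w\<close> obeys the same formula on all of (-2,2).\<close>
  have ext: "AE x in leb (-2) 2. extend_by w v x = w x + T h x"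
    if h: "V h" and ae: "AE x in I. v x - w x = T h x" for v h
    unfolding AE_leb_iff using ae[unfolded AE_leb_iff]
  proof eventually_elim
    case (elim x)
    then show ?case using clamped_biprim_outside(2)[OF h, of x]
      by (cases "x \<le> -1 \<or> 1 \<le> x") (auto simp: extend_by_def algebra_simps)
  qed
  have "\<exists>h k. y = energy h k \<and> V h \<and> V k"
    if y: "y = F (extend_by w v\<^sub>r) (extend_by w v\<^sub>p)"
      and v: "H20 (-1) 1 (\<lambda>x. v\<^sub>r x - w x)" "H20 (-1) 1 (\<lambda>x. v\<^sub>p x - w x)" for y v\<^sub>r v\<^sub>p
  proof -
    obtain h where h: "V h" "AE x in I. v\<^sub>r x - w x = T h x"
      using H20_imp_clamped[OF v(1)] by (auto simp: biprim_def)
    obtain k where k: "V k" "AE x in I. v\<^sub>p x - w x = T k x"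
      using H20_imp_clamped[OF v(2)] by (auto simp: biprim_def)
    show ?thesis using F1_jump_free[OF h(1) k(1) ext[OF h] ext[OF k]] y h(1) k(1) by blast
  qed
  moreover have "\<exists>v\<^sub>r v\<^sub>p. energy h k = F (extend_by w v\<^sub>r) (extend_by w v\<^sub>p) \<and>
      H20 (-1) 1 (\<lambda>x. v\<^sub>r x - w x) \<and> H20 (-1) 1 (\<lambda>x. v\<^sub>p x - w x)"
    if hk: "V h" "V k" for h k
  proof -
    have H20: "H20 (-1) 1 (\<lambda>x. (w x + T g x) - w x)" if "V g" for g
      by (rule clamped_imp_H20[OF that]) (simp_all add: biprim_def)
    have ae: "AE x in I. (w x + T g x) - w x = T g x" for g by simp
    show ?thesis
      using F1_jump_free[OF hk ext[OF hk(1) ae] ext[OF hk(2) ae]] H20[OF hk(1)] H20[OF hk(2)]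
      by (intro exI[of _ "\<lambda>x. w x + T h x"] exI[of _ "\<lambda>x. w x + T k x"]) auto
  qed
  ultimately show ?thesis unfolding jump_free_values_def by blast
qed

lemma F1_admissible_cases:
  assumes adm: "admissible w (v\<^sub>r, v\<^sub>p)"
  obtains "\<beta> - load \<le> F v\<^sub>r v\<^sub>p"
  | h k where "V h" "V k" "AE x in leb (-2) 2. v\<^sub>r x = w x + T h x"
      "AE x in leb (-2) 2. v\<^sub>p x = w x + T k x" "F v\<^sub>r v\<^sub>p = energy h k"
proof -
  obtain k where k: "V k" "AE x in leb (-2) 2. v\<^sub>p x = w x + T k x"
    using admissible_plate[OF adm] by blast
  have "pw_H2 (-2) 2 v\<^sub>r" using adm by (simp add: admissible_def)
  then obtain C D q P J K where r: "jump_rep2 (-2) 2 v\<^sub>r C D q P J K"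
    by (rule pw_H2_imp_jump_rep2) simp
  \<comment> \<open>Partition points with no jump and no crease may lie in \<open>P\<close>, so the
    distinction is made on the genuine singularities.\<close>
  let ?A = "{s\<in>P. J s \<noteq> 0}" and ?B = "{s\<in>P. K s \<noteq> 0}"
  have fin: "finite P" using r by (simp add: jump_rep2_def)
  show ?thesis
  proof (cases "?A \<union> ?B = {}")
    case True
    have "AE x in leb (-2) 2. v\<^sub>r x = C + prim (-2) 2 (\<lambda>t. D + prim (-2) 2 q t) x"
      by (rule jump_rep2_continuous[OF r]) (use True in auto)
    moreover have "L2 (-2) 2 q" using r by (simp add: jump_rep2_def)
    ultimately have h: "V (\<lambda>x. q x - w2 x)" "AE x in leb (-2) 2. v\<^sub>r x = w x + T (\<lambda>x. q x - w2 x) x"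
      using prim_imp_clamped[OF _ _ admissible_outside(1,2)[OF adm]] by blast+
    show ?thesis using that(2)[OF h(1) k(1) h(2) k(2) F1_jump_free[OF h(1) k(1) h(2) k(2)]] .
  next
    case False
    \<comment> \<open>If there is a jump it pays \<alpha>, which is at least \<beta>; if there is
      none, every crease lies off the jump set and pays \<beta>.\<close>
    have "\<beta> \<le> \<alpha> * real (card ?A) + \<beta> * real (card (?B - ?A))"
    proof (cases "?A = {}")
      case True
      then have "?B - ?A \<noteq> {}" using False by blast
      then have "card (?B - ?A) \<ge> 1" using fin by (simp add: Suc_le_eq card_gt_0_iff)
      then have "\<beta> * 1 \<le> \<beta> * real (card (?B - ?A))" using \<beta> by (intro mult_left_mono) auto
      then show ?thesis unfolding True by simp
    next
      case False
      then have "card ?A \<ge> 1" using fin by (simp add: Suc_le_eq card_gt_0_iff)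
      then have "\<alpha> * 1 \<le> \<alpha> * real (card ?A)" using \<beta> by (intro mult_left_mono) auto
      moreover have "0 \<le> \<beta> * real (card (?B - ?A))" using \<beta> by simp
      ultimately show ?thesis using \<beta> by linarith
    qed
    then have "\<beta> - load \<le> F v\<^sub>r v\<^sub>p"
      using energy_parts_lower_bound[OF F1_rep(2,3)[OF r k] k(1)] unfolding F1_rep(1)[OF r k] by linarith
    then show ?thesis by (rule that(1))
  qed
qed

lemma admissible_jump_free:
  assumes h: "V h" and k: "V k"
  shows "admissible w (\<lambda>x. w x + T h x, \<lambda>x. w x + T k x)"
proof -
  let ?s = "\<lambda>i::nat. if i = 0 then -2 else (2::real)"
  have H: "H2 (-2) 2 (\<lambda>x. w x + T g x)" if "V g" for g
    by (rule jump_free_rep(2)[OF that]) simp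
  have "pw_H2 (-2) 2 (\<lambda>x. w x + T h x)"
    unfolding pw_H2_def by (rule exI[of _ 1], rule exI[of _ ?s]) (use H[OF h] in simp)
  moreover have "AE x in lebesgue_on ({-2<..<-1} \<union> {1<..<2}). w x + T h x = w x \<and> w x + T k x = w x"
    using clamped_biprim_outside(2)[OF h] clamped_biprim_outside(2)[OF k] by (intro AE_I2) auto
  ultimately show ?thesis using H[OF k] by (simp add: admissible_def)
qed

theorem unique_minimizer:
  defines "M \<equiv> Inf (jump_free_values \<alpha> \<beta> \<eta> \<mu> \<gamma> f\<^sub>r f\<^sub>p w)"
  shows "(M \<in> jump_free_values \<alpha> \<beta> \<eta> \<mu> \<gamma> f\<^sub>r f\<^sub>p w \<and>
          (\<forall>y \<in> jump_free_values \<alpha> \<beta> \<eta> \<mu> \<gamma> f\<^sub>r f\<^sub>p w. M \<le> y)) \<and>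
    (load < \<beta> - M \<longrightarrow>
     (\<exists>u\<^sub>r u\<^sub>p. minimizer \<alpha> \<beta> \<eta> \<mu> \<gamma> f\<^sub>r f\<^sub>p w u\<^sub>r u\<^sub>p \<and>
        (\<forall>v\<^sub>r v\<^sub>p. minimizer \<alpha> \<beta> \<eta> \<mu> \<gamma> f\<^sub>r f\<^sub>p w v\<^sub>r v\<^sub>p \<longrightarrow>
           (AE x in lebesgue_on {-2<..<2}. v\<^sub>r x = u\<^sub>r x \<and> v\<^sub>p x = u\<^sub>p x)) \<and>
        disc_set (-2) 2 u\<^sub>r \<union> disc_set (-2) 2 (ac_deriv (-2) 2 u\<^sub>r) = {} \<and>
        H20 (-2) 2 (\<lambda>x. u\<^sub>r x - w x)))"
proof -
  obtain h k where h: "V h" and k: "V k"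
    and min: "\<And>h' k'. V h' \<Longrightarrow> V k' \<Longrightarrow> energy h k \<le> energy h' k'"
    using energy_min_exists by blast
  have in_set: "energy h k \<in> jump_free_values \<alpha> \<beta> \<eta> \<mu> \<gamma> f\<^sub>r f\<^sub>p w"
    and least: "\<And>y. y \<in> jump_free_values \<alpha> \<beta> \<eta> \<mu> \<gamma> f\<^sub>r f\<^sub>p w \<Longrightarrow> energy h k \<le> y"
    unfolding jump_free_values_eq using h k min by blast+
  have M: "M = energy h k" unfolding M_def by (rule cInf_eq_minimum[OF in_set least])
  define u\<^sub>r u\<^sub>p where "u\<^sub>r x = w x + T h x" and "u\<^sub>p x = w x + T k x" for x
  have u: "AE x in leb (-2) 2. u\<^sub>r x = w x + T h x" "AE x in leb (-2) 2. u\<^sub>p x = w x + T k x"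
    by (simp_all add: u\<^sub>r_def u\<^sub>p_def)
  have adm_u: "admissible w (u\<^sub>r, u\<^sub>p)"
    using admissible_jump_free[OF h k] by (simp add: u\<^sub>r_def[abs_def] u\<^sub>p_def[abs_def])
  have F1_u: "F u\<^sub>r u\<^sub>p = M" unfolding M by (rule F1_jump_free[OF h k u])
  have disc: "disc_set (-2) 2 u\<^sub>r \<union> disc_set (-2) 2 (ac_deriv (-2) 2 u\<^sub>r) = {}"
    using jump_rep2_ac_derivs(3,4)[OF jump_free_rep(1)[OF h u(1)]] by simp
  have H20: "H20 (-2) 2 (\<lambda>x. u\<^sub>r x - w x)"
    by (rule clamped_imp_H20[OF clamped_extend(1)[OF h, of "-2" 2]])
       (use clamped_extend(2)[OF h, of "-2" 2] in \<open>simp_all add: biprim_def u\<^sub>r_def\<close>)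
  have "minimizer \<alpha> \<beta> \<eta> \<mu> \<gamma> f\<^sub>r f\<^sub>p w u\<^sub>r u\<^sub>p \<and>
      (\<forall>v\<^sub>r v\<^sub>p. minimizer \<alpha> \<beta> \<eta> \<mu> \<gamma> f\<^sub>r f\<^sub>p w v\<^sub>r v\<^sub>p \<longrightarrow>
           (AE x in leb (-2) 2. v\<^sub>r x = u\<^sub>r x \<and> v\<^sub>p x = u\<^sub>p x))" if load: "load < \<beta> - M"
  proof (intro conjI allI impI)
    have "M \<le> F v\<^sub>r v\<^sub>p" if "admissible w (v\<^sub>r, v\<^sub>p)" for v\<^sub>r v\<^sub>p
      using that
    proof (cases rule: F1_admissible_cases)
      case 1
      then show ?thesis using load by linarith
    next
      case (2 h' k')
      then show ?thesis using min M by simp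
    qed
    then show "minimizer \<alpha> \<beta> \<eta> \<mu> \<gamma> f\<^sub>r f\<^sub>p w u\<^sub>r u\<^sub>p"
      unfolding minimizer_def is_arg_min_def using adm_u F1_u by (auto simp: not_less)
    fix v\<^sub>r v\<^sub>p assume "minimizer \<alpha> \<beta> \<eta> \<mu> \<gamma> f\<^sub>r f\<^sub>p w v\<^sub>r v\<^sub>p"
    then have v: "admissible w (v\<^sub>r, v\<^sub>p)" "F v\<^sub>r v\<^sub>p \<le> M"
      unfolding minimizer_def is_arg_min_def using adm_u F1_u by (auto simp: not_less)
    from v(1) show "AE x in leb (-2) 2. v\<^sub>r x = u\<^sub>r x \<and> v\<^sub>p x = u\<^sub>p x"
    proof (cases rule: F1_admissible_cases)
      \<comment> \<open>A singular competitor has energy at least \<beta> - \<open>load\<close>,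
        which the strict assumption places above \<open>M\<close>.\<close>
      case 1
      then show ?thesis using v(2) load by linarith
    next
      case (2 h' k')
      then have "energy h' k' = energy h k" using v(2) min[OF 2(1,2)] M by linarith
      then have "T h' = T h" "T k' = T k" using energy_min_unique[OF h k 2(1,2) min] by blast+
      then show ?thesis using 2(3,4) by (simp add: u\<^sub>r_def u\<^sub>p_def)
    qed
  qed
  then show ?thesis using in_set least disc H20 unfolding M by blast
qed

end

theorem theorem3p4:
  fixes w f\<^sub>r f\<^sub>p :: "real \<Rightarrow> real" and \<alpha> \<beta> \<eta> \<mu> \<gamma> M :: real
  assumes "C2_on (-2) 2 w"
    and "\<eta> > 0" and "\<mu> > 0" and "\<gamma> > 0"
    and "L2 (-1) 1 f\<^sub>r" and "L2 (-1) 1 f\<^sub>p"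
    and "0 < \<beta>" and "\<beta> \<le> \<alpha>" and "\<alpha> \<le> 2 * \<beta>"
  defines "M \<equiv> Inf (jump_free_values \<alpha> \<beta> \<eta> \<mu> \<gamma> f\<^sub>r f\<^sub>p w)"
  shows "(M \<in> jump_free_values \<alpha> \<beta> \<eta> \<mu> \<gamma> f\<^sub>r f\<^sub>p w \<and>
          (\<forall>y \<in> jump_free_values \<alpha> \<beta> \<eta> \<mu> \<gamma> f\<^sub>r f\<^sub>p w. M \<le> y)) \<and>
    (1 / (4 * \<mu>) * (L2_norm (-1) 1 f\<^sub>r)\<^sup>2
      + C_P / (2 * \<gamma>) * (L2_norm (-1) 1 (\<lambda>x. f\<^sub>r x + f\<^sub>p x))\<^sup>2
      + \<gamma> * (L2_norm (-1) 1 (deriv (deriv w)))\<^sup>2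
      + (LINT x|lebesgue_on {-1<..<1}. (f\<^sub>r x + f\<^sub>p x) * w x) < \<beta> - M
     \<longrightarrow>
     (\<exists>u\<^sub>r u\<^sub>p. minimizer \<alpha> \<beta> \<eta> \<mu> \<gamma> f\<^sub>r f\<^sub>p w u\<^sub>r u\<^sub>p \<and>
        (\<forall>v\<^sub>r v\<^sub>p. minimizer \<alpha> \<beta> \<eta> \<mu> \<gamma> f\<^sub>r f\<^sub>p w v\<^sub>r v\<^sub>p \<longrightarrow>
           (AE x in lebesgue_on {-2<..<2}. v\<^sub>r x = u\<^sub>r x \<and> v\<^sub>p x = u\<^sub>p x)) \<and>
        disc_set (-2) 2 u\<^sub>r \<union> disc_set (-2) 2 (ac_deriv (-2) 2 u\<^sub>r) = {} \<and>
        H20 (-2) 2 (\<lambda>x. u\<^sub>r x - w x)))"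
proof -
  obtain w1 w2 where w1: "\<forall>x\<in>{-2..2}. (w has_real_derivative w1 x) (at x within {-2..2})"
    and w2: "\<forall>x\<in>{-2..2}. (w1 has_real_derivative w2 x) (at x within {-2..2})" and c: "continuous_on {-2..2} w2"
    using assms(1) unfolding C2_on_def by blast
  interpret plate_problem w w1 w2 f\<^sub>r f\<^sub>p \<alpha> \<beta> \<eta> \<mu> \<gamma>
    by unfold_locales (use assms w1 w2 c in auto)
  \<comment> \<open>In the open interval (-2,2), which contains (-1,1), the derivatives within the
    closed interval are two-sided and coincide with \<open>deriv\<close>.\<close>
  have d1: "deriv w x = w1 x" if "x \<in> {-2<..<2}" for x
    using w1[rule_format, of x] that at_within_Icc_at[of "-2" x 2] by (intro DERIV_imp_deriv) auto
  have "deriv (deriv w) x = w2 x" if x: "x \<in> {-2<..<2}" for x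
  proof -
    have "\<forall>\<^sub>F y in nhds x. deriv w y = w1 y"
      using eventually_nhds_in_open[OF _ x] by (rule eventually_mono) (auto intro: d1)
    then have "deriv (deriv w) x = deriv w1 x" by (intro deriv_cong_ev) auto
    also have "\<dots> = w2 x"
      using w2[rule_format, of x] x at_within_Icc_at[of "-2" x 2] by (intro DERIV_imp_deriv) auto
    finally show ?thesis .
  qed
  then have "L2_norm (-1) 1 (deriv (deriv w)) = L2_norm (-1) 1 w2"
    by (intro L2_norm_AE_cong AE_I2) auto
  then show ?thesis using unique_minimizer unfolding load_def M_def by simp
qed

end
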